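(* Let $P$ be a full-dimensional simple lattice polytope in $M_{\mathbb R}\simeq\mathbb R^n$ with facets $F_1,\dots,F_r$ and inner normal fan $\Sigma$ with rays $\Sigma(1)=\{\rho_1,\dots,\rho_r\}$ ($\rho_i$ corresponding to the facet $F_i$). For a subset $K\subseteq\{1,\dots,r\}$ let $P^K=P\setminus\bigcup_{i\in K}F_i$, and let $$Todd^K\Big(\frac{\partial}{\partial h}\Big):=\sum_{g\in G_\Sigma}\prod_{i\in K}\frac{a_{\rho_i}(g)\cdot\frac{\partial}{\partial h_i}\cdot e^{-\frac{\partial}{\partial h_i}}}{1-a_{\rho_i}(g)\cdot e^{-\frac{\partial}{\partial h_i}}}\cdot\prod_{i\notin K}\frac{\frac{\partial}{\partial h_i}}{1-a_{\rho_i}(g)\cdot e^{-\frac{\partial}{\partial h_i}}}.$$ Let $f$ be a polynomial function on $M_{\mathbb R}$. Then: $$Todd^K\Big(\frac{\partial}{\partial h}\Big)\Big(\int_{P(h)}f(m)\,dm\Big)\Big|_{h=0}=\sum_{m\in P^K\cap M}f(m).$$ In the local case of the tangent cone $Tan(P,v)=v+C_v$ of $P$ at a vertex $v$, with corresponding cone $\sigma=C_v^\vee\in\Sigma(n)$, we get, for $z\in N_{\mathbb C}$ small enough with $-z\in\mathrm{Int}(\sigma)$: $$Todd^K\Big(\frac{\partial}{\partial h}\Big)\Big(\int_{Tan(P,v)(h)}e^{\langle m,z\rangle}\,dm\Big)\Big|_{h=0}=\sum_{m\in Tan(P,v)^K\cap M}e^{\langle m,z\rangle}.$$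
   Context: $M\simeq\mathbb Z^n$ is a lattice with dual $N$ and pairing $\langle\cdot,\cdot\rangle$; $N_{\mathbb C}=N\otimes\mathbb C$; $\mathbb T=N\otimes\mathbb C^*$; $u\in N$ is viewed as a one-parameter subgroup $u:\mathbb C^*\to\mathbb T$. Simple means each vertex of $P$ lies on exactly $n$ facets. $P=\{m\in M_{\mathbb R}\mid\langle m,u_{\rho_i}\rangle+c_i\ge0,\ i=1,\dots,r\}$ with $u_{\rho_i}\in N$ the ray generators and $c_i\in\mathbb Z$. For a small real vector $h=(h_1,\dots,h_r)$, $P(h)=\{m\mid\langle m,u_{\rho_i}\rangle+c_i+h_i\ge0\ \forall i\}$. $C_v=\mathrm{Cone}(P\cap M-v)$, $Tan(P,v)(h)=\{m\mid\langle m,u_{\rho_i}\rangle+c_i+h_i\ge0\ \forall i\text{ with }\rho_i\in\sigma(1)\}$, and $Tan(P,v)^K$ is $Tan(P,v)$ with the facets corresponding to those $i\in K$ with $\rho_i\in\sigma(1)$ removed. $\mathrm{Int}(\sigma)\subset N_{\mathbb R}\subset N_{\mathbb C}$. Lebesgue measure is normalized so that the unit cube of $M$ has volume $1$. $G=\ker\big((\mathbb C^* )^{\Sigma(1)}\to\mathbb T,\ (t_\rho)\mapsto\prod_\rho u_\rho(t_\rho)\big)$, $a_\rho$ is the projection to the $\rho$-th factor, $G_\tau=\{g\in G\mid a_\rho(g)=1\ \forall\rho\notin\tau(1)\}$ for $\tau\in\Sigma$, and $G_\Sigma=\bigcup_{\tau\in\Sigma}G_\tau$ (a finite set). The operator is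 read as a power series in the $\frac{\partial}{\partial h_i}$; infinite order operators are applied as limits of their truncations (in the polynomial case only finitely many terms contribute). In the local case derivatives with respect to $h_i$ with $\rho_i\notin\sigma(1)$ act as zero (equivalently, one uses the fan $\sigma$ and $G_\sigma$ in place of $\Sigma$ and $G_\Sigma$). *)

theory Defs
  imports "HOL-Analysis.Analysis" "HOL-Computational_Algebra.Formal_Power_Series"
begin

text \<open>
  Coordinates are chosen so that \<open>M = N = \<int>\<^sup>n\<close> is the type \<^typ>\<open>int ^ 'n\<close>, with
  \<open>M\<^sub>\<real> = N\<^sub>\<real>\<close> the type \<^typ>\<open>real ^ 'n\<close> and \<open>N\<^sub>\<complex>\<close> the type \<^typ>\<open>complex ^ 'n\<close>.
  The pairing becomes the standard inner product, the torus \<open>N \<otimes> \<complex>\<^sup>*\<close> becomes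
  \<open>(\<complex>\<^sup>*)\<^sup>n\<close>, and the normalised Lebesgue measure becomes \<open>lborel\<close>.
  The facets, and the rays of the normal fan, are indexed by a finite linearly ordered type \<open>'r\<close>.
\<close>

definition rvec :: "int ^ 'n \<Rightarrow> real ^ 'n" where
  "rvec m = (\<chi> j. of_int (m $ j))"

definition cvec :: "real ^ 'n \<Rightarrow> complex ^ 'n" where
  "cvec w = (\<chi> j. of_real (w $ j))"

definition cpair :: "real ^ 'n \<Rightarrow> complex ^ 'n \<Rightarrow> complex" where
  "cpair m z = (\<Sum>j\<in>UNIV. of_real (m $ j) * z $ j)"

definition lattice_pts :: "(real ^ 'n) set \<Rightarrow> (int ^ 'n) set" where
  "lattice_pts S = {m. rvec m \<in> S}"

definition lattice_polytope :: "(real ^ 'n) set \<Rightarrow> bool" where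
  "lattice_polytope P \<longleftrightarrow> (\<exists>V. finite V \<and> P = convex hull (rvec ` V))"

definition simple_polytope :: "(real ^ 'n) set \<Rightarrow> bool" where
  "simple_polytope P \<longleftrightarrow>
     (\<forall>v. v extreme_point_of P \<longrightarrow> card {Q. Q facet_of P \<and> v \<in> Q} = CARD('n))"

definition normal_cone :: "(real ^ 'n) set \<Rightarrow> (real ^ 'n) set \<Rightarrow> (real ^ 'n) set" where
  "normal_cone P Q = {w. \<forall>m\<in>Q. \<forall>m'\<in>P. m \<bullet> w \<le> m' \<bullet> w}"

definition normal_fan :: "(real ^ 'n) set \<Rightarrow> (real ^ 'n) set set" where
  "normal_fan P = {normal_cone P Q |Q. Q face_of P \<and> Q \<noteq> {}}"

definition cone_rays :: "(real ^ 'n) set \<Rightarrow> (real ^ 'n) set set" where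
  "cone_rays \<tau> = {\<rho>. \<rho> face_of \<tau> \<and> dim \<rho> = 1}"

text \<open>The ray generator of \<open>\<rho>\<close> is the generator of the semigroup \<open>\<rho> \<inter> N\<close>.\<close>

definition ray_generator :: "(real ^ 'n) set \<Rightarrow> int ^ 'n \<Rightarrow> bool" where
  "ray_generator \<rho> w \<longleftrightarrow> lattice_pts \<rho> = range (\<lambda>k::nat. of_nat k *s w)"

definition dual_cone :: "(real ^ 'n) set \<Rightarrow> (real ^ 'n) set" where
  "dual_cone C = {w. \<forall>m\<in>C. 0 \<le> m \<bullet> w}"

definition polytope_shift ::
    "('r::finite \<Rightarrow> int ^ 'n) \<Rightarrow> ('r \<Rightarrow> int) \<Rightarrow> real ^ 'r \<Rightarrow> (real ^ 'n) set" where
  "polytope_shift u c h = {m. \<forall>i. 0 \<le> m \<bullet> rvec (u i) + of_int (c i) + h $ i}"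

definition vertex_cone :: "(real ^ 'n) set \<Rightarrow> real ^ 'n \<Rightarrow> (real ^ 'n) set" where
  "vertex_cone P v = convex_cone hull ((\<lambda>m. rvec m - v) ` lattice_pts P)"

definition tangent :: "(real ^ 'n) set \<Rightarrow> real ^ 'n \<Rightarrow> (real ^ 'n) set" where
  "tangent P v = (\<lambda>m. v + m) ` vertex_cone P v"

definition tangent_shift ::
    "('r::finite \<Rightarrow> (real ^ 'n) set) \<Rightarrow> ('r \<Rightarrow> int ^ 'n) \<Rightarrow> ('r \<Rightarrow> int) \<Rightarrow> (real ^ 'n) set
      \<Rightarrow> real ^ 'r \<Rightarrow> (real ^ 'n) set" where
  "tangent_shift \<rho> u c \<sigma> h =
     {m. \<forall>i. \<rho> i \<in> cone_rays \<sigma> \<longrightarrow> 0 \<le> m \<bullet> rvec (u i) + of_int (c i) + h $ i}"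

text \<open>Only the facets of the tangent cone whose index lies in \<open>K\<close> and whose ray lies in \<open>\<sigma>\<close> are removed.\<close>

definition tangent_removed ::
    "('r \<Rightarrow> (real ^ 'n) set) \<Rightarrow> ('r \<Rightarrow> int ^ 'n) \<Rightarrow> ('r \<Rightarrow> int) \<Rightarrow> (real ^ 'n) set
      \<Rightarrow> real ^ 'n \<Rightarrow> (real ^ 'n) set \<Rightarrow> 'r set \<Rightarrow> (real ^ 'n) set" where
  "tangent_removed \<rho> u c P v \<sigma> K =
     tangent P v - (\<Union>i\<in>{i\<in>K. \<rho> i \<in> cone_rays \<sigma>}.
       {m \<in> tangent P v. m \<bullet> rvec (u i) + of_int (c i) = 0})"

definition one_param :: "int ^ 'n \<Rightarrow> complex \<Rightarrow> complex ^ 'n" where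
  "one_param w t = (\<chi> j. t powi (w $ j))"

definition grp_G :: "('r::finite \<Rightarrow> int ^ 'n) \<Rightarrow> (complex ^ 'r) set" where
  "grp_G u = {g. (\<forall>i. g $ i \<noteq> 0) \<and> (\<Prod>i\<in>UNIV. one_param (u i) (g $ i)) = 1}"

definition grp_cone ::
    "('r::finite \<Rightarrow> (real ^ 'n) set) \<Rightarrow> ('r \<Rightarrow> int ^ 'n) \<Rightarrow> (real ^ 'n) set \<Rightarrow> (complex ^ 'r) set" where
  "grp_cone \<rho> u \<tau> = {g \<in> grp_G u. \<forall>i. \<rho> i \<notin> cone_rays \<tau> \<longrightarrow> g $ i = 1}"

definition grp_fan ::
    "('r::finite \<Rightarrow> (real ^ 'n) set) \<Rightarrow> ('r \<Rightarrow> int ^ 'n) \<Rightarrow> (real ^ 'n) set set \<Rightarrow> (complex ^ 'r) set" where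
  "grp_fan \<rho> u \<Sigma> = (\<Union>\<tau>\<in>\<Sigma>. grp_cone \<rho> u \<tau>)"

text \<open>
  The \<open>i\<close>-th factor of the Todd operator as a formal power series in \<open>\<partial>/\<partial>h\<^sub>i\<close>, where \<open>a = a\<^sub>\<rho>(g)\<close> and
  \<open>b\<close> says whether \<open>i \<in> K\<close>. For \<open>a = 1\<close> the denominator has subdegree 1, and the division
  of formal power series cancels the common factor \<open>X\<close>.
\<close>

definition todd_factor :: "bool \<Rightarrow> complex \<Rightarrow> complex fps" where
  "todd_factor b a =
     (if b then (fps_const a * fps_X * fps_exp (-1)) / (1 - fps_const a * fps_exp (-1))
      else fps_X / (1 - fps_const a * fps_exp (-1)))"

text \<open>
  The coefficient of \<open>\<partial>\<^sup>\<alpha>\<close> in the Todd operator. The set \<open>\<Gamma>\<close> is meant to be \<open>G\<^sub>\<Sigma>\<close>, which is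
  finite for a simplicial fan; over an infinite \<open>\<Gamma>\<close> the sum would be 0.
\<close>

definition todd_coeff :: "(complex ^ 'r::finite) set \<Rightarrow> 'r set \<Rightarrow> ('r \<Rightarrow> nat) \<Rightarrow> complex" where
  "todd_coeff \<Gamma> K \<alpha> = (\<Sum>g\<in>\<Gamma>. \<Prod>i\<in>UNIV. fps_nth (todd_factor (i \<in> K) (g $ i)) (\<alpha> i))"

definition pderiv_dir :: "'r::finite \<Rightarrow> (real ^ 'r \<Rightarrow> complex) \<Rightarrow> real ^ 'r \<Rightarrow> complex" where
  "pderiv_dir i \<phi> h = vector_derivative (\<lambda>t. \<phi> (h + t *\<^sub>R axis i 1)) (at 0)"

text \<open>
  The derivatives are taken in the order given by the linear order on the indices; this order
  is immaterial for the functions satisfying \<open>smooth_near_0\<close> below.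
\<close>

definition mixed_partial ::
    "('r::{finite,linorder} \<Rightarrow> nat) \<Rightarrow> (real ^ 'r::{finite,linorder} \<Rightarrow> complex)
      \<Rightarrow> real ^ 'r::{finite,linorder} \<Rightarrow> complex" where
  "mixed_partial \<alpha> \<phi> = foldr (\<lambda>i. pderiv_dir i ^^ \<alpha> i) (sorted_list_of_set UNIV) \<phi>"

definition smooth_near_0 :: "(real ^ 'r::finite \<Rightarrow> complex) \<Rightarrow> bool" where
  "smooth_near_0 \<phi> \<longleftrightarrow>
     (\<exists>\<epsilon>>0. \<forall>js. \<forall>h\<in>ball 0 \<epsilon>. foldr pderiv_dir js \<phi> differentiable (at h))"

text \<open>
  \<open>todd_at_0 \<Gamma> K \<phi> s\<close> says that the Todd operator of \<open>K\<close>, with \<open>\<Gamma>\<close> in place of \<open>G\<^sub>\<Sigma>\<close>, can be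
  applied to \<open>\<phi>\<close> and that the result takes the value \<open>s\<close> at \<open>h = 0\<close>: \<open>\<phi>\<close> is infinitely
  differentiable near 0, so that the derivatives are genuine and commute, and the truncations
  of the operator by total order, applied to \<open>\<phi>\<close> at 0, converge to \<open>s\<close>.
\<close>

definition todd_at_0 ::
    "(complex ^ 'r::{finite,linorder}) set \<Rightarrow> 'r set
      \<Rightarrow> (real ^ 'r::{finite,linorder} \<Rightarrow> complex) \<Rightarrow> complex \<Rightarrow> bool" where
  "todd_at_0 \<Gamma> K \<phi> s \<longleftrightarrow> smooth_near_0 \<phi> \<and>
     (\<lambda>d::nat. \<Sum>\<alpha> | (\<Sum>i\<in>UNIV. \<alpha> i) \<le> d. todd_coeff \<Gamma> K \<alpha> * mixed_partial \<alpha> \<phi> 0) \<longlonglongrightarrow> s"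

end

theory Submission
  imports Defs
begin

text \<open> The proof uses the Lawrence--Varchenko polar decomposition. A generic covector
  \<open>\<xi>\<close> has coordinates \<open>\<xi> \<bullet> d v i\<close> with respect to the facet
  normals at each vertex \<open>v\<close>; flipping the inequalities with a negative coordinate turns every
  tangent cone into a signed half-open cone on which \<open>exp (- m \<bullet> \<xi>)\<close> decays, and
  the signed indicators of these cones add up to the indicator of \<open>P(h)\<close> for all small
  \<open>h\<close>. Over one simplicial cone both the integral and the lattice sum of this exponential are
  products of geometric terms, the lattice being singled out by averaging over the characters in
  \<open>G\<^sub>\<sigma>\<close>, and the Todd operator maps the first to the second; this is the local
  formula. Replacing \<open>\<xi>\<close> by \<open>t \<xi>\<close> and comparing coefficients of powers of
  \<open>t\<close> gives the global formula for \<open>f m = (m \<bullet> \<xi>) ^ k\<close>, and such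
  powers span all polynomials. \<close>

section \<open>Lattice frames and volumes\<close>

text \<open>The term of a single vertex has a pole of order \<open>CARD('n)\<close> at
  \<open>t = 0\<close>, and it equals an integral or a lattice sum for \<open>t > 0\<close> only;
  just the sum over all vertices is regular. Hence both sides are multiplied by
  \<open>t ^ CARD('n)\<close> and compared as power series that agree on small positive reals, and
  an integrand of degree \<open>k\<close> is read off at the coefficient
  \<open>CARD('n) + k\<close>. The shift \<open>h\<close> enters a vertex term through one linear
  form, so on that term the operator becomes a power series in one variable with arguments scaled by
  the coordinates \<open>\<xi> \<bullet> d v i\<close>. The whole group of the fan can act at every
  vertex: the coordinate of a ray outside the vertex cone is \<open>0\<close>, and the constant term
  of a Todd factor is \<open>1\<close> for \<open>a = 1\<close> and \<open>0\<close> otherwise, so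
  only the elements of \<open>G\<^sub>\<sigma>\<close> survive. Flipped half-lines are open, so that
  the two signed indicators belonging to one inequality differ by a constant; this is what makes the
  sum over the vertices insensitive to the direction, lattice points on the boundary
  included.\<close>

lemma rvec_simps [simp]:
  "rvec (a + b) = rvec a + rvec b" "rvec (a - b) = rvec a - rvec b" "rvec (- a) = - rvec a"
  "rvec 0 = 0" "rvec a $ j = of_int (a $ j)"
  by (simp_all add: rvec_def vec_eq_iff)

lemma rvec_eq_iff [simp]: "rvec a = rvec b \<longleftrightarrow> a = b"
  by (simp add: rvec_def vec_eq_iff)

definition ipair :: "int ^ 'n \<Rightarrow> int ^ 'n \<Rightarrow> int" where
  "ipair a b = (\<Sum>l\<in>UNIV. a $ l * b $ l)"

lemma rvec_inner: "rvec a \<bullet> rvec b = of_int (ipair a b)"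
  by (simp add: inner_vec_def ipair_def)

lemma ipair_add: "ipair (a + b) c = ipair a c + ipair b c"
  by (simp add: ipair_def algebra_simps sum.distrib)

lemma ipair_diff: "ipair (a - b) c = ipair a c - ipair b c"
  by (simp add: ipair_def algebra_simps sum_subtractf)

section \<open>The half-open unit cube and Lebesgue measure\<close>

definition unit_cube :: "(real ^ 'n) set" where
  "unit_cube = {x. \<forall>j. 0 \<le> x $ j \<and> x $ j < 1}"

lemma unit_cube_borel [measurable]: "(unit_cube :: (real ^ 'n) set) \<in> sets borel"
proof -
  have "unit_cube = (\<Inter>j. {x :: real ^ 'n. 0 \<le> x $ j} \<inter> {x. x $ j < 1})"
    by (auto simp: unit_cube_def)
  moreover have "\<dots> \<in> sets borel"
    by (intro sets.countable_INT' sets.Int borel_closed borel_open closed_Collect_le open_Collect_less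
          continuous_intros) (auto intro: countable_finite)
  ultimately show ?thesis by simp
qed

lemma emeasure_between_boxes:
  assumes "box a b \<subseteq> A" "A \<subseteq> cbox a b" "A \<in> sets borel"
    and "\<And>k. a $ k \<le> b $ k"
  shows "emeasure lborel (A :: (real ^ 'n) set) = ennreal (\<Prod>k\<in>UNIV. b $ k - a $ k)"
proof -
  have le: "\<And>k. k \<in> Basis \<Longrightarrow> a \<bullet> k \<le> b \<bullet> k"
    using assms(4) by (auto simp: Basis_vec_def inner_axis)
  have inj: "inj (\<lambda>i. axis i 1 :: real ^ 'n)"
    by (auto simp: inj_on_def axis_eq_axis)
  have Basis: "(Basis :: (real ^ 'n) set) = range (\<lambda>i. axis i 1)"
    by (auto simp: Basis_vec_def)
  have eq: "(\<Prod>k\<in>Basis. (b - a) \<bullet> k) = (\<Prod>k\<in>UNIV. b $ k - a $ k)"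
    unfolding Basis by (subst prod.reindex[OF inj]) (simp add: o_def inner_axis)
  have "emeasure lborel (box a b) \<le> emeasure lborel A" "emeasure lborel A \<le> emeasure lborel (cbox a b)"
    using assms by (auto intro!: emeasure_mono)
  then show ?thesis using le eq by (simp add: emeasure_lborel_box emeasure_lborel_cbox)
qed

lemma emeasure_unit_cube: "emeasure lborel (unit_cube :: (real ^ 'n) set) = 1"
  by (subst emeasure_between_boxes[of 0 1])
     (auto simp: unit_cube_def mem_box_cart less_imp_le)

lemma emeasure_neg_unit_cube: "emeasure lborel {x. - x \<in> (unit_cube :: (real ^ 'n) set)} = 1"
  by (subst emeasure_between_boxes[of "-1" 0])
     (auto simp: unit_cube_def mem_box_cart less_imp_le neg_le_iff_le minus_le_iff
        intro!: measurable_sets_borel[of uminus borel unit_cube, unfolded vimage_def])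

lemma nn_integral_lborel_shift:
  fixes f :: "'a::euclidean_space \<Rightarrow> ennreal"
  assumes [measurable]: "f \<in> borel_measurable borel"
  shows "(\<integral>\<^sup>+ x. f (x + c) \<partial>lborel) = (\<integral>\<^sup>+ x. f x \<partial>lborel)"
proof -
  have "(\<integral>\<^sup>+ x. f x \<partial>lborel) = (\<integral>\<^sup>+ x. f x \<partial>distr lborel borel ((+) c))"
    by (simp add: lborel_distr_plus)
  also have "\<dots> = (\<integral>\<^sup>+ x. f (c + x) \<partial>lborel)"
    by (subst nn_integral_distr) auto
  finally show ?thesis by (simp add: add.commute)
qed

lemma count_space_sum_finite:
  assumes "finite A"
  shows "(\<Sum>r\<in>A. f r) = (\<integral>\<^sup>+ r. f r * indicator A r \<partial>count_space UNIV)"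
  using assms by (simp add: nn_integral_count_space_indicator[symmetric] nn_integral_count_space_finite)

text \<open>The vectors \<open>U j\<close> are linearly independent but may span a proper
  sublattice, and \<open>D\<close> may have non-integral entries. The intended case is a vertex
  cone: \<open>U\<close> its ray generators, \<open>D\<close> its edge directions.\<close>

locale lattice_frame =
  fixes U :: "'n::finite \<Rightarrow> int ^ 'n" and D :: "'n \<Rightarrow> real ^ 'n"
  assumes dual: "D k \<bullet> rvec (U j) = (if j = k then 1 else 0)"
begin

definition T :: "real ^ 'n \<Rightarrow> real ^ 'n" where
  "T x = (\<chi> j. x \<bullet> rvec (U j))"

definition Tinv :: "real ^ 'n \<Rightarrow> real ^ 'n" where
  "Tinv y = (\<Sum>j\<in>UNIV. (y $ j) *\<^sub>R D j)"

text \<open>\<open>T\<close> restricted to lattice points. Its range is a sublattice of finite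
  index, and that index is the multiplicity of the cone.\<close>

definition TZ :: "int ^ 'n \<Rightarrow> int ^ 'n" where
  "TZ m = (\<chi> j. ipair m (U j))"

lemma linear_T: "linear T"
  by (rule linearI) (simp_all add: T_def vec_eq_iff inner_add_left)

lemma linear_Tinv: "linear Tinv"
  by (rule linearI) (simp_all add: Tinv_def scaleR_add_left sum.distrib scaleR_sum_right)

lemma T_nth [simp]: "T x $ j = x \<bullet> rvec (U j)"
  by (simp add: T_def)

lemma T_Tinv [simp]: "T (Tinv y) = y"
  by (simp add: vec_eq_iff Tinv_def inner_sum_left dual if_distrib[of "(*) _"] cong: if_cong)

lemma T_inj: "inj T"
  by (rule linear_surjective_imp_injective[OF linear_T]) (metis T_Tinv surjI)+

lemma Tinv_T [simp]: "Tinv (T x) = x"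
  by (metis T_Tinv T_inj injD)

lemma T_rvec: "T (rvec m) = rvec (TZ m)"
  by (simp add: vec_eq_iff TZ_def rvec_inner)

lemma TZ_diff: "TZ (a - b) = TZ a - TZ b"
  by (simp add: TZ_def ipair_diff vec_eq_iff)

lemma TZ_inj: "TZ a = TZ b \<longleftrightarrow> a = b"
  by (metis T_rvec T_inj injD rvec_eq_iff)

text \<open>A right inverse of a square matrix is also a left inverse; this is the transpose of
  \<open>Tinv (T y) = y\<close>.\<close>

lemma expand: "(\<Sum>j\<in>UNIV. (x \<bullet> D j) *\<^sub>R rvec (U j)) = x"
proof -
  have "(\<Sum>j\<in>UNIV. (x \<bullet> D j) *\<^sub>R rvec (U j)) \<bullet> y = x \<bullet> y" for y
  proof -
    have "(\<Sum>j\<in>UNIV. (x \<bullet> D j) *\<^sub>R rvec (U j)) \<bullet> y = x \<bullet> Tinv (T y)"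
      by (simp only: Tinv_def) (simp add: inner_sum_left inner_sum_right inner_commute mult.commute)
    then show ?thesis by simp
  qed
  then show ?thesis by (metis vector_eq_ldot inner_commute)
qed

lemma T_borel [measurable]: "T \<in> borel_measurable borel"
  by (intro borel_measurable_continuous_onI linear_continuous_on linear_conv_bounded_linear[THEN iffD1] linear_T)
 
lemma Tinv_borel [measurable]: "Tinv \<in> borel_measurable borel"
  by (intro borel_measurable_continuous_onI linear_continuous_on linear_conv_bounded_linear[THEN iffD1] linear_Tinv)

text \<open>The reciprocal of the absolute determinant of \<open>T\<close>. No determinant is
  formed: the value comes from counting cosets in \<open>card_reps_covol\<close> and characters in
  \<open>card_Gam\<close>.\<close>

definition covol :: ennreal where
  "covol = (\<integral>\<^sup>+ x. indicator unit_cube (T x) \<partial>lborel)"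

text \<open>Uniqueness of translation invariant measures: integrate \<open>indicator unit_cube (T x) * g (y
  + T x)\<close> in both orders.\<close>

lemma nn_integral_T:
  assumes [measurable]: "g \<in> borel_measurable borel"
  shows "(\<integral>\<^sup>+ x. g (T x) \<partial>lborel) = covol * (\<integral>\<^sup>+ y. g y \<partial>lborel)"
proof -
  let ?f = "indicator unit_cube :: real ^ 'n \<Rightarrow> ennreal"
  have "covol * (\<integral>\<^sup>+ y. g y \<partial>lborel)
      = (\<integral>\<^sup>+ x. ?f (T x) * (\<integral>\<^sup>+ y. g y \<partial>lborel) \<partial>lborel)"
    by (simp add: covol_def nn_integral_multc)
  also have "\<dots> = (\<integral>\<^sup>+ x. ?f (T x) * (\<integral>\<^sup>+ y. g (y
      + T x) \<partial>lborel) \<partial>lborel)"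
    by (simp add: nn_integral_lborel_shift)
  also have "\<dots> = (\<integral>\<^sup>+ x. (\<integral>\<^sup>+ y. ?f (T x) * g (y
      + T x) \<partial>lborel) \<partial>lborel)"
    by (simp add: nn_integral_cmult)
  also have "\<dots> = (\<integral>\<^sup>+ y. (\<integral>\<^sup>+ x. ?f (T x) * g (y
      + T x) \<partial>lborel) \<partial>lborel)"
    by (rule lborel_pair.Fubini'[symmetric]) measurable
  also have "\<dots> = (\<integral>\<^sup>+ y. (\<integral>\<^sup>+ x. ?f (T (x + - Tinv y)) * g (y + T (x
      + - Tinv y)) \<partial>lborel) \<partial>lborel)"
    by (intro nn_integral_cong nn_integral_lborel_shift[symmetric]) measurable
  also have "\<dots> = (\<integral>\<^sup>+ y. (\<integral>\<^sup>+ x. ?f (T x - y) * g (T x) \<partial>lborel)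
      \<partial>lborel)"
    by (simp add: linear_diff[OF linear_T])
  also have "\<dots> = (\<integral>\<^sup>+ x. (\<integral>\<^sup>+ y. ?f (T x - y) * g (T x) \<partial>lborel)
      \<partial>lborel)"
    by (rule lborel_pair.Fubini') measurable
  also have "\<dots> = (\<integral>\<^sup>+ x. (\<integral>\<^sup>+ y. ?f (T x - y) \<partial>lborel) * g (T x)
      \<partial>lborel)"
    by (simp add: nn_integral_multc)
  also have "\<dots> = (\<integral>\<^sup>+ x. g (T x) \<partial>lborel)"
  proof (intro nn_integral_cong)
    fix x :: "real ^ 'n"
    have "(\<integral>\<^sup>+ y. ?f (T x - y) \<partial>lborel)
        = (\<integral>\<^sup>+ y. ?f (T x - (y + T x)) \<partial>lborel)"
      by (rule nn_integral_lborel_shift[symmetric]) measurable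
    also have "\<dots> = (\<integral>\<^sup>+ y. indicator {x. - x \<in> (unit_cube :: (real ^ 'n) set)} y \<partial>lborel)"
      by (intro nn_integral_cong) (auto simp: indicator_def)
    also have "\<dots> = 1"
      by (subst nn_integral_indicator)
         (use emeasure_neg_unit_cube in \<open>auto intro!: measurable_sets_borel[of uminus borel unit_cube,
             unfolded vimage_def]\<close>)
    finally show "(\<integral>\<^sup>+ y. ?f (T x - y) \<partial>lborel) * g (T x) = g (T x)" by simp
  qed
  finally show ?thesis ..
qed

text \<open>The lattice points of the half-open parallelepiped that is the image of the cube under
  \<open>T\<close>, one in each coset of \<open>range TZ\<close>.\<close>

definition reps :: "(int ^ 'n) set" where
  "reps = {r. Tinv (rvec r) \<in> unit_cube}"

definition vfloor :: "real ^ 'n \<Rightarrow> int ^ 'n" where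
  "vfloor x = (\<chi> j. \<lfloor>x $ j\<rfloor>)"

lemma vfloor_cube: "x - rvec k \<in> unit_cube \<longleftrightarrow> k = vfloor x"
proof -
  have "0 \<le> x $ j - of_int (k $ j) \<and> x $ j - of_int (k $ j) < 1 \<longleftrightarrow> k $ j
      = \<lfloor>x $ j\<rfloor>" for j
    by linarith
  then show ?thesis by (simp add: unit_cube_def vfloor_def vec_eq_iff)
qed

definition coset_coord :: "int ^ 'n \<Rightarrow> int ^ 'n" where
  "coset_coord k = vfloor (Tinv (rvec k))"

lemma Tinv_TZ: "Tinv (rvec (TZ m)) = rvec m"
  by (metis T_rvec Tinv_T)

lemma reps_iff: "k - TZ m \<in> reps \<longleftrightarrow> m = coset_coord k"
  by (simp add: reps_def coset_coord_def linear_diff[OF linear_Tinv] Tinv_TZ vfloor_cube)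

lemma bij_reps: "bij_betw (\<lambda>(r, m). r + TZ m) (reps \<times> UNIV) UNIV"
proof (rule bij_betwI[where g = "\<lambda>k. (k - TZ (coset_coord k), coset_coord k)"])
  show "(\<lambda>k. (k - TZ (coset_coord k), coset_coord k)) \<in> UNIV \<rightarrow> reps \<times> UNIV"
    by (auto simp: reps_iff)
next
  fix x assume "x \<in> reps \<times> (UNIV :: (int ^ 'n) set)"
  then obtain r m where x: "x = (r, m)" "r \<in> reps" by auto
  have "m = coset_coord (r + TZ m)"
    using x reps_iff[of "r + TZ m" m] by simp
  then show "(\<lambda>k. (k - TZ (coset_coord k), coset_coord k)) ((\<lambda>(r, m). r + TZ m) x) = x"
    by (simp add: x)
qed auto

lemma finite_int_vec_bounded: "finite {k :: int ^ 'n. \<forall>j. \<bar>k $ j\<bar> \<le> b}"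
proof -
  have "finite (PiE (UNIV :: 'n set) (\<lambda>_. {-b..b}))"
    by (intro finite_PiE) auto
  moreover have "{k :: int ^ 'n. \<forall>j. \<bar>k $ j\<bar> \<le> b}
      = vec_lambda ` (PiE (UNIV :: 'n set) (\<lambda>_. {-b..b}))"
  proof (intro equalityI subsetI)
    fix k :: "int ^ 'n" assume "k \<in> {k. \<forall>j. \<bar>k $ j\<bar> \<le> b}"
    then have "vec_nth k \<in> PiE UNIV (\<lambda>_. {-b..b})" by (auto simp: abs_le_iff minus_le_iff)
    then show "k \<in> vec_lambda ` (PiE UNIV (\<lambda>_. {-b..b}))"
      by (metis image_eqI vec_nth_inverse)
  qed (auto simp: PiE_def Pi_def abs_le_iff minus_le_iff)
  ultimately show ?thesis by simp
qed

lemma finite_int_vec_norm: "finite {k :: int ^ 'n. norm (rvec k) \<le> b}"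
proof (rule finite_subset[OF _ finite_int_vec_bounded[of "\<lceil>b\<rceil>"]], clarify)
  fix k :: "int ^ 'n" and j assume "norm (rvec k) \<le> b"
  moreover have "\<bar>rvec k $ j\<bar> \<le> norm (rvec k)" by (rule component_le_norm_cart)
  ultimately have "real_of_int \<bar>k $ j\<bar> \<le> b" by simp
  then show "\<bar>k $ j\<bar> \<le> \<lceil>b\<rceil>" by linarith
qed

lemma finite_reps: "finite reps"
proof -
  have "bounded (unit_cube :: (real ^ 'n) set)"
    by (rule bounded_subset[OF bounded_cbox[of 0 1]]) (auto simp: unit_cube_def mem_box_cart less_imp_le)
  then have "bounded (T ` unit_cube)"
    by (rule bounded_linear_image) (simp add: linear_T linear_linear)
  then obtain b where b: "\<And>x. x \<in> T ` unit_cube \<Longrightarrow> norm x \<le> b"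
    by (auto simp: bounded_iff)
  have "reps \<subseteq> {k. norm (rvec k) \<le> b}"
    unfolding reps_def using b by (metis (mono_tags, lifting) T_Tinv image_eqI mem_Collect_eq subsetI)
  then show ?thesis using finite_int_vec_norm finite_subset by blast
qed

lemma nn_integral_lattice_cube:
  "(\<integral>\<^sup>+ k. indicator unit_cube (x - rvec k :: real ^ 'n) \<partial>count_space UNIV) = (1 :: ennreal)"
proof -
  have "(\<integral>\<^sup>+ k. indicator unit_cube (x - rvec k :: real ^ 'n) \<partial>count_space UNIV)
      = (\<integral>\<^sup>+ k. indicator {vfloor x} k \<partial>count_space UNIV :: ennreal)"
    by (intro nn_integral_cong) (simp add: indicator_def vfloor_cube)
  then show ?thesis by simp
qed

text \<open>\<open>J k\<close> is the volume of the part of the unit cube that \<open>T\<close> maps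
  into the cube at \<open>k\<close>. Over all \<open>k\<close> these volumes add up to
  \<open>1\<close>. Over a single coset of \<open>range TZ\<close> they add up to
  \<open>covol\<close>, because translating by a lattice vector \<open>m\<close> moves the target
  cube by \<open>TZ m\<close>.\<close>

lemma card_reps_covol: "of_nat (card reps) * covol = 1"
proof -
  let ?f = "indicator unit_cube :: real ^ 'n \<Rightarrow> ennreal"
  define J where "J k = (\<integral>\<^sup>+ x. ?f x * ?f (T x - rvec k) \<partial>lborel)" for k
  have rvec_meas [measurable]: "rvec \<in> count_space UNIV \<rightarrow>\<^sub>M borel" by simp
  have "of_nat (card reps) * covol = (\<Sum>r\<in>reps. covol)" by simp
  also have "\<dots> = (\<Sum>r\<in>reps. \<integral>\<^sup>+ x. ?f (T x - rvec r) \<partial>lborel)"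
  proof (intro sum.cong refl)
    fix r
    have "covol = (\<integral>\<^sup>+ x. ?f (T (x + - Tinv (rvec r))) \<partial>lborel)"
      unfolding covol_def by (rule nn_integral_lborel_shift[symmetric]) measurable
    then show "covol = (\<integral>\<^sup>+ x. ?f (T x - rvec r) \<partial>lborel)"
      by (simp add: linear_diff[OF linear_T])
  qed
  \<comment> \<open>The inserted factor is \<open>1\<close>, as the lattice translates of the
    half-open cube tile the space.\<close>
  also have "\<dots> = (\<Sum>r\<in>reps. \<integral>\<^sup>+ x. (\<integral>\<^sup>+ k. ?f (x - rvec k) * ?f (T x
      - rvec r) \<partial>count_space UNIV) \<partial>lborel)"
    by (simp add: nn_integral_multc nn_integral_lattice_cube)
  also have "\<dots> = (\<Sum>r\<in>reps. \<integral>\<^sup>+ k. (\<integral>\<^sup>+ x. ?f (x - rvec k) * ?f (T x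
      - rvec r) \<partial>lborel) \<partial>count_space UNIV)"
    by (intro sum.cong refl nn_integral_count_space_nn_integral) auto
  also have "\<dots> = (\<Sum>r\<in>reps. \<integral>\<^sup>+ k. J (r - TZ k) \<partial>count_space UNIV)"
  proof (rule sum.cong[OF refl], rule nn_integral_cong)
    fix r k
    have "(\<integral>\<^sup>+ x. ?f (x - rvec k) * ?f (T x - rvec r) \<partial>lborel)
        = (\<integral>\<^sup>+ x. ?f (x + rvec k - rvec k) * ?f (T (x + rvec k) - rvec r) \<partial>lborel)"
      by (rule nn_integral_lborel_shift[symmetric]) measurable
    then show "(\<integral>\<^sup>+ x. ?f (x - rvec k) * ?f (T x - rvec r) \<partial>lborel)
        = J (r - TZ k)"
      by (simp add: J_def linear_add[OF linear_T] T_rvec algebra_simps)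
  qed
  also have "\<dots> = (\<Sum>r\<in>reps. \<integral>\<^sup>+ k. J (r + TZ k) \<partial>count_space UNIV)"
  proof (intro sum.cong refl)
    fix r
    have "bij_betw uminus (UNIV :: (int ^ 'n) set) UNIV"
      by (rule bij_betwI[where g = uminus]) auto
    from nn_integral_bij_count_space[OF this, of "\<lambda>k. J (r + TZ k)"]
    show "(\<integral>\<^sup>+ k. J (r - TZ k) \<partial>count_space UNIV) =
      (\<integral>\<^sup>+ k. J (r + TZ k) \<partial>count_space UNIV)"
      using TZ_diff[of 0] by (simp add: TZ_def[of 0] ipair_def zero_vec_def[symmetric])
  qed
  also have "\<dots> = (\<integral>\<^sup>+ r. (\<integral>\<^sup>+ k. J (r
      + TZ k) * indicator reps r \<partial>count_space UNIV) \<partial>count_space UNIV)"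
    by (simp add: nn_integral_multc count_space_sum_finite[OF finite_reps])
  also have "\<dots> = (\<integral>\<^sup>+ p. J (fst p + TZ (snd p)) * indicator reps (fst p) \<partial>count_space UNIV)"
    by (subst nn_integral_fst_count_space[symmetric]) simp
  also have "\<dots> = (\<integral>\<^sup>+ p. J (fst p + TZ (snd p)) \<partial>count_space (reps \<times> UNIV))"
    by (subst nn_integral_count_space_indicator) (auto intro!: nn_integral_cong simp: indicator_def)
  also have "\<dots> = (\<integral>\<^sup>+ k. J k \<partial>count_space UNIV)"
    using nn_integral_bij_count_space[OF bij_reps, of J]
    by (simp add: case_prod_unfold)
  also have "\<dots> = (\<integral>\<^sup>+ x. (\<integral>\<^sup>+ k. ?f x * ?f (T x - rvec k)
      \<partial>count_space UNIV) \<partial>lborel)"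
    unfolding J_def by (intro nn_integral_count_space_nn_integral[symmetric]) auto
  also have "\<dots> = (\<integral>\<^sup>+ x. ?f x \<partial>lborel)"
    by (simp add: nn_integral_cmult nn_integral_lattice_cube)
  also have "\<dots> = 1" by (simp add: emeasure_unit_cube)
  finally show ?thesis .
qed

end

section \<open>Characters of the quotient of a lattice\<close>

lemma power_int_sum:
  fixes a :: "'a::field"
  assumes "a \<noteq> 0"
  shows "a powi (\<Sum>x\<in>A. f x) = (\<Prod>x\<in>A. a powi f x)"
  using assms by (induction A rule: infinite_finite_induct) (auto simp: power_int_add)

lemma prod_power_int:
  fixes f :: "'b \<Rightarrow> 'a::field"
  shows "(\<Prod>x\<in>A. f x) powi n = (\<Prod>x\<in>A. f x powi n)"
  by (induction A rule: infinite_finite_induct) (auto simp: power_int_mult_distrib)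

lemma exp_2pi_eq_1_iff: "exp (2 * complex_of_real pi * \<i> * z) = 1 \<longleftrightarrow> z \<in> \<int>"
proof -
  have "exp (2 * complex_of_real pi * \<i> * z) = 1 \<longleftrightarrow> Im z = 0 \<and> (\<exists>n. Re z = of_int n)"
    by (auto simp: exp_eq_1 field_simps)
  also have "\<dots> \<longleftrightarrow> z \<in> \<int>"
    by (auto simp: Ints_def complex_eq_iff)
  finally show ?thesis .
qed

context lattice_frame
begin

definition chi :: "('n \<Rightarrow> complex) \<Rightarrow> int ^ 'n \<Rightarrow> complex" where
  "chi g k = (\<Prod>j\<in>UNIV. g j powi (k $ j))"

text \<open>The group \<open>G\<^sub>\<sigma>\<close> with coordinates indexed by the rays of the
  cone. Through \<open>chi\<close> it is the character group of the quotient of the lattice by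
  \<open>range TZ\<close>.\<close>

definition Gam :: "('n \<Rightarrow> complex) set" where
  "Gam = {g. (\<forall>j. g j \<noteq> 0) \<and> (\<forall>l. (\<Prod>j\<in>UNIV. g j powi (U j $ l)) = 1)}"

text \<open>By \<open>expand\<close>, \<open>D j \<bullet> rvec y\<close> is the coefficient of
  \<open>U j\<close> in \<open>y\<close>. Exponentiating the coefficients identifies
  \<open>N\<close> modulo the sublattice of the \<open>U j\<close> with \<open>Gam\<close>.\<close>

definition gexp :: "int ^ 'n \<Rightarrow> 'n \<Rightarrow> complex" where
  "gexp y j = exp (2 * of_real pi * \<i> * of_real (D j \<bullet> rvec y))"

lemma Gam_nz: "g \<in> Gam \<Longrightarrow> g j \<noteq> 0"
  by (simp add: Gam_def)

lemma chi_add: "g \<in> Gam \<Longrightarrow> chi g (k + k') = chi g k * chi g k'"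
  by (simp add: chi_def Gam_nz power_int_add prod.distrib)

lemma chi_diff: "g \<in> Gam \<Longrightarrow> chi g (k - k') = chi g k / chi g k'"
  by (simp add: chi_def Gam_nz power_int_diff prod_dividef)

lemma chi_TZ: assumes "g \<in> Gam" shows "chi g (TZ m) = 1"
proof -
  have "chi g (TZ m) = (\<Prod>j\<in>UNIV. \<Prod>l\<in>UNIV. (g j powi (U j $ l)) powi (m $ l))"
    using assms by (simp add: chi_def TZ_def ipair_def power_int_sum Gam_nz mult.commute
        flip: power_int_mult)
  also have "\<dots> = (\<Prod>l\<in>UNIV. (\<Prod>j\<in>UNIV. (g j powi (U j $ l))) powi (m $ l))"
    by (subst prod.swap) (simp add: prod_power_int)
  also have "\<dots> = 1" using assms by (simp add: Gam_def)
  finally show ?thesis .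
qed

lemma chi_axis: "chi g (axis j 1) = g j"
proof -
  have "chi g (axis j 1) = (\<Prod>i\<in>UNIV. if i = j then g i else 1)"
    unfolding chi_def by (intro prod.cong) (auto simp: axis_def)
  then show ?thesis by simp
qed

lemma inner_Tinv: "Tinv y \<bullet> x = (\<Sum>j\<in>UNIV. y $ j * (D j \<bullet> x))"
  by (simp add: Tinv_def inner_sum_left)

lemma chi_gexp: "chi (gexp y) k = exp (2 * of_real pi * \<i> * of_real (Tinv (rvec k) \<bullet> rvec y))"
  by (simp add: chi_def gexp_def exp_power_int inner_Tinv sum_distrib_left exp_sum ac_simps)

lemma gexp_in: "gexp y \<in> Gam"
proof -
  have "(\<Prod>j\<in>UNIV. gexp y j powi (U j $ l)) = 1" for l
  proof -
    have "(\<Prod>j\<in>UNIV. gexp y j powi (U j $ l))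
        = exp (2 * of_real pi * \<i> * of_real (\<Sum>j\<in>UNIV. of_int (U j $ l) * (D j \<bullet> rvec y)))"
      by (simp add: gexp_def exp_power_int sum_distrib_left exp_sum ac_simps)
    also have "(\<Sum>j\<in>UNIV. of_int (U j $ l) * (D j \<bullet> rvec y)) = of_int (y $ l)"
      using arg_cong[OF expand[of "rvec y"], of "\<lambda>v. v $ l"]
      by (simp add: inner_commute mult.commute)
    finally show ?thesis by (simp add: exp_2pi_eq_1_iff)
  qed
  then show ?thesis by (simp add: Gam_def gexp_def)
qed

text \<open>Logarithms \<open>x j\<close> of the entries turn the defining equations into the
  statement that the combination of the \<open>U j\<close> with coefficients \<open>x j\<close> is
  an integral vector \<open>y\<close>. Pairing with \<open>D k\<close> kills the imaginary parts and
  identifies the real parts.\<close>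

lemma Gam_eq: "Gam = range gexp"
proof (intro equalityI subsetI)
  fix g assume g: "g \<in> Gam"
  define x where "x j = Ln (g j) / (2 * of_real pi * \<i>)" for j
  have gx: "g j = exp (2 * of_real pi * \<i> * x j)" for j
    using g by (simp add: x_def Gam_nz)
  have int: "(\<Sum>j\<in>UNIV. of_int (U j $ l) * x j) \<in> \<int>" for l
  proof -
    have "exp (2 * of_real pi * \<i> * (\<Sum>j\<in>UNIV. of_int (U j $ l) * x j)) = (\<Prod>j\<in>UNIV. g j powi (U j $ l))"
      by (simp add: gx exp_power_int sum_distrib_left exp_sum ac_simps)
    also have "\<dots> = 1" using g by (simp add: Gam_def)
    finally show ?thesis by (simp add: exp_2pi_eq_1_iff)
  qed
  then have "\<exists>n. (\<Sum>j\<in>UNIV. of_int (U j $ l) * x j) = of_int n" for l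
    by (meson Ints_cases)
  then obtain n where n: "\<And>l. (\<Sum>j\<in>UNIV. of_int (U j $ l) * x j) = of_int (n l)"
    by metis
  define y where "y = (\<chi> l. n l)"
  have y: "(\<Sum>j\<in>UNIV. of_int (U j $ l) * x j) = of_int (y $ l)" for l
    by (simp add: n y_def)
  have "(\<Sum>j\<in>UNIV. Im (x j) *\<^sub>R rvec (U j)) = 0"
    using arg_cong[OF y, of Im] by (simp add: vec_eq_iff mult.commute)
  then have "D k \<bullet> (\<Sum>j\<in>UNIV. Im (x j) *\<^sub>R rvec (U j)) = 0" for k by simp
  then have Im: "Im (x k) = 0" for k
    by (simp add: inner_sum_right dual if_distrib[of "(*) _"] cong: if_cong)
  have "(\<Sum>j\<in>UNIV. Re (x j) *\<^sub>R rvec (U j)) = rvec y"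
    using arg_cong[OF y, of Re] by (simp add: vec_eq_iff mult.commute)
  then have "D k \<bullet> (\<Sum>j\<in>UNIV. Re (x j) *\<^sub>R rvec (U j)) = D k \<bullet> rvec y" for k by simp
  then have Re: "Re (x k) = D k \<bullet> rvec y" for k
    by (simp add: inner_sum_right dual if_distrib[of "(*) _"] cong: if_cong)
  have "x k = of_real (D k \<bullet> rvec y)" for k using Re Im by (simp add: complex_eq_iff)
  then have "g = gexp y" by (simp add: gexp_def fun_eq_iff gx)
  then show "g \<in> range gexp" by blast
qed (auto simp: gexp_in)

text \<open>Only the class of \<open>y\<close> modulo the \<open>U j\<close> matters, so taking
  fractional parts moves \<open>y\<close> into the parallelepiped that they span, which is
  bounded.\<close>

lemma finite_Gam: "finite Gam"
proof -
  have "\<exists>y'. norm (rvec y') \<le> (\<Sum>j\<in>UNIV. norm (rvec (U j))) \<and> gexp y = gexp y'" for y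
  proof -
    define y' where "y' = (\<chi> l. y $ l - (\<Sum>j\<in>UNIV. \<lfloor>D j \<bullet> rvec y\<rfloor> * U j $ l))"
    have eq: "rvec y' = (\<Sum>j\<in>UNIV. frac (D j \<bullet> rvec y) *\<^sub>R rvec (U j))"
    proof -
      have "rvec y' = rvec y - (\<Sum>j\<in>UNIV. of_int \<lfloor>D j \<bullet> rvec y\<rfloor> *\<^sub>R rvec (U j))"
        by (simp add: y'_def vec_eq_iff)
      then show ?thesis
        by (subst (asm) expand[of "rvec y", symmetric])
          (simp add: frac_def inner_commute scaleR_diff_left sum_subtractf)
    qed
    have D: "D k \<bullet> rvec y' = (D k \<bullet> rvec y) - of_int \<lfloor>D k \<bullet> rvec y\<rfloor>" for k
      by (simp add: eq inner_sum_right dual frac_def if_distrib[of "(*) _"] cong: if_cong)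
    have "gexp y' k = gexp y k" for k
    proof -
      have "exp (2 * of_real pi * \<i> * (of_int \<lfloor>D k \<bullet> rvec y\<rfloor> :: complex)) = 1"
        by (simp only: exp_2pi_eq_1_iff) simp
      then show ?thesis by (simp add: gexp_def D right_diff_distrib exp_diff)
    qed
    moreover have "norm (rvec y') \<le> (\<Sum>j\<in>UNIV. norm (rvec (U j)))"
      unfolding eq
      by (rule order_trans[OF norm_sum]) (auto intro!: sum_mono mult_left_le_one_le simp: frac_lt_1 less_imp_le)
    ultimately show ?thesis by (metis ext)
  qed
  then have "Gam \<subseteq> gexp ` {y. norm (rvec y) \<le> (\<Sum>j\<in>UNIV. norm (rvec (U j)))}"
    unfolding Gam_eq by fastforce
  then show ?thesis by (rule finite_subset) (simp add: finite_int_vec_norm)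
qed

lemma norm_Gam: "g \<in> Gam \<Longrightarrow> norm (g j) = 1"
  unfolding Gam_eq gexp_def by auto

lemma one_in_Gam: "(\<lambda>_. 1) \<in> Gam"
  by (simp add: Gam_def)

lemma Gam_mult: "g \<in> Gam \<Longrightarrow> h \<in> Gam \<Longrightarrow> (\<lambda>j. g j * h j) \<in> Gam"
  by (simp add: Gam_def power_int_mult_distrib prod.distrib)

lemma Gam_divide: "g \<in> Gam \<Longrightarrow> h \<in> Gam \<Longrightarrow> (\<lambda>j. g j / h j) \<in> Gam"
  by (simp add: Gam_def power_int_divide_distrib prod_dividef)

text \<open>If the characters coming from all unit vectors are trivial on \<open>k\<close>, then
  every entry of \<open>Tinv (rvec k)\<close> is an integer.\<close>

lemma chi_separates:
  assumes "k \<notin> range TZ"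
  shows "\<exists>h\<in>Gam. chi h k \<noteq> 1"
proof (rule ccontr)
  assume "\<not> ?thesis"
  then have "chi (gexp (axis l 1)) k = 1" for l by (auto simp: gexp_in)
  then have "of_real (Tinv (rvec k) \<bullet> rvec (axis l 1)) \<in> (\<int> :: complex set)" for l
    by (simp add: chi_gexp exp_2pi_eq_1_iff)
  moreover have "rvec (axis l 1) = axis l 1" for l :: 'n
    by (simp add: vec_eq_iff axis_def)
  ultimately have "of_real (Tinv (rvec k) $ l) \<in> (\<int> :: complex set)" for l
    by (simp add: inner_axis)
  then have "\<exists>n. Tinv (rvec k) $ l = of_int n" for l
    by (metis Ints_cases of_real_eq_iff of_real_of_int_eq)
  then obtain n where "\<And>l. Tinv (rvec k) $ l = of_int (n l)" by metis
  then have "Tinv (rvec k) = rvec (\<chi> l. n l)" by (simp add: vec_eq_iff)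
  then have "k = TZ (\<chi> l. n l)" by (metis T_Tinv T_rvec rvec_eq_iff)
  with assms show False by blast
qed

lemma sum_chi: "(\<Sum>g\<in>Gam. chi g k) = (if k \<in> range TZ then of_nat (card Gam) else 0)"
proof (cases "k \<in> range TZ")
  case True
  then show ?thesis by (auto simp: chi_TZ)
next
  case False
  then obtain h where h: "h \<in> Gam" "chi h k \<noteq> 1" using chi_separates by blast
  have "(\<Sum>g\<in>Gam. chi g k) = (\<Sum>g\<in>Gam. chi (\<lambda>j. h j * g j) k)"
    by (rule sum.reindex_bij_witness[of _ "\<lambda>g j. h j * g j" "\<lambda>g j. g j / h j"])
       (use h in \<open>auto simp: Gam_mult Gam_divide Gam_nz\<close>)
  also have "\<dots> = chi h k * (\<Sum>g\<in>Gam. chi g k)"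
    by (simp add: chi_def power_int_mult_distrib prod.distrib sum_distrib_left)
  finally show ?thesis using h False by simp
qed

lemma zero_in_reps: "0 \<in> reps"
  by (simp add: reps_def unit_cube_def linear_0[OF linear_Tinv])

lemma reps_unique: "r \<in> reps \<Longrightarrow> r + TZ m \<in> reps \<Longrightarrow> m = 0"
  using reps_iff[of "r + TZ m" m] reps_iff[of "r + TZ m" 0] TZ_diff[of 0 0] by simp

lemma sum_reps_chi:
  assumes g: "g \<in> Gam" "g \<noteq> (\<lambda>_. 1)"
  shows "(\<Sum>r\<in>reps. chi g r) = 0"
proof -
  obtain j where j: "g j \<noteq> 1" using g by auto
  \<comment> \<open>Translation by a unit vector, reduced modulo \<open>range TZ\<close> back into
    \<open>reps\<close>. It permutes \<open>reps\<close> and multiplies \<open>chi g\<close> by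
    \<open>g j\<close>, which differs from \<open>1\<close>.\<close>
  define \<phi> where "\<phi> r = r + axis j 1 - TZ (coset_coord (r + axis j 1))" for r
  have inj: "inj_on \<phi> reps"
  proof (rule inj_onI)
    fix r r' assume r: "r \<in> reps" "r' \<in> reps" "\<phi> r = \<phi> r'"
    define m where "m = coset_coord (r + axis j 1) - coset_coord (r' + axis j 1)"
    have "r = r' + TZ m"
      using r(3) by (simp add: \<phi>_def m_def TZ_diff algebra_simps)
    with reps_unique[of r' m] r TZ_diff[of 0 0] show "r = r'" by simp
  qed
  moreover have "\<phi> ` reps \<subseteq> reps" by (auto simp: \<phi>_def reps_iff)
  ultimately have bij: "bij_betw \<phi> reps reps"
    by (simp add: bij_betw_def endo_inj_surj finite_reps)
  have "(\<Sum>r\<in>reps. chi g r) = (\<Sum>r\<in>reps. chi g (\<phi> r))"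
    by (rule sum.reindex_bij_betw[OF bij, symmetric])
  also have "\<dots> = g j * (\<Sum>r\<in>reps. chi g r)"
    using g by (simp add: \<phi>_def chi_diff chi_add chi_TZ chi_axis sum_distrib_left mult.commute)
  finally show ?thesis using j by simp
qed

text \<open>Both orthogonality relations of the characters of \<open>\<int>\<^sup>n / U
  \<int>\<^sup>n\<close>: counting the same double sum.\<close>

lemma card_Gam: "card Gam = card reps"
proof -
  have "(of_nat (card Gam) :: complex) = (\<Sum>r\<in>reps. if r = 0 then of_nat (card Gam) else 0)"
    by (simp add: zero_in_reps finite_reps)
  also have "\<dots> = (\<Sum>r\<in>reps. if r \<in> range TZ then of_nat (card Gam) else 0)"
    using reps_unique[OF zero_in_reps] TZ_diff[of 0 0] by (intro sum.cong) (auto simp: image_iff)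
  also have "\<dots> = (\<Sum>r\<in>reps. \<Sum>g\<in>Gam. chi g r)" by (simp add: sum_chi)
  also have "\<dots> = (\<Sum>g\<in>Gam. \<Sum>r\<in>reps. chi g r)" by (rule sum.swap)
  also have "\<dots> = (\<Sum>g\<in>Gam. if g = (\<lambda>_. 1) then of_nat (card reps) else 0)"
    by (intro sum.cong) (auto simp: sum_reps_chi, simp add: chi_def)
  also have "\<dots> = of_nat (card reps)" by (simp add: one_in_Gam finite_Gam)
  finally show ?thesis by simp
qed

lemma card_Gam_pos: "card Gam > 0"
  using one_in_Gam finite_Gam by (auto simp: card_gt_0_iff)

lemma covol_eq: "covol = ennreal (1 / card Gam)"
proof -
  have "of_nat (card Gam) * covol = 1" by (simp add: card_Gam card_reps_covol)
  moreover have "ennreal (1 / card Gam) * of_nat (card Gam) = 1"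
    using card_Gam_pos by (simp add: ennreal_of_nat_eq_real_of_nat flip: ennreal_mult')
  ultimately show ?thesis by (metis mult.assoc mult.left_neutral mult.right_neutral)
qed

end

section \<open>Sums and integrals over a simplicial cone\<close>

text \<open>The half-line on which \<open>exp (- (l * y))\<close> decays as \<open>y\<close> runs to
  infinity along it. The open case is the exact complement of the closed one.\<close>

definition halfline :: "real \<Rightarrow> real \<Rightarrow> real set" where
  "halfline l h = (if l > 0 then {y. 0 \<le> y + h} else {y. y + h < 0})"

lemma halfline_borel [measurable]: "halfline l h \<in> sets borel"
  by (auto simp: halfline_def intro!: borel_closed borel_open closed_Collect_le open_Collect_less
      continuous_intros)

lemma nn_integral_exp_atLeast:
  assumes "l > 0"
  shows "(\<integral>\<^sup>+ y. ennreal (exp (- (l * y))) * indicator {a..} y \<partial>lborel)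
      = ennreal (exp (- (l * a)) / l)"
proof -
  have "(\<integral>\<^sup>+ y. ennreal (exp (- (l * y))) * indicator {a..} y \<partial>lborel)
      = 0 - (- exp (- (l * a)) / l)"
  proof (rule nn_integral_FTC_atLeast)
    show "((\<lambda>x. - exp (- (l * x)) / l) \<longlongrightarrow> 0) at_top"
      using assms by real_asymp
  qed (use assms in \<open>auto intro!: derivative_eq_intros\<close>)
  then show ?thesis by simp
qed

lemma nn_integral_exp_halfline:
  assumes "l \<noteq> 0"
  shows "(\<integral>\<^sup>+ y. ennreal (indicator (halfline l h) y * exp (- (l * y))) \<partial>lborel)
      = ennreal (exp (l * h) / \<bar>l\<bar>)"
proof (cases "l > 0")
  case True
  have "(\<integral>\<^sup>+ y. ennreal (indicator (halfline l h) y * exp (- (l * y))) \<partial>lborel)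
     = (\<integral>\<^sup>+ y. ennreal (exp (- (l * y))) * indicator {-h..} y \<partial>lborel)"
    using True by (intro nn_integral_cong) (auto simp: halfline_def indicator_def)
  then show ?thesis using True by (simp add: nn_integral_exp_atLeast)
next
  case False
  have "(\<integral>\<^sup>+ y. ennreal (indicator (halfline l h) y * exp (- (l * y))) \<partial>lborel)
     = (\<integral>\<^sup>+ y. ennreal (indicator (halfline l h) (- y) * exp (l * y)) \<partial>lborel)"
    by (subst nn_integral_real_affine[where c = "-1" and t = 0]) auto
  \<comment> \<open>The end point \<open>h\<close>, in which the open and the closed half-line
    differ, has measure zero.\<close>
  also have "\<dots> = (\<integral>\<^sup>+ y. ennreal (exp (- (- l * y))) * indicator {h..} y \<partial>lborel)"
    using AE_lborel_singleton[of h] by (intro nn_integral_cong_AE)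
      (use False in \<open>auto elim!: eventually_mono simp: halfline_def indicator_def\<close>)
  finally show ?thesis using False assms by (simp only: nn_integral_exp_atLeast) simp
qed

lemma nn_integral_lborel_prod_vec:
  fixes f :: "'n::finite \<Rightarrow> real \<Rightarrow> ennreal"
  assumes [measurable]: "\<And>j. f j \<in> borel_measurable borel"
  shows "(\<integral>\<^sup>+ x. (\<Prod>j\<in>UNIV. f j (x $ j)) \<partial>(lborel :: (real ^ 'n) measure))
      = (\<Prod>j\<in>UNIV. \<integral>\<^sup>+ y. f j y \<partial>lborel)"
proof -
  define idx where "idx b = (SOME j. b = axis j 1)" for b :: "real ^ 'n"
  have idx: "idx (axis j 1) = j" for j
    unfolding idx_def by (rule some_equality) (auto simp: axis_eq_axis)
  have inj: "inj (\<lambda>i. axis i 1 :: real ^ 'n)"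
    by (auto simp: inj_on_def axis_eq_axis)
  have Basis: "(Basis :: (real ^ 'n) set) = range (\<lambda>i. axis i 1)"
    by (auto simp: Basis_vec_def)
  have "(\<Prod>b\<in>Basis. f (idx b) (x \<bullet> b)) = (\<Prod>j\<in>UNIV. f j (x $ j))" for x :: "real ^ 'n"
    unfolding Basis by (subst prod.reindex[OF inj]) (simp add: idx inner_axis)
  moreover have "(\<Prod>b\<in>Basis. \<integral>\<^sup>+ y. f (idx b) y \<partial>lborel)
      = (\<Prod>j\<in>UNIV. \<integral>\<^sup>+ y. f j y \<partial>lborel)"
    unfolding Basis by (subst prod.reindex[OF inj]) (simp add: idx)
  ultimately show ?thesis
    using nn_integral_lborel_prod[of "\<lambda>b. f (idx b)"] by simp
qed

lemma has_sum_finite_sum: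
  fixes f :: "'a \<Rightarrow> 'b \<Rightarrow> 'c :: {topological_comm_monoid_add}"
  assumes "finite X" "\<And>x. x \<in> X \<Longrightarrow> (f x has_sum S x) A"
  shows "((\<lambda>k. \<Sum>x\<in>X. f x k) has_sum (\<Sum>x\<in>X. S x)) A"
  using assms by (induction X rule: finite_induct) (auto intro!: has_sum_add)

lemma has_sum_prod_PiE_abs:
  fixes f :: "'a \<Rightarrow> 'b \<Rightarrow> 'c :: {banach, real_normed_field}"
  assumes fin: "finite A" and abs: "\<And>x. x \<in> A \<Longrightarrow> (\<lambda>y. norm (f x y)) summable_on B x"
  shows "((\<lambda>g. \<Prod>x\<in>A. f x (g x)) has_sum (\<Prod>x\<in>A. infsum (f x) (B x))) (PiE A B)"
proof -
  have "(\<lambda>g. norm (\<Prod>x\<in>A. f x (g x))) summable_on PiE A B"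
  \<comment> \<open>Summability is inferred from a nonzero \<open>infsum\<close>. Since
    \<open>infsum\<close> is \<open>0\<close> also for families that are not summable, a vanishing
    factor needs its own argument.\<close>
  proof (cases "\<exists>x\<in>A. infsum (\<lambda>y. norm (f x y)) (B x) = 0")
    case True
    then obtain x where x: "x \<in> A" "infsum (\<lambda>y. norm (f x y)) (B x) = 0" by blast
    have "f x y = 0" if "y \<in> B x" for y
      using nonneg_infsum_le_0D[of "\<lambda>y. norm (f x y)" "B x" y] x abs that by simp
    then have "(\<Prod>x\<in>A. f x (g x)) = 0" if "g \<in> PiE A B" for g
      using that x fin by (auto simp: prod_zero_iff)
    then show ?thesis by (auto cong: summable_on_cong)
  next
    case False
    have "infsum (\<lambda>g. \<Prod>x\<in>A. norm (f x (g x))) (PiE A B)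
        = (\<Prod>x\<in>A. infsum (\<lambda>y. norm (f x y)) (B x))"
      by (rule infsum_prod_PiE_abs) (use assms in auto)
    also have "\<dots> \<noteq> 0" using False fin by (simp add: prod_zero_iff)
    finally have "(\<lambda>g. \<Prod>x\<in>A. norm (f x (g x))) summable_on (PiE A B)"
      using infsum_not_exists by blast
    then show ?thesis by (simp add: prod_norm)
  qed
  then have "(\<lambda>g. \<Prod>x\<in>A. f x (g x)) summable_on PiE A B"
    by (rule abs_summable_summable)
  then show ?thesis
    using infsum_prod_PiE_abs[of A f B] assms by (metis has_sum_infsum)
qed

definition halfints :: "real \<Rightarrow> int \<Rightarrow> int set" where
  "halfints l b = (if l > 0 then {b..} else {..<b})"

definition geom_value :: "int \<Rightarrow> 'a::field \<Rightarrow> 'a" where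
  "geom_value b w = w powi b / (1 - w)"

text \<open>One rational function has two expansions: over \<open>{b..}\<close> inside the unit disk
  and, with a minus sign, over \<open>{..<b}\<close> outside it. Flipping an inequality therefore
  changes a lattice sum by a sign only.\<close>

lemma has_sum_power_int:
  fixes w :: "'a :: {banach, real_normed_field}"
  assumes w: "w \<noteq> 0" and l: "l > 0 \<Longrightarrow> norm w < 1" "l < 0 \<Longrightarrow> norm w > 1" "l \<noteq> 0"
  shows "((\<lambda>k. w powi k) has_sum (of_real (sgn l) * geom_value b w)) (halfints l b)"
proof (cases "l > 0")
  case True
  have "((\<lambda>n. w ^ n) has_sum (1 / (1 - w))) UNIV"
    by (rule norm_summable_imp_has_sum)
       (use l(1)[OF True] in \<open>auto simp: norm_power summable_geometric intro: geometric_sums\<close>)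
  then have "((\<lambda>n. w powi b * w ^ n) has_sum (w powi b * (1 / (1 - w)))) UNIV"
    by (rule has_sum_cmult_right)
  also have "?this \<longleftrightarrow> ((\<lambda>k. w powi k) has_sum (w powi b * (1 / (1 - w)))) {b..}"
    by (rule has_sum_reindex_bij_witness[of _ "\<lambda>k. nat (k - b)" "\<lambda>n. b + int n"])
       (use w in \<open>auto simp: power_int_add\<close>)
  finally show ?thesis using True by (simp add: halfints_def geom_value_def)
next
  case False
  then have ln: "l < 0" using l(3) by simp
  let ?v = "inverse w"
  have v: "norm ?v < 1" using l(2)[OF ln] by (simp add: norm_inverse inverse_less_1_iff)
  have w1: "w \<noteq> 1" using l(2)[OF ln] by auto
  have "((\<lambda>n. ?v ^ n) has_sum (1 / (1 - ?v))) UNIV"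
    by (rule norm_summable_imp_has_sum)
       (use v in \<open>auto simp: norm_power summable_geometric intro: geometric_sums\<close>)
  then have "((\<lambda>n. w powi (b - 1) * ?v ^ n) has_sum (w powi (b - 1) * (1 / (1 - ?v)))) UNIV"
    by (rule has_sum_cmult_right)
  also have "?this \<longleftrightarrow> ((\<lambda>k. w powi k) has_sum (w powi (b - 1) * (1 / (1 - ?v)))) {..<b}"
    by (rule has_sum_reindex_bij_witness[of _ "\<lambda>k. nat (b - 1 - k)" "\<lambda>n. b - 1 - int n"])
       (use w in \<open>auto simp: power_int_diff power_int_add field_simps\<close>)
  also have "w powi (b - 1) * (1 / (1 - ?v)) = of_real (sgn l) * geom_value b w"
    using w w1 ln by (simp add: geom_value_def power_int_diff field_simps)
  finally show ?thesis using False by (simp add: halfints_def)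
qed

lemma has_sum_unimodular_power_int:
  fixes w :: complex
  assumes w: "norm w = exp (- l)" and l: "l \<noteq> 0"
  shows "((\<lambda>k. w powi k) has_sum (of_real (sgn l) * geom_value b w)) (halfints l b)"
    and "(\<lambda>k. norm (w powi k)) summable_on (halfints l b)"
proof -
  have "w \<noteq> 0" using w by auto
  then show "((\<lambda>k. w powi k) has_sum (of_real (sgn l) * geom_value b w)) (halfints l b)"
    by (rule has_sum_power_int) (use w l in auto)
  \<comment> \<open>Absolute convergence is the same statement for the real number
    \<open>norm w\<close>.\<close>
  have "((\<lambda>k. norm w powi k) has_sum (of_real (sgn l) * geom_value b (norm w))) (halfints l b)"
    by (rule has_sum_power_int) (use w l in auto)
  then show "(\<lambda>k. norm (w powi k)) summable_on (halfints l b)"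
    by (auto simp: norm_power_int summable_on_def)
qed

context lattice_frame
begin

text \<open>In the coordinates given by \<open>T\<close> the cone is a product of half-lines, and
  the change of variables costs the factor \<open>covol\<close>.\<close>

lemma cone_integral:
  assumes l: "\<And>j. l j \<noteq> 0"
  shows "has_bochner_integral lborel
    (\<lambda>x. \<Prod>j\<in>UNIV. indicator (halfline (l j) (h j)) (x \<bullet> rvec (U j)) * exp (- (l j
        * (x \<bullet> rvec (U j)))))
    ((\<Prod>j\<in>UNIV. exp (l j * h j) / \<bar>l j\<bar>) / card Gam)"
proof -
  define f where "f j y = indicator (halfline (l j) (h j)) y * exp (- (l j * y))" for j and y :: real
  have [measurable]: "f j \<in> borel_measurable borel" for j unfolding f_def by measurable
  have nn: "f j y \<ge> 0" for j y by (simp add: f_def)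
  have "(\<integral>\<^sup>+ x. ennreal (\<Prod>j\<in>UNIV. f j (x \<bullet> rvec (U j))) \<partial>lborel)
     = (\<integral>\<^sup>+ x. (\<Prod>j\<in>UNIV. ennreal (f j (T x $ j))) \<partial>lborel)"
    by (simp add: prod_ennreal nn)
  also have "\<dots> = covol * (\<integral>\<^sup>+ y. (\<Prod>j\<in>UNIV. ennreal (f j (y $ j))) \<partial>lborel)"
    by (rule nn_integral_T) measurable
  also have "(\<integral>\<^sup>+ y. (\<Prod>j\<in>UNIV. ennreal (f j (y $ j))) \<partial>(lborel :: (real ^ 'n)
      measure)) = (\<Prod>j\<in>UNIV. \<integral>\<^sup>+ y. ennreal (f j y) \<partial>lborel)"
    by (rule nn_integral_lborel_prod_vec) measurable
  also have "\<dots> = ennreal (\<Prod>j\<in>UNIV. exp (l j * h j) / \<bar>l j\<bar>)"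
    by (simp add: f_def nn_integral_exp_halfline l prod_ennreal)
  also have "covol * \<dots> = ennreal ((\<Prod>j\<in>UNIV. exp (l j * h j) / \<bar>l j\<bar>) / card Gam)"
    by (simp add: covol_eq prod_nonneg flip: ennreal_mult')
  finally show ?thesis
    unfolding f_def by (intro has_bochner_integral_nn_integral) (auto intro!: prod_nonneg divide_nonneg_nonneg)
qed

text \<open>The sum of the characters in \<open>Gam\<close> is \<open>card Gam\<close> on
  \<open>range TZ\<close> and \<open>0\<close> elsewhere, so the lattice sum is an average of full
  products of geometric series. Since the apex \<open>v\<close> is a lattice point, the vectors of
  slacks of lattice points are exactly the elements \<open>TZ (m - v)\<close> of
  \<open>range TZ\<close>.\<close>

lemma cone_sum:
  fixes l :: "'n \<Rightarrow> real" and b c :: "'n \<Rightarrow> int"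
  assumes l: "\<And>j. l j \<noteq> 0" and c: "\<And>j. c j = - ipair v (U j)"
  shows "((\<lambda>m. (\<Prod>j\<in>UNIV. of_bool (ipair m (U j)
      + c j \<in> halfints (l j) (b j)) * exp (- (of_real (l j) * of_int (ipair m (U j))))))
      has_sum
      (\<Sum>g\<in>Gam. \<Prod>j\<in>UNIV. exp (of_real (l j) * of_int (c j)) * (of_real (sgn (l j)) *
          geom_value (b j) (g j * exp (- of_real (l j))))) / (of_nat (card Gam) :: complex)) UNIV"
proof -
  let ?S = "\<lambda>j. halfints (l j) (b j)"
  let ?e = "\<lambda>j. exp (- complex_of_real (l j))"
  \<comment> \<open>The series run over the slacks \<open>k j = ipair m (U j) + c j\<close>;
    \<open>C\<close> converts exponentials of slacks back into exponentials of
    \<open>ipair m (U j)\<close>.\<close>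
  define C where "C = (\<Prod>j\<in>UNIV. exp (complex_of_real (l j) * of_int (c j)))"
  define V where "V g = (\<Prod>j\<in>UNIV. of_real (sgn (l j)) * geom_value (b j) (g j * ?e j))" for g
  have *: "((\<lambda>k. \<Prod>j\<in>UNIV. (g j * ?e j) powi k j) has_sum V g) (PiE UNIV ?S)" if g: "g \<in> Gam" for g
  proof -
    have n: "norm (g j * ?e j) = exp (- l j)" for j
      using norm_Gam[OF g] by (simp add: norm_mult)
    have "V g = (\<Prod>j\<in>UNIV. infsum (\<lambda>k. (g j * ?e j) powi k) (?S j))"
      unfolding V_def by (intro prod.cong refl infsumI[symmetric] has_sum_unimodular_power_int(1)[OF n l])
    then show ?thesis
      using has_sum_prod_PiE_abs[of UNIV "\<lambda>j k. (g j * ?e j) powi k" ?S] has_sum_unimodular_power_int(2)[OF n l]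
      by simp
  qed
  have "((\<lambda>k. \<Sum>g\<in>Gam. \<Prod>j\<in>UNIV. (g j * ?e j) powi k j)
      has_sum (\<Sum>g\<in>Gam. V g)) (PiE UNIV ?S)"
    using * by (rule has_sum_finite_sum[OF finite_Gam])
  also have "(\<lambda>k. \<Sum>g\<in>Gam. \<Prod>j\<in>UNIV. (g j * ?e j) powi k j)
     = (\<lambda>k. (if (\<chi> j. k j) \<in> range TZ then of_nat (card Gam) * (\<Prod>j\<in>UNIV. ?e j powi k j) else 0))"
  proof
    fix k :: "'n \<Rightarrow> int"
    have "(\<Sum>g\<in>Gam. \<Prod>j\<in>UNIV. (g j * ?e j) powi k j)
        = (\<Sum>g\<in>Gam. chi g (\<chi> j. k j)) * (\<Prod>j\<in>UNIV. ?e j powi k j)"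
      by (simp add: chi_def power_int_mult_distrib prod.distrib sum_distrib_right)
    then show "(\<Sum>g\<in>Gam. \<Prod>j\<in>UNIV. (g j * ?e j) powi k j)
      = (if (\<chi> j. k j) \<in> range TZ then of_nat (card Gam) * (\<Prod>j\<in>UNIV. ?e j powi k j) else 0)"
      by (simp add: sum_chi)
  qed
  finally have "((\<lambda>k. C / of_nat (card Gam) * (if (\<chi> j. k j) \<in> range TZ then of_nat (card Gam)
      * (\<Prod>j\<in>UNIV. ?e j powi k j) else 0))
      has_sum (C / of_nat (card Gam) * (\<Sum>g\<in>Gam. V g))) (PiE UNIV ?S)"
    by (rule has_sum_cmult_right)
  also have "?this \<longleftrightarrow> ((\<lambda>k. C * (\<Prod>j\<in>UNIV. ?e j powi k j))
      has_sum (C / of_nat (card Gam) * (\<Sum>g\<in>Gam. V g)))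
      {k \<in> PiE UNIV ?S. (\<chi> j. k j) \<in> range TZ}"
    using card_Gam_pos by (intro has_sum_cong_neutral) auto
  also have "\<dots> \<longleftrightarrow> ((\<lambda>m. \<Prod>j\<in>UNIV. exp (- (of_real (l j) * of_int (ipair
      m (U j))))) has_sum (C / of_nat (card Gam) * (\<Sum>g\<in>Gam. V g)))
      {m. \<forall>j. ipair m (U j) + c j \<in> ?S j}"
  proof (rule has_sum_reindex_bij_witness[of _ "\<lambda>m j. ipair m (U j) + c j" "\<lambda>k. inv TZ (\<chi> j. k j) + v"])
    fix k assume "k \<in> {k \<in> PiE UNIV ?S. (\<chi> j. k j) \<in> range TZ}"
    then have k: "k \<in> PiE UNIV ?S" "TZ (inv TZ (\<chi> j. k j)) = (\<chi> j. k j)"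
      by (auto simp: f_inv_into_f)
    have "TZ (inv TZ (\<chi> j. k j)) $ j = k j" for j using k(2) by simp
    then have kj: "ipair (inv TZ (\<chi> j. k j)) (U j) = k j" for j by (simp add: TZ_def)
    then show "(\<lambda>j. ipair (inv TZ (\<chi> j. k j) + v) (U j) + c j) = k"
      by (simp add: fun_eq_iff ipair_add c)
    show "inv TZ (\<chi> j. k j) + v \<in> {m. \<forall>j. ipair m (U j) + c j \<in> ?S j}"
      using k(1) by (auto simp: ipair_add c kj)
    show "(\<Prod>j\<in>UNIV. exp (- (complex_of_real (l j) * of_int (ipair (inv TZ (\<chi> j. k j)
        + v) (U j))))) = C * (\<Prod>j\<in>UNIV. ?e j powi k j)"
      unfolding C_def prod.distrib[symmetric]
      by (intro prod.cong refl) (simp add: ipair_add kj c exp_power_int exp_add[symmetric] algebra_simps)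
  next
    fix m assume m: "m \<in> {m. \<forall>j. ipair m (U j) + c j \<in> ?S j}"
    have eq: "(\<chi> j. ipair m (U j) + c j) = TZ (m - v)"
      by (simp add: vec_eq_iff TZ_def ipair_diff c)
    then show "(\<lambda>j. ipair m (U j) + c j) \<in> {k \<in> PiE UNIV ?S. (\<chi> j. k j) \<in> range TZ}"
      using m by auto
    have "inj TZ" by (simp add: inj_def TZ_inj)
    then show "inv TZ (\<chi> j. ipair m (U j) + c j) + v = m"
      by (simp add: eq)
  qed simp_all
  also have "\<dots> \<longleftrightarrow> ((\<lambda>m. (\<Prod>j\<in>UNIV. of_bool (ipair m (U j)
      + c j \<in> ?S j) * exp (- (of_real (l j) * of_int (ipair m (U j))))))
      has_sum (C / of_nat (card Gam) * (\<Sum>g\<in>Gam. V g))) UNIV"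
    by (intro has_sum_cong_neutral) (auto simp: prod_zero_iff intro!: prod.cong)
  also have "C / of_nat (card Gam) * (\<Sum>g\<in>Gam. V g)
     = (\<Sum>g\<in>Gam. \<Prod>j\<in>UNIV. exp (of_real (l j) * of_int (c j)) * (of_real (sgn (l j)) *
          geom_value (b j) (g j * ?e j))) / of_nat (card Gam)"
    unfolding C_def V_def by (simp add: sum_distrib_left prod.distrib[symmetric] sum_divide_distrib)
  finally show ?thesis .
qed

end

section \<open>Vertices and edges of a simple polytope\<close>

lemma open_avoids_hyperplanes:
  fixes S :: "(real ^ 'n) set"
  assumes "open S" "S \<noteq> {}" "finite A" "0 \<notin> A"
  obtains x where "x \<in> S" "\<And>a. a \<in> A \<Longrightarrow> x \<bullet> a \<noteq> 0"
proof -
  have "negligible (\<Union>a\<in>A. {x. a \<bullet> x = 0})"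
    using assms by (intro negligible_Union) (auto intro!: negligible_hyperplane)
  then have "\<not> S \<subseteq> (\<Union>a\<in>A. {x. a \<bullet> x = 0})"
    using open_not_negligible[OF assms(1,2)] negligible_subset by blast
  then obtain x where "x \<in> S" "x \<notin> (\<Union>a\<in>A. {x. a \<bullet> x = 0})" by blast
  then show ?thesis using that[of x] by (auto simp: inner_commute)
qed

text \<open>For \<open>l \<noteq> 0\<close> this is the signed indicator of the half-line \<open>s \<ge>
  0\<close> or \<open>s < 0\<close>. The mean of the two at \<open>l = 0\<close> makes the polar sum locally
  constant also where a coordinate vanishes.\<close>

definition polar_factor :: "real \<Rightarrow> real \<Rightarrow> real" where
  "polar_factor l s = (sgn l + (if s \<ge> 0 then 1 else -1)) / 2"

lemma polar_factor_pos: "l > 0 \<Longrightarrow> polar_factor l s = of_bool (s \<ge> 0)"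
  and polar_factor_neg: "l < 0 \<Longrightarrow> polar_factor l s = - of_bool (s < 0)"
  by (auto simp: polar_factor_def)

text \<open>Simplicity is expressed by the number of tight inequalities, which makes the tight
  normals at each vertex a basis.\<close>

locale simple_hpolytope =
  fixes a :: "'r::finite \<Rightarrow> real ^ 'n" and c :: "'r \<Rightarrow> real"
  assumes bounded_P: "bounded {m. \<forall>i. 0 \<le> m \<bullet> a i + c i}"
    and simple: "\<And>v. v extreme_point_of {m. \<forall>i. 0 \<le> m \<bullet> a i + c i} \<Longrightarrow>
      card {i. v \<bullet> a i + c i = 0} = CARD('n)"
begin

definition hpoly :: "real ^ 'r \<Rightarrow> (real ^ 'n) set" where
  "hpoly h = {m. \<forall>i. 0 \<le> m \<bullet> a i + c i + h $ i}"

definition tight :: "real ^ 'n \<Rightarrow> 'r set" where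
  "tight v = {i. v \<bullet> a i + c i = 0}"

definition V :: "(real ^ 'n) set" where
  "V = {v. v extreme_point_of hpoly 0}"

lemma mem_hpoly_0: "m \<in> hpoly 0 \<longleftrightarrow> (\<forall>i. 0 \<le> m \<bullet> a i + c i)"
  by (simp add: hpoly_def)

lemma bounded_hpoly_0: "bounded (hpoly 0)"
  using bounded_P by (simp add: hpoly_def)

lemma closed_hpoly: "closed (hpoly h)"
  unfolding hpoly_def by (intro closed_Collect_all closed_Collect_le continuous_intros)

lemma convex_hpoly: "convex (hpoly h)"
proof -
  have "hpoly h = (\<Inter>i. {m. - (c i + h $ i) \<le> a i \<bullet> m})"
  proof -
    have "0 \<le> m \<bullet> a i + c i + h $ i \<longleftrightarrow> - (c i + h $ i) \<le> a i \<bullet> m" for m i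
      by (simp only: inner_commute[of m]) linarith
    then show ?thesis by (auto simp: hpoly_def)
  qed
  moreover have "convex \<dots>"
    using convex_halfspace_ge by (intro convex_INT) auto
  ultimately show ?thesis by simp
qed

lemma card_tight: "v \<in> V \<Longrightarrow> card (tight v) = CARD('n)"
  using simple by (simp add: V_def tight_def hpoly_def)

lemma V_in: "v \<in> V \<Longrightarrow> v \<in> hpoly 0"
  by (simp add: V_def extreme_point_of_def)

text \<open>The inequalities that are strict at \<open>v\<close> survive short steps by continuity,
  so only the tight ones restrict the direction.\<close>

lemma small_step:
  assumes "v \<in> hpoly 0" "\<And>i. i \<in> tight v \<Longrightarrow> 0 \<le> x \<bullet> a i"
  obtains e where "e > 0" "\<And>t. 0 \<le> t \<Longrightarrow> t \<le> e \<Longrightarrow> v + t *\<^sub>R x \<in> hpoly 0"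
proof -
  have "\<forall>\<^sub>F t in at_right 0. 0 \<le> (v + t *\<^sub>R x) \<bullet> a i + c i" for i
  proof (cases "i \<in> tight v")
    case True
    then have "v \<bullet> a i + c i = 0" by (simp add: tight_def)
    then have "(v + t *\<^sub>R x) \<bullet> a i + c i = t * (x \<bullet> a i)" for t by (simp add: inner_add_left)
    then show ?thesis using assms(2)[OF True]
      by (auto simp: eventually_at_right_field intro!: exI[of _ 1])
  next
    case False
    with assms(1) have "0 < v \<bullet> a i + c i"
      by (auto simp: tight_def mem_hpoly_0 less_le)
    moreover have "((\<lambda>t. (v + t *\<^sub>R x) \<bullet> a i + c i) \<longlongrightarrow> (v
        + 0 *\<^sub>R x) \<bullet> a i + c i) (at_right 0)"
      by (intro tendsto_intros)
    ultimately show ?thesis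
      by (auto dest!: order_tendstoD(1)[of _ _ _ 0] elim: eventually_mono)
  qed
  then have "\<forall>\<^sub>F t in at_right 0. v + t *\<^sub>R x \<in> hpoly 0"
    by (simp add: mem_hpoly_0 eventually_all_finite)
  then obtain b where b: "b > 0" "\<And>t. 0 < t \<Longrightarrow> t < b \<Longrightarrow> v + t *\<^sub>R x \<in> hpoly 0"
    by (auto simp: eventually_at_right_field)
  show ?thesis
  proof (rule that[of "b / 2"])
    fix t assume "0 \<le> t" "t \<le> b / 2"
    then show "v + t *\<^sub>R x \<in> hpoly 0" using b assms(1) by (cases "t = 0") auto
  qed (use b in auto)
qed

text \<open>A direction orthogonal to all tight normals can be followed a little both ways, which
  would make \<open>v\<close> a midpoint.\<close>

lemma extreme_orth:
  assumes v: "v \<in> V" and x: "\<And>i. i \<in> tight v \<Longrightarrow> x \<bullet> a i = 0"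
  shows "x = 0"
proof (rule ccontr)
  assume "x \<noteq> 0"
  obtain e where e: "e > 0" "\<And>t. 0 \<le> t \<Longrightarrow> t \<le> e
      \<Longrightarrow> v + t *\<^sub>R x \<in> hpoly 0"
    using small_step[of v x] V_in[OF v] x by auto
  obtain e' where e': "e' > 0" "\<And>t. 0 \<le> t \<Longrightarrow> t \<le> e'
      \<Longrightarrow> v + t *\<^sub>R (- x) \<in> hpoly 0"
    using small_step[of v "- x"] V_in[OF v] x by auto
  define t where "t = min e e'"
  have t: "t > 0" "v + t *\<^sub>R x \<in> hpoly 0" "v - t *\<^sub>R x \<in> hpoly 0"
    using e e' e(2)[of t] e'(2)[of t] by (auto simp: t_def)
  have "v = midpoint (v - t *\<^sub>R x) (v + t *\<^sub>R x)"
    by (simp add: midpoint_def scaleR_2[symmetric])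
  moreover have "v - t *\<^sub>R x \<noteq> v + t *\<^sub>R x"
    using \<open>x \<noteq> 0\<close> t(1) by (simp add: eq_commute[of "v - _"] algebra_simps scaleR_2[symmetric])
  ultimately have "v \<in> open_segment (v - t *\<^sub>R x) (v + t *\<^sub>R x)"
    by (metis midpoint_in_open_segment)
  then show False using v t by (auto simp: V_def extreme_point_of_def)
qed

lemma extremeI:
  assumes v: "v \<in> hpoly 0" and orth: "\<And>x. (\<And>i. i \<in> tight v \<Longrightarrow> x \<bullet> a i
      = 0) \<Longrightarrow> x = 0"
  shows "v \<in> V"
proof -
  have False if pq: "p \<in> hpoly 0" "q \<in> hpoly 0" "v \<in> open_segment p q" for p q
  proof -
    obtain s where s: "0 < s" "s < 1" "v = (1 - s) *\<^sub>R p + s *\<^sub>R q" "p \<noteq> q"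
      using pq(3) by (auto simp: in_segment)
    have "(p - q) \<bullet> a i = 0" if i: "i \<in> tight v" for i
    proof -
      have "(1 - s) * (p \<bullet> a i + c i) + s * (q \<bullet> a i + c i) = 0"
        using i by (simp add: tight_def s(3) inner_add_left algebra_simps)
      moreover have "0 \<le> (1 - s) * (p \<bullet> a i + c i)" "0 \<le> s * (q \<bullet> a i + c i)"
        using pq s by (auto simp: mem_hpoly_0)
      ultimately have "(1 - s) * (p \<bullet> a i + c i) = 0" "s * (q \<bullet> a i + c i) = 0" by linarith+
      then have "p \<bullet> a i + c i = 0" "q \<bullet> a i + c i = 0" using s by auto
      then show ?thesis by (simp add: inner_diff_left)
    qed
    then have "p - q = 0" by (rule orth)
    with s show False by simp
  qed
  then show ?thesis using v by (auto simp: V_def extreme_point_of_def)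
qed

lemma tight_inj: "v \<in> V \<Longrightarrow> w \<in> V
    \<Longrightarrow> tight v \<subseteq> tight w \<Longrightarrow> v = w"
proof -
  assume v: "v \<in> V" "w \<in> V" "tight v \<subseteq> tight w"
  have "(v - w) \<bullet> a i = 0" if "i \<in> tight v" for i
  proof -
    have "i \<in> tight w" using that v by blast
    with that have "v \<bullet> a i + c i = 0" "w \<bullet> a i + c i = 0" by (auto simp: tight_def)
    then show ?thesis by (simp add: inner_diff_left)
  qed
  then have "v - w = 0" by (rule extreme_orth[OF v(1)])
  then show "v = w" by simp
qed

lemma finite_V: "finite V"
proof (rule finite_imageD[of tight])
  show "inj_on tight V" by (rule inj_onI) (simp add: tight_inj)
qed simp

text \<open>For a vertex \<open>v\<close> and tight \<open>i\<close>, the direction of the edge that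
  leaves facet \<open>i\<close> and stays on the other facets through \<open>v\<close>, scaled so
  that the slack of \<open>i\<close> grows at rate \<open>1\<close>.\<close>

definition d :: "real ^ 'n \<Rightarrow> 'r \<Rightarrow> real ^ 'n" where
  "d v i = (SOME x. \<forall>k\<in>tight v. x \<bullet> a k = (if k = i then 1 else 0))"

text \<open>The tight normals span the space by \<open>extreme_orth\<close>, and by simplicity there
  are exactly \<open>CARD('n)\<close> of them; so they form a basis and have a dual basis.\<close>

lemma dual_tight:
  assumes v: "v \<in> V" and ik: "i \<in> tight v" "k \<in> tight v"
  shows "d v i \<bullet> a k = (if k = i then 1 else 0)"
proof -
  have "\<not> dim (a ` tight v) < DIM(real ^ 'n)"
  proof
    assume "dim (a ` tight v) < DIM(real ^ 'n)"
    then obtain x where x: "x \<noteq> 0" "\<And>y. y \<in> span (a ` tight v) \<Longrightarrow> orthogonal x y"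
      using orthogonal_to_subspace_exists by blast
    then have "x \<bullet> a i = 0" if "i \<in> tight v" for i
      using that by (auto simp: orthogonal_def span_base)
    with x(1) extreme_orth[OF v] show False by blast
  qed
  then have dim: "CARD('n) \<le> dim (a ` tight v)" by simp
  moreover have "dim (a ` tight v) \<le> card (a ` tight v)" by (rule dim_le_card') simp
  moreover have "card (a ` tight v) \<le> card (tight v)" by (rule card_image_le) simp
  ultimately have card: "card (a ` tight v) = card (tight v)" "card (a ` tight v) \<le> dim (a ` tight v)"
    using card_tight[OF v] by auto
  then have inj: "inj_on a (tight v)" by (simp add: eq_card_imp_inj_on)
  have indep: "independent (a ` tight v)"
    using card(2) by (intro card_le_dim_spanning[of _ "span (a ` tight v)"]) (auto intro: span_base)
  obtain f where f: "linear f" "\<And>x. x \<in> a ` tight v \<Longrightarrow> f x = (if x = a i then 1 else 0 :: real)"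
    using linear_independent_extend[OF indep, of "\<lambda>x. if x = a i then 1 else 0"] by blast
  \<comment> \<open>\<open>adjoint f 1\<close> is the vector that represents the functional
    \<open>f\<close>.\<close>
  have "\<forall>k\<in>tight v. adjoint f 1 \<bullet> a k = (if k = i then 1 else 0)"
    using f adjoint_works[OF f(1), of _ 1] inj ik(1) by (auto simp: inner_commute inj_on_eq_iff)
  then have "\<forall>k\<in>tight v. d v i \<bullet> a k = (if k = i then 1 else 0)"
    unfolding d_def by (rule someI)
  with ik show ?thesis by blast
qed

text \<open>For a displacement \<open>y = m - v\<close>, this splits the change of
  \<open>\<xi>\<close> into changes of slack, weighted by the slopes of \<open>\<xi>\<close> along
  the edges at \<open>v\<close>.\<close>

lemma expand_tight:
  assumes v: "v \<in> V"
  shows "y \<bullet> \<xi> = (\<Sum>i\<in>tight v. (y \<bullet> a i) * (\<xi> \<bullet> d v i))"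
proof -
  have "(y - (\<Sum>i\<in>tight v. (y \<bullet> a i) *\<^sub>R d v i)) \<bullet> a k = 0" if "k \<in> tight v" for k
  proof -
    have "(\<Sum>i\<in>tight v. (y \<bullet> a i) *\<^sub>R d v i) \<bullet> a k = (\<Sum>i\<in>tight v. if i
        = k then y \<bullet> a i else 0)"
      unfolding inner_sum_left using dual_tight[OF v] that by (intro sum.cong) auto
    then show ?thesis using that by (simp add: inner_diff_left)
  qed
  then have "y - (\<Sum>i\<in>tight v. (y \<bullet> a i) *\<^sub>R d v i) = 0" by (rule extreme_orth[OF v])
  then have "y = (\<Sum>i\<in>tight v. (y \<bullet> a i) *\<^sub>R d v i)" by simp
  then have "y \<bullet> \<xi> = (\<Sum>i\<in>tight v. (y \<bullet> a i) *\<^sub>R d v i) \<bullet> \<xi>" by (rule arg_cong)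
  also have "\<dots> = (\<Sum>i\<in>tight v. (y \<bullet> a i) * (\<xi> \<bullet> d v i))"
    by (simp add: inner_sum_left inner_commute[of \<xi>])
  finally show ?thesis .
qed

definition nbr :: "real ^ 'n \<Rightarrow> 'r \<Rightarrow> real ^ 'n \<Rightarrow> bool" where
  "nbr v i w \<longleftrightarrow> w \<in> V \<and> w \<noteq> v \<and> tight v - {i} \<subseteq> tight w"

lemma nbr_param:
  assumes v: "v \<in> V" and i: "i \<in> tight v" and w: "nbr v i w"
  obtains t where "t > 0" "w = v + t *\<^sub>R d v i"
proof -
  define t where "t = w \<bullet> a i + c i"
  have "(w - v - t *\<^sub>R d v i) \<bullet> a k = 0" if k: "k \<in> tight v" for k
    using k w i dual_tight[OF v i k] by (auto simp: t_def nbr_def tight_def inner_diff_left)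
  then have "w - v - t *\<^sub>R d v i = 0" by (rule extreme_orth[OF v])
  then have eq: "w = v + t *\<^sub>R d v i" by (simp add: algebra_simps)
  have "t \<ge> 0" using w V_in by (auto simp: t_def nbr_def mem_hpoly_0)
  moreover have "t \<noteq> 0" using eq w by (auto simp: nbr_def)
  ultimately show ?thesis using that[of t] eq by simp
qed

text \<open>All candidates lie on one ray from \<open>v\<close>, and the nearer of two would be an
  inner point of a segment in the polytope.\<close>

lemma nbr_unique:
  assumes v: "v \<in> V" and i: "i \<in> tight v" and w: "nbr v i w" "nbr v i w'"
  shows "w = w'"
proof -
  have *: "\<not> t < t'" if t: "t > 0" "nbr v i (v + t *\<^sub>R d v i)" "nbr v i (v + t' *\<^sub>R d v i)" for t t'
  proof
    assume less: "t < t'"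
    let ?x = "d v i"
    have "v + t *\<^sub>R ?x \<in> open_segment v (v + t' *\<^sub>R ?x)"
      using t less unfolding in_segment nbr_def
      by (intro conjI exI[of _ "t / t'"]) (auto simp: algebra_simps)
    then show False using t v V_in[of v] V_in[of "v + t' *\<^sub>R ?x"]
      by (auto simp: nbr_def V_def extreme_point_of_def)
  qed
  obtain t where t: "t > 0" "w = v + t *\<^sub>R d v i" using nbr_param v i w(1) by blast
  obtain t' where t': "t' > 0" "w' = v + t' *\<^sub>R d v i" using nbr_param v i w(2) by blast
  have "t = t'" using *[of t t'] *[of t' t] t t' w by auto
  then show ?thesis using t t' by simp
qed

text \<open>Both ends of an edge have \<open>CARD('n)\<close> tight indices, so moving along it is a
  pivot that exchanges \<open>i\<close> for a single \<open>j\<close>.\<close>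

lemma nbr_tight:
  assumes v: "v \<in> V" and i: "i \<in> tight v" and w: "nbr v i w"
  obtains j where "j \<notin> tight v" "tight w = insert j (tight v - {i})"
proof -
  have cards: "card (tight w) = card (tight v)" using v w by (simp add: card_tight nbr_def)
  have "\<not> tight w \<subseteq> tight v"
    using tight_inj[of w v] v w by (auto simp: nbr_def)
  then obtain j where j: "j \<in> tight w" "j \<notin> tight v" by blast
  have "insert j (tight v - {i}) \<subseteq> tight w" using j w by (auto simp: nbr_def)
  moreover have "card (insert j (tight v - {i})) = card (tight v)"
  proof -
    have "card (tight v - {i}) = card (tight v) - 1" "card (tight v) > 0"
      using i by (auto simp: card_gt_0_iff)
    then show ?thesis using j by simp
  qed
  ultimately have "insert j (tight v - {i}) = tight w"
    using cards by (intro card_subset_eq) auto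
  then show ?thesis using that j by metis
qed

text \<open>The slack of \<open>j\<close> is positive at \<open>v\<close> and zero at
  \<open>w\<close>, hence the negative slope; the edge seen from \<open>w\<close> is therefore a
  negative multiple of the edge seen from \<open>v\<close>. The remaining claims expand
  \<open>d v i\<close> and \<open>d v k\<close> in the basis at \<open>w\<close>.\<close>

lemma nbr_coords:
  assumes v: "v \<in> V" and i: "i \<in> tight v" and w: "nbr v i w"
    and j: "j \<notin> tight v" "tight w = insert j (tight v - {i})"
  shows "d v i \<bullet> a j < 0" "\<xi> \<bullet> d v i = (d v i \<bullet> a j) * (\<xi> \<bullet> d w j)"
    "\<xi> \<bullet> d v i = 0 \<Longrightarrow> k \<in> tight v - {i} \<Longrightarrow> \<xi> \<bullet> d w k
        = \<xi> \<bullet> d v k"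
proof -
  have wV: "w \<in> V" using w by (simp add: nbr_def)
  obtain t where t: "t > 0" "w = v + t *\<^sub>R d v i" using nbr_param v i w by blast
  have "j \<in> tight w" using j by simp
  then have "v \<bullet> a j + c j + t * (d v i \<bullet> a j) = 0"
    by (simp add: tight_def t(2) inner_add_left algebra_simps)
  moreover have "v \<bullet> a j + c j > 0"
    using V_in[OF v] j(1) by (auto simp: tight_def mem_hpoly_0 less_le)
  ultimately have "t * (d v i \<bullet> a j) < 0" by linarith
  then show neg: "d v i \<bullet> a j < 0" using t(1) by (simp add: mult_less_0_iff)
  have expw: "y \<bullet> \<xi> = (y \<bullet> a j) * (\<xi> \<bullet> d w j)
      + (\<Sum>k\<in>tight v - {i}. (y \<bullet> a k) * (\<xi> \<bullet> d w k))" for y \<xi>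
    using expand_tight[OF wV, of y \<xi>] j by simp
  have "(\<Sum>k\<in>tight v - {i}. (d v i \<bullet> a k) * (\<xi> \<bullet> d w k)) = 0"
    using dual_tight[OF v i] by (intro sum.neutral) auto
  then show eq: "\<xi> \<bullet> d v i = (d v i \<bullet> a j) * (\<xi> \<bullet> d w j)"
    using expw[of "d v i" \<xi>] by (simp add: inner_commute)
  assume 0: "\<xi> \<bullet> d v i = 0" and k: "k \<in> tight v - {i}"
  have "(\<Sum>k'\<in>tight v - {i}. (d v k \<bullet> a k') * (\<xi> \<bullet> d w k'))
      = (\<Sum>k'\<in>tight v - {i}. if k' = k then \<xi> \<bullet> d w k' else 0)"
    using dual_tight[OF v] k by (intro sum.cong) auto
  also have "\<dots> = \<xi> \<bullet> d w k" using k by simp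
  finally show "\<xi> \<bullet> d w k = \<xi> \<bullet> d v k"
    using expw[of "d v k" \<xi>] eq 0 neg by (simp add: inner_commute)
qed

text \<open>The polytope is bounded, so the edge runs into a new constraint. The stopping point is a
  vertex: a direction orthogonal to the tight normals kept from \<open>v\<close> is a multiple of
  \<open>x\<close>, and the new normal excludes that.\<close>

lemma nbr_exists:
  assumes v: "v \<in> V" and i: "i \<in> tight v"
  shows "\<exists>w. nbr v i w"
proof -
  define x where "x = d v i"
  define J where "J = {j. x \<bullet> a j < 0}"
  define slack where "slack j = v \<bullet> a j + c j" for j
  have slack: "slack j \<ge> 0" for j using V_in[OF v] by (simp add: slack_def mem_hpoly_0)
  have x_tight: "x \<bullet> a k = (if k = i then 1 else 0)" if "k \<in> tight v" for k
    using dual_tight[OF v i that] by (simp add: x_def)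
  have x0: "x \<noteq> 0" using x_tight[OF i] by auto
  have "J \<noteq> {}"
  proof
    assume "J = {}"
    then have ge: "x \<bullet> a j \<ge> 0" for j by (auto simp: J_def not_less)
    have "v + t *\<^sub>R x \<in> hpoly 0" if "t \<ge> 0" for t
    proof -
      have "0 \<le> slack j + t * (x \<bullet> a j)" for j using slack[of j] ge[of j] that by simp
      then show ?thesis by (simp add: mem_hpoly_0 slack_def inner_add_left algebra_simps)
    qed
    moreover obtain b where b: "\<And>y. y \<in> hpoly 0 \<Longrightarrow> norm y \<le> b"
      using bounded_hpoly_0 by (auto simp: bounded_iff)
    ultimately have b': "norm (v + t *\<^sub>R x) \<le> b" if "t \<ge> 0" for t using that by blast
    have "b \<ge> 0" using order_trans[OF norm_ge_zero b'[of 0]] by simp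
    \<comment> \<open>Far enough along the ray for the point to have norm greater than
      \<open>b\<close>.\<close>
    define t where "t = (b + norm v + 1) / norm x"
    have t: "t \<ge> 0" "t * norm x = b + norm v + 1" using \<open>b \<ge> 0\<close> x0 by (auto simp: t_def)
    have "norm (t *\<^sub>R x) \<le> norm (v + t *\<^sub>R x) + norm v"
      by (metis add_diff_cancel_left' norm_triangle_ineq4)
    then show False using b'[OF t(1)] t by simp
  qed
  \<comment> \<open>The ratio test of the simplex method: the first slack to reach zero along
    \<open>x\<close> stops the motion.\<close>
  define t where "t = Min ((\<lambda>j. slack j / - (x \<bullet> a j)) ` J)"
  have "t \<in> (\<lambda>j. slack j / - (x \<bullet> a j)) ` J"
    unfolding t_def using \<open>J \<noteq> {}\<close> by (intro Min_in) auto
  then obtain j where j: "j \<in> J" "t = slack j / - (x \<bullet> a j)" by auto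
  have t_le: "t \<le> slack k / - (x \<bullet> a k)" if "k \<in> J" for k
    unfolding t_def using that by (intro Min_le) auto
  have jt: "j \<notin> tight v" using j(1) x_tight[of j] by (auto simp: J_def split: if_splits)
  then have "slack j > 0" using slack[of j] by (auto simp: tight_def slack_def less_le)
  then have tpos: "t > 0" using j by (auto simp: J_def divide_pos_neg)
  define w where "w = v + t *\<^sub>R x"
  have wa: "w \<bullet> a k + c k = slack k + t * (x \<bullet> a k)" for k
    by (simp add: w_def slack_def inner_add_left)
  have wP: "w \<in> hpoly 0"
    unfolding mem_hpoly_0 wa
  proof
    fix k
    show "0 \<le> slack k + t * (x \<bullet> a k)"
    proof (cases "k \<in> J")
      case True
      then have "x \<bullet> a k < 0" by (simp add: J_def)
      then show ?thesis using t_le[OF True] by (simp add: field_simps)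
    next
      case False
      then show ?thesis using slack[of k] tpos by (simp add: J_def not_less)
    qed
  qed
  have wt: "tight v - {i} \<subseteq> tight w"
    using x_tight by (auto simp: tight_def[of w] wa) (auto simp: tight_def slack_def)
  have wj: "j \<in> tight w" using j by (simp add: tight_def[of w] wa J_def)
  have "w \<in> V"
  proof (rule extremeI[OF wP])
    fix y assume y: "\<And>k. k \<in> tight w \<Longrightarrow> y \<bullet> a k = 0"
    have "(y - (y \<bullet> a i) *\<^sub>R x) \<bullet> a k = 0" if "k \<in> tight v" for k
      using that y wt x_tight[OF that] by (auto simp: inner_diff_left subset_iff)
    then have "y - (y \<bullet> a i) *\<^sub>R x = 0" by (rule extreme_orth[OF v])
    then have yx: "y = (y \<bullet> a i) *\<^sub>R x" by simp
    have "(y \<bullet> a i) * (x \<bullet> a j) = 0" using y[OF wj] by (subst (asm) yx) simp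
    then have "y \<bullet> a i = 0" using j(1) by (simp add: J_def)
    then show "y = 0" using yx by simp
  qed
  moreover have "w \<noteq> v" using tpos x0 by (simp add: w_def)
  ultimately show ?thesis using wt by (auto simp: nbr_def)
qed

lemma nbr_sym:
  assumes "v \<in> V" "i \<in> tight v" "nbr v i w" "j \<notin> tight v" "tight w = insert j (tight v - {i})"
  shows "nbr w j v"
  using assms by (auto simp: nbr_def)

end

section \<open>The polar decomposition\<close>

context simple_hpolytope
begin

definition generic :: "real ^ 'n \<Rightarrow> bool" where
  "generic \<xi> \<longleftrightarrow> (\<forall>v\<in>V. \<forall>i\<in>tight v. \<xi> \<bullet> d v i \<noteq> 0)"

definition polar_sum :: "('r \<Rightarrow> real) \<Rightarrow> real ^ 'n \<Rightarrow> real" where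
  "polar_sum s \<xi> = (\<Sum>v\<in>V. \<Prod>i\<in>tight v. polar_factor (\<xi> \<bullet> d v i) (s i))"

text \<open>When a coordinate \<open>\<xi> \<bullet> d v z\<close> changes sign, the change of the summand
  of \<open>v\<close> is cancelled by that of the neighbour of \<open>v\<close> along the edge \<open>d v
  z\<close>.\<close>

lemma polar_sum_eq_nearby:
  assumes uniq: "\<And>v i k. v \<in> V \<Longrightarrow> i \<in> tight v \<Longrightarrow> k \<in> tight v \<Longrightarrow>
      \<xi> \<bullet> d v i = 0 \<Longrightarrow> \<xi> \<bullet> d v k = 0 \<Longrightarrow> i = k"
    and sgn: "\<And>v i. v \<in> V \<Longrightarrow> i \<in> tight v
        \<Longrightarrow> \<xi> \<bullet> d v i \<noteq> 0 \<Longrightarrow> sgn (\<eta> \<bullet> d v i)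
            = sgn (\<xi> \<bullet> d v i)"
  shows "polar_sum s \<eta> = polar_sum s \<xi>"
proof -
  define Z where "Z = {v\<in>V. \<exists>i\<in>tight v. \<xi> \<bullet> d v i = 0}"
  define z where "z v = (SOME i. i \<in> tight v \<and> \<xi> \<bullet> d v i = 0)" for v
  have z: "z v \<in> tight v" "\<xi> \<bullet> d v (z v) = 0" "v \<in> V" if "v \<in> Z" for v
    using that someI_ex[of "\<lambda>i. i \<in> tight v \<and> \<xi> \<bullet> d v i = 0"] by (auto simp: Z_def z_def)
  have z_eq: "z v = i" if "v \<in> V" "i \<in> tight v" "\<xi> \<bullet> d v i = 0" for v i
    using that z[of v] uniq[of v "z v" i] by (auto simp: Z_def)
  define \<Delta> where "\<Delta> v = (\<Prod>i\<in>tight v. polar_factor (\<eta> \<bullet> d v i) (s i)) -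
      (\<Prod>i\<in>tight v. polar_factor (\<xi> \<bullet> d v i) (s i))" for v
  have nonZ: "\<Delta> v = 0" if "v \<in> V - Z" for v
  proof -
    have "polar_factor (\<eta> \<bullet> d v i) (s i)
        = polar_factor (\<xi> \<bullet> d v i) (s i)" if "i \<in> tight v" for i
      using sgn[of v i] that \<open>v \<in> V - Z\<close> by (auto simp: Z_def polar_factor_def)
    then show ?thesis by (simp add: \<Delta>_def)
  qed
  \<comment> \<open>The factor at \<open>z v\<close> was that of \<open>l = 0\<close>, so it changes
    by half the new sign. All other factors depend only on signs that stay the same.\<close>
  have onZ: "\<Delta> v = sgn (\<eta> \<bullet> d v (z v)) / 2
      * (\<Prod>i\<in>tight v - {z v}. polar_factor (\<xi> \<bullet> d v i) (s i))" if v: "v \<in> Z" for v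
  proof -
    have "polar_factor (\<eta> \<bullet> d v i) (s i)
        = polar_factor (\<xi> \<bullet> d v i) (s i)" if "i \<in> tight v - {z v}" for i
      using sgn[of v i] that z_eq[of v i] z[OF v] by (auto simp: polar_factor_def)
    then have eq: "(\<Prod>i\<in>tight v - {z v}. polar_factor (\<eta> \<bullet> d v i) (s i))
        = (\<Prod>i\<in>tight v - {z v}. polar_factor (\<xi> \<bullet> d v i) (s i))"
      by simp
    show ?thesis
      unfolding \<Delta>_def using z[OF v]
      by (simp add: prod.remove[OF _ z(1)[OF v]] eq left_diff_distrib[symmetric] polar_factor_def[of _ "s (z v)"]
           diff_divide_distrib[symmetric])
  qed
  define \<sigma> where "\<sigma> v = (SOME w. nbr v (z v) w)" for v
  have \<sigma>: "nbr v (z v) (\<sigma> v)" if "v \<in> Z" for v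
    unfolding \<sigma>_def using nbr_exists z that by (blast intro: someI_ex)
  \<comment> \<open>The map \<open>\<sigma>\<close> exchanges the ends of an edge orthogonal to
    \<open>\<xi>\<close>. At both ends the other coordinates of \<open>\<xi>\<close> agree, while
    the coordinates of \<open>\<eta>\<close> along the edge have opposite signs.\<close>
  have key: "\<sigma> v \<in> Z \<and> \<sigma> (\<sigma> v) = v \<and> \<Delta> (\<sigma> v)
      = - \<Delta> v" if v: "v \<in> Z" for v
  proof -
    define w where "w = \<sigma> v"
    note zv = z[OF v]
    have w: "nbr v (z v) w" using \<sigma>[OF v] by (simp add: w_def)
    have wV: "w \<in> V" using w by (simp add: nbr_def)
    obtain j where j: "j \<notin> tight v" "tight w = insert j (tight v - {z v})"
      using nbr_tight[OF zv(3,1) w] by blast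
    note co = nbr_coords[OF zv(3,1) w j]
    have jw: "j \<in> tight w" using j by simp
    have \<xi>j: "\<xi> \<bullet> d w j = 0" using co(1) co(2)[of \<xi>] zv(2) by simp
    have wZ: "w \<in> Z" using wV jw \<xi>j by (auto simp: Z_def)
    have zw: "z w = j" by (rule z_eq[OF wV jw \<xi>j])
    have "\<sigma> w = v"
    proof (rule nbr_unique[OF wV jw])
      show "nbr w j (\<sigma> w)" using \<sigma>[OF wZ] zw by simp
      show "nbr w j v" by (rule nbr_sym[OF zv(3,1) w j])
    qed
    moreover have "\<Delta> w = - \<Delta> v"
    proof -
      have "sgn (\<eta> \<bullet> d v (z v)) = - sgn (\<eta> \<bullet> d w j)"
        using co(1) by (simp add: co(2)[of \<eta>] sgn_mult)
      moreover have "tight w - {j} = tight v - {z v}" using j by auto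
      moreover have "(\<Prod>i\<in>tight v - {z v}. polar_factor (\<xi> \<bullet> d w i) (s i))
          = (\<Prod>i\<in>tight v - {z v}. polar_factor (\<xi> \<bullet> d v i) (s i))"
        using co(3)[OF zv(2)] by (intro prod.cong) auto
      ultimately show ?thesis by (simp add: onZ[OF v] onZ[OF wZ] zw)
    qed
    ultimately show ?thesis using wZ by (simp add: w_def)
  qed
  have "(\<Sum>v\<in>Z. \<Delta> v) = (\<Sum>v\<in>Z. \<Delta> (\<sigma> v))"
    by (rule sum.reindex_bij_witness[of _ \<sigma> \<sigma>]) (use key in auto)
  also have "\<dots> = - (\<Sum>v\<in>Z. \<Delta> v)" using key by (simp add: sum_negf)
  finally have "(\<Sum>v\<in>Z. \<Delta> v) = 0" by simp
  moreover have "(\<Sum>v\<in>V. \<Delta> v) = (\<Sum>v\<in>Z. \<Delta> v)"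
    using nonZ finite_V by (intro sum.mono_neutral_right) (auto simp: Z_def)
  ultimately show ?thesis by (simp add: polar_sum_def \<Delta>_def sum_subtractf)
qed

text \<open>On a line along which at most one coordinate per vertex vanishes at a time, the polar
  sum is locally constant everywhere, crossings included; the real line is connected.\<close>

lemma polar_sum_path:
  assumes uniq: "\<And>t v i k. v \<in> V \<Longrightarrow> i \<in> tight v
      \<Longrightarrow> k \<in> tight v \<Longrightarrow>
      ((1 - t) *\<^sub>R \<xi> + t *\<^sub>R \<eta>) \<bullet> d v i
          = 0 \<Longrightarrow> ((1 - t) *\<^sub>R \<xi> + t *\<^sub>R \<eta>) \<bullet> d v k = 0 \<Longrightarrow> i = k"
  shows "polar_sum s \<xi> = polar_sum s \<eta>"
proof -
  define p where "p t = (1 - t) *\<^sub>R \<xi> + t *\<^sub>R \<eta>" for t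
  have "\<forall>\<^sub>F t in at t0. polar_sum s (p t0) = polar_sum s (p t)" for t0
  proof -
    have "\<forall>\<^sub>F t in at t0. p t0 \<bullet> d v i \<noteq> 0 \<longrightarrow> sgn (p t \<bullet> d v
        i) = sgn (p t0 \<bullet> d v i)" for v i
    proof (cases "p t0 \<bullet> d v i = 0")
      case False
      have lim: "((\<lambda>t. p t \<bullet> d v i) \<longlongrightarrow> p t0 \<bullet> d v i) (at t0)"
        unfolding p_def by (intro tendsto_intros)
      from False consider "p t0 \<bullet> d v i > 0" | "p t0 \<bullet> d v i < 0" by linarith
      then show ?thesis
      proof cases
        case 1
        from order_tendstoD(1)[OF lim this] show ?thesis by eventually_elim (use 1 in auto)
      next
        case 2
        from order_tendstoD(2)[OF lim this] show ?thesis by eventually_elim (use 2 in auto)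
      qed
    qed auto
    then have "\<forall>\<^sub>F t in at t0. \<forall>v\<in>V. \<forall>i\<in>tight v. p t0 \<bullet> d v i
        \<noteq> 0 \<longrightarrow> sgn (p t \<bullet> d v i) = sgn (p t0 \<bullet> d v i)"
      by (simp add: eventually_ball_finite_distrib finite_V)
    then show ?thesis
      by eventually_elim (rule polar_sum_eq_nearby[symmetric], use uniq in \<open>auto simp: p_def\<close>)
  qed
  then have "\<forall>\<^sub>F t in at t0 within UNIV. polar_sum s (p t0) = polar_sum s (p t)" for t0 by simp
  then have "polar_sum s (p 0) = polar_sum s (p 1)"
    by (intro connected_local_const[of UNIV 0 1 "\<lambda>t. polar_sum s (p t)"]) auto
  then show ?thesis by (simp add: p_def)
qed

text \<open>The intersection point of the shifted hyperplanes whose indices are tight at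
  \<open>v\<close>.\<close>

definition moved_vertex :: "real ^ 'n \<Rightarrow> real ^ 'r \<Rightarrow> real ^ 'n" where
  "moved_vertex v h = v - (\<Sum>i\<in>tight v. (h $ i) *\<^sub>R d v i)"

lemma moved_vertex_tight:
  assumes "v \<in> V" "k \<in> tight v"
  shows "moved_vertex v h \<bullet> a k + c k + h $ k = 0"
proof -
  have "(\<Sum>i\<in>tight v. (h $ i) *\<^sub>R d v i) \<bullet> a k = (\<Sum>i\<in>tight v. if i = k then h $ i else 0)"
    unfolding inner_sum_left using dual_tight[OF assms(1)] assms(2) by (intro sum.cong) auto
  then show ?thesis using assms by (simp add: moved_vertex_def inner_diff_left tight_def)
qed

text \<open>This is the sense in which \<open>h\<close> has to be small: no vertex is cut off when
  the facets move.\<close>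

definition admissible :: "real ^ 'r \<Rightarrow> bool" where
  "admissible h \<longleftrightarrow> (\<forall>v\<in>V. moved_vertex v h \<in> hpoly h)"

lemma admissible_nearby: "\<exists>e>0. \<forall>h\<in>ball 0 e. admissible h"
proof -
  have "\<forall>\<^sub>F h in at 0. 0 \<le> moved_vertex v h \<bullet> a k + c k + h $ k" if v: "v \<in> V" for v k
  proof (cases "k \<in> tight v")
    case True
    then show ?thesis using moved_vertex_tight[OF v] by simp
  next
    case False
    have "((\<lambda>h. moved_vertex v h \<bullet> a k + c k
        + h $ k) \<longlongrightarrow> moved_vertex v 0 \<bullet> a k + c k + 0 $ k) (at 0)"
      unfolding moved_vertex_def by (intro tendsto_intros)
    moreover have "moved_vertex v 0 \<bullet> a k + c k + (0 :: real ^ 'r) $ k > 0"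
      using V_in[OF v] False by (auto simp: moved_vertex_def mem_hpoly_0 tight_def less_le)
    ultimately show ?thesis by (auto dest!: order_tendstoD(1) elim: eventually_mono)
  qed
  then have "\<forall>\<^sub>F h in at 0. admissible h"
    unfolding admissible_def hpoly_def by (simp add: eventually_ball_finite_distrib finite_V eventually_all_finite)
  then obtain e where e: "e > 0" "\<And>h. h \<noteq> 0 \<Longrightarrow> dist h 0 < e \<Longrightarrow> admissible h"
    by (auto simp: eventually_at)
  have "admissible 0"
    using V_in by (auto simp: admissible_def moved_vertex_def)
  then show ?thesis using e by (metis dist_commute mem_ball)
qed

lemma V_min_exists:
  assumes ne: "hpoly 0 \<noteq> {}"
  obtains v where "v \<in> V" "\<And>p. p \<in> hpoly 0 \<Longrightarrow> v \<bullet> \<xi> \<le> p \<bullet> \<xi>"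
proof -
  have hull: "hpoly 0 = convex hull V"
    unfolding V_def
    by (rule Krein_Milman_Minkowski) (auto simp: convex_hpoly compact_eq_bounded_closed closed_hpoly bounded_hpoly_0)
  have "V \<noteq> {}" using hull ne by auto
  define v where "v = arg_min_on (\<lambda>w. w \<bullet> \<xi>) V"
  have v: "v \<in> V" "\<And>w. w \<in> V \<Longrightarrow> v \<bullet> \<xi> \<le> w \<bullet> \<xi>"
    unfolding v_def using arg_min_if_finite(1)[OF finite_V \<open>V \<noteq> {}\<close>]
      arg_min_least[OF finite_V \<open>V \<noteq> {}\<close>] by auto
  have "convex hull V \<subseteq> {p. v \<bullet> \<xi> \<le> \<xi> \<bullet> p}"
    using v by (intro hull_minimal convex_halfspace_ge) (auto simp: inner_commute)
  then show ?thesis using that[of v] v(1) hull by (auto simp: inner_commute)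
qed

lemma min_coords_nonneg:
  assumes v: "v \<in> V" "\<And>p. p \<in> hpoly 0
      \<Longrightarrow> v \<bullet> \<xi> \<le> p \<bullet> \<xi>" and i: "i \<in> tight v"
  shows "\<xi> \<bullet> d v i \<ge> 0"
proof -
  obtain e where e: "e > 0" "\<And>t. 0 \<le> t \<Longrightarrow> t \<le> e
      \<Longrightarrow> v + t *\<^sub>R d v i \<in> hpoly 0"
    using small_step[of v "d v i"] V_in[OF v(1)] dual_tight[OF v(1) i]
    by (metis le_numeral_extra(3) zero_le_one)
  have "v \<bullet> \<xi> \<le> (v + e *\<^sub>R d v i) \<bullet> \<xi>" using e v by simp
  then have "0 \<le> e * (\<xi> \<bullet> d v i)" by (simp add: inner_add_left inner_commute[of \<xi>])
  then show ?thesis using e(1) by (simp add: zero_le_mult_iff)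
qed

text \<open>Each such vertex minimises \<open>\<xi>\<close> over the polytope, so two of them have
  the same value; as all coordinates are positive, the tight slacks of one vanish at the
  other.\<close>

lemma positive_vertex_unique:
  assumes v: "v \<in> V" "\<And>i. i \<in> tight v \<Longrightarrow> \<xi> \<bullet> d v i > 0"
    and w: "w \<in> V" "\<And>i. i \<in> tight w \<Longrightarrow> \<xi> \<bullet> d w i > 0"
  shows "v = w"
proof -
  have nonneg: "(w - v) \<bullet> \<xi> \<ge> 0"
    if v: "v \<in> V" "\<And>i. i \<in> tight v \<Longrightarrow> \<xi> \<bullet> d v i > 0" and w: "w \<in> V" for v w
    unfolding expand_tight[OF v(1), of "w - v" \<xi>] using V_in[OF w] v
    by (intro sum_nonneg mult_nonneg_nonneg)
       (auto simp: inner_diff_left tight_def mem_hpoly_0 less_imp_le, metis add_le_cancel_right)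
  have "(w - v) \<bullet> \<xi> = 0"
    using nonneg[OF v w(1)] nonneg[OF w v(1)] by (simp add: inner_diff_left)
  then have sum0: "(\<Sum>i\<in>tight v. ((w - v) \<bullet> a i) * (\<xi> \<bullet> d v i)) = 0"
    using expand_tight[OF v(1), of "w - v" \<xi>] by simp
  have slack: "(w - v) \<bullet> a i = w \<bullet> a i + c i" if "i \<in> tight v" for i
    using that by (simp add: tight_def inner_diff_left)
  have nn: "0 \<le> ((w - v) \<bullet> a i) * (\<xi> \<bullet> d v i)" if "i \<in> tight v" for i
    using V_in[OF w(1)] v(2)[OF that] slack[OF that] by (simp add: mem_hpoly_0)
  have "(w - v) \<bullet> a i = 0" if "i \<in> tight v" for i
  proof -
    have "((w - v) \<bullet> a i) * (\<xi> \<bullet> d v i) = 0"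
      using sum0 nn that by (subst (asm) sum_nonneg_eq_0_iff) auto
    then show ?thesis using v(2)[OF that] by simp
  qed
  then have "w - v = 0" by (rule extreme_orth[OF v(1)])
  then show ?thesis by simp
qed

text \<open>On \<open>hpoly h\<close> only the vertex minimising \<open>\<xi>\<close> contributes,
  since every other vertex has a negative coordinate whose factor is zero there. Off
  \<open>hpoly h\<close> the sum is moved along a line to a direction \<open>\<eta>\<close> at which
  every summand vanishes.\<close>

theorem polar_decomposition:
  assumes ne: "hpoly 0 \<noteq> {}" and h: "admissible h" and gen: "generic \<xi>"
  shows "polar_sum (\<lambda>i. m \<bullet> a i + c i + h $ i) \<xi> = of_bool (m \<in> hpoly h)"
proof (cases "m \<in> hpoly h")
  case True
  obtain v where v: "v \<in> V" "\<And>p. p \<in> hpoly 0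
      \<Longrightarrow> v \<bullet> \<xi> \<le> p \<bullet> \<xi>" using V_min_exists ne by blast
  have vpos: "\<xi> \<bullet> d v i > 0" if "i \<in> tight v" for i
    using min_coords_nonneg[OF v that] gen v(1) that by (force simp: generic_def less_le)
  have "(\<Prod>i\<in>tight w. polar_factor (\<xi> \<bullet> d w i) (m \<bullet> a i + c i + h $ i))
      = of_bool (w = v)" if w: "w \<in> V" for w
  proof (cases "w = v")
    case True
    then show ?thesis using vpos \<open>m \<in> hpoly h\<close>
      by (auto simp: polar_factor_pos hpoly_def intro!: prod.neutral)
  next
    case False
    then obtain i where i: "i \<in> tight w" "\<not> \<xi> \<bullet> d w i > 0"
      using positive_vertex_unique[OF w _ v(1) vpos] by blast
    then have "\<xi> \<bullet> d w i < 0" using gen w by (force simp: generic_def not_less less_le)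
    then have "polar_factor (\<xi> \<bullet> d w i) (m \<bullet> a i + c i + h $ i) = 0"
      using \<open>m \<in> hpoly h\<close> by (simp add: polar_factor_neg hpoly_def not_less)
    then show ?thesis using i False by (auto simp: prod_zero_iff)
  qed
  then show ?thesis using True v(1) finite_V by (simp add: polar_sum_def of_bool_def cong: sum.cong)
next
  case False
  define s where "s i = m \<bullet> a i + c i + h $ i" for i
  \<comment> \<open>Directions that place \<open>m\<close> strictly below every moved vertex.
    Separating \<open>m\<close> from \<open>hpoly h\<close> yields one, because admissibility keeps
    the moved vertices in \<open>hpoly h\<close>.\<close>
  define S where "S = {\<eta>. \<forall>v\<in>V. m \<bullet> \<eta> < moved_vertex v h \<bullet> \<eta>}"
  have "S = (\<Inter>v\<in>V. {\<eta>. m \<bullet> \<eta> < moved_vertex v h \<bullet> \<eta>})" by (auto simp: S_def)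
  then have "open S"
    using finite_V by (auto intro!: open_INT open_Collect_less continuous_intros)
  moreover have "S \<noteq> {}"
  proof -
    obtain x b where "x \<bullet> m < b" "\<And>p. p \<in> hpoly h \<Longrightarrow> b < x \<bullet> p"
      using separating_hyperplane_closed_point[OF convex_hpoly closed_hpoly False] by blast
    then have "x \<in> S" using h by (fastforce simp: S_def admissible_def inner_commute)
    then show ?thesis by blast
  qed
  \<comment> \<open>Avoiding the first family makes \<open>\<eta>\<close> generic. Avoiding the
    second keeps the determinant of the coordinates \<open>i\<close>, \<open>k\<close> of
    \<open>\<xi>\<close> and \<open>\<eta>\<close> away from zero, so no point of the line has two
    vanishing coordinates at one vertex.\<close>
  moreover define A where "A = (\<Union>v\<in>V. d v ` tight v) \<union>
     (\<Union>v\<in>V. (\<lambda>(i, k). (\<xi> \<bullet> d v i) *\<^sub>R d v k - (\<xi> \<bullet> d v k)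
         *\<^sub>R d v i) ` {(i, k). i \<in> tight v \<and> k \<in> tight v \<and> i \<noteq> k})"
  have "finite A" unfolding A_def using finite_V by auto
  moreover have "0 \<notin> A"
  proof
    assume "0 \<in> A"
    then consider v i where "v \<in> V" "i \<in> tight v" "d v i = 0"
      | v i k where "v \<in> V" "i \<in> tight v" "k \<in> tight v" "i \<noteq> k" "(\<xi> \<bullet> d v i)
          *\<^sub>R d v k - (\<xi> \<bullet> d v k) *\<^sub>R d v i = 0"
      by (auto simp: A_def)
    then show False
    proof cases
      case (1 v i)
      then show False using dual_tight[of v i i] by simp
    next
      case (2 v i k)
      have "(\<xi> \<bullet> d v i) * (d v k \<bullet> a k) - (\<xi> \<bullet> d v k) * (d v i \<bullet> a k) = 0"
        using arg_cong[OF 2(5), of "\<lambda>x. x \<bullet> a k"]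
            by (simp only: inner_diff_left inner_scaleR_left inner_zero_left)
      then have "\<xi> \<bullet> d v i = 0" using 2(1-4) by (simp add: dual_tight)
      then show False using gen 2(1-4) by (auto simp: generic_def)
    qed
  qed
  ultimately obtain \<eta> where \<eta>: "\<eta> \<in> S" "\<And>x. x \<in> A
      \<Longrightarrow> \<eta> \<bullet> x \<noteq> 0"
    using open_avoids_hyperplanes by metis
  have "polar_sum s \<xi> = polar_sum s \<eta>"
  proof (rule polar_sum_path, rule ccontr)
    fix t v i k
    assume v: "v \<in> V" "i \<in> tight v" "k \<in> tight v" "i \<noteq> k"
      and zi: "((1 - t) *\<^sub>R \<xi> + t *\<^sub>R \<eta>) \<bullet> d v i
          = 0" and zk: "((1 - t) *\<^sub>R \<xi> + t *\<^sub>R \<eta>) \<bullet> d v k = 0"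
    have "(\<xi> \<bullet> d v i) *\<^sub>R d v k - (\<xi> \<bullet> d v k) *\<^sub>R d v i \<in> A"
        using v by (force simp: A_def)
    then have "\<eta> \<bullet> ((\<xi> \<bullet> d v i) *\<^sub>R d v k - (\<xi> \<bullet> d v k) *\<^sub>R d v
        i) \<noteq> 0" by (rule \<eta>(2))
    then have det: "(\<xi> \<bullet> d v i) * (\<eta> \<bullet> d v k) - (\<xi> \<bullet> d v k)
        * (\<eta> \<bullet> d v i) \<noteq> 0"
      by (simp add: inner_diff_right)
    have i: "(1 - t) * (\<xi> \<bullet> d v i) + t * (\<eta> \<bullet> d v i)
        = 0" and k: "(1 - t) * (\<xi> \<bullet> d v k) + t * (\<eta> \<bullet> d v k) = 0"
      using zi zk by (simp_all add: inner_add_left)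
    have "t * ((\<xi> \<bullet> d v i) * (\<eta> \<bullet> d v k) - (\<xi> \<bullet> d v k) * (\<eta> \<bullet> d v i)) = 0"
      "(1 - t) * ((\<xi> \<bullet> d v i) * (\<eta> \<bullet> d v k) - (\<xi> \<bullet> d v k)
          * (\<eta> \<bullet> d v i)) = 0"
      using i k by algebra+
    then show False using det by simp
  qed
  also have "\<dots> = 0"
    unfolding polar_sum_def
  proof (rule sum.neutral, rule ballI, rule ccontr)
    fix v assume v: "v \<in> V" and "(\<Prod>i\<in>tight v. polar_factor (\<eta> \<bullet> d v i) (s i)) \<noteq> 0"
    then have nz: "polar_factor (\<eta> \<bullet> d v i) (s i) \<noteq> 0" if "i \<in> tight v" for i
      using that by (auto simp: prod_zero_iff)
    \<comment> \<open>A nonzero factor forces \<open>s i\<close> to agree in sign with its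
      coordinate or to vanish. Then \<open>m\<close> is not below the moved vertex, against the
      choice of \<open>\<eta>\<close>.\<close>
    have "0 \<le> (\<Sum>i\<in>tight v. s i * (\<eta> \<bullet> d v i))"
    proof (rule sum_nonneg)
      fix i assume i: "i \<in> tight v"
      then have "\<eta> \<bullet> d v i \<noteq> 0" using \<eta>(2) v by (auto simp: A_def)
      then consider "\<eta> \<bullet> d v i > 0" | "\<eta> \<bullet> d v i < 0" by linarith
      then show "0 \<le> s i * (\<eta> \<bullet> d v i)"
        using nz[OF i] by cases (auto simp: polar_factor_pos polar_factor_neg mult_nonpos_nonpos not_less split: if_splits)
    qed
    also have "\<dots> = (\<Sum>i\<in>tight v. ((m - moved_vertex v h) \<bullet> a i) * (\<eta> \<bullet> d v i))"
    proof (intro sum.cong refl)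
      fix i assume "i \<in> tight v"
      then have "s i = (m - moved_vertex v h) \<bullet> a i"
        using moved_vertex_tight[OF v, of i h] by (simp add: s_def inner_diff_left)
      then show "s i * (\<eta> \<bullet> d v i) = ((m - moved_vertex v h) \<bullet> a i) * (\<eta> \<bullet> d v i)" by simp
    qed
    also have "\<dots> = (m - moved_vertex v h) \<bullet> \<eta>" by (rule expand_tight[OF v, symmetric])
    finally show False using \<eta>(1) v by (auto simp: S_def inner_diff_left)
  qed
  finally show ?thesis using False by (simp add: s_def[abs_def])
qed

text \<open>Weak duality: at a vertex minimising \<open>\<xi>\<close> over \<open>hpoly 0\<close>,
  the direction \<open>\<xi>\<close> is a nonnegative combination of tight normals, and this bounds
  \<open>\<xi>\<close> below on \<open>hpoly h\<close> for every \<open>h\<close>.\<close>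

lemma bounded_hpoly: assumes ne: "hpoly 0 \<noteq> {}" shows "bounded (hpoly h)"
proof -
  have "\<exists>b. \<forall>m\<in>hpoly h. b \<le> m \<bullet> \<xi>" for \<xi>
  proof -
    obtain v where v: "v \<in> V" "\<And>p. p \<in> hpoly 0
        \<Longrightarrow> v \<bullet> \<xi> \<le> p \<bullet> \<xi>" using V_min_exists ne by blast
    have "(\<Sum>i\<in>tight v. - (c i + h $ i) * (\<xi> \<bullet> d v i))
        \<le> m \<bullet> \<xi>" if "m \<in> hpoly h" for m
      unfolding expand_tight[OF v(1), of m \<xi>]
    proof (intro sum_mono mult_right_mono)
      fix i assume i: "i \<in> tight v"
      show "0 \<le> \<xi> \<bullet> d v i" by (rule min_coords_nonneg[OF v i])
      have "0 \<le> m \<bullet> a i + c i + h $ i" using that by (simp add: hpoly_def)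
      then show "- (c i + h $ i) \<le> m \<bullet> a i" by linarith
    qed
    then show ?thesis by blast
  qed
  then obtain b where b: "\<And>\<xi> m. m \<in> hpoly h \<Longrightarrow> b \<xi> \<le> m \<bullet> \<xi>" by metis
  have "hpoly h \<subseteq> cbox (\<chi> j. b (axis j 1)) (\<chi> j. - b (- axis j 1))"
    using b[of _ "axis _ 1"] b[of _ "- axis _ 1"] by (auto simp: mem_box_cart inner_axis le_minus_iff)
  then show ?thesis using bounded_cbox bounded_subset by blast
qed

end

section \<open>The Todd operator on ridge functions\<close>

lemma pderiv_dir_cong:
  fixes \<phi> :: "real ^ 'r::finite \<Rightarrow> complex"
  assumes "\<And>h. h \<in> S \<Longrightarrow> \<phi> h = \<phi>' h" "open S" "h \<in> S"
  shows "pderiv_dir i \<phi> h = pderiv_dir i \<phi>' h"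
  unfolding pderiv_dir_def
proof (rule vector_derivative_cong_eq)
  have "((\<lambda>t. h + t *\<^sub>R axis i 1) \<longlongrightarrow> h + 0 *\<^sub>R axis i 1) (nhds 0)"
    by (intro tendsto_intros filterlim_ident)
  then have "\<forall>\<^sub>F t in nhds 0. h + t *\<^sub>R axis i 1 \<in> S"
    using assms(2,3) by (auto dest: topological_tendstoD)
  then show "\<forall>\<^sub>F t in nhds 0. t \<in> UNIV \<longrightarrow> \<phi> (h + t *\<^sub>R axis i 1)
      = \<phi>' (h + t *\<^sub>R axis i 1)"
    by eventually_elim (use assms(1) in auto)
qed auto

lemma foldr_pderiv_cong:
  fixes \<phi> :: "real ^ 'r::finite \<Rightarrow> complex"
  assumes "\<And>h. h \<in> S \<Longrightarrow> \<phi> h = \<phi>' h" "open S" "h \<in> S"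
  shows "foldr pderiv_dir js \<phi> h = foldr pderiv_dir js \<phi>' h"
  using assms(3)
proof (induction js arbitrary: h)
  case (Cons j js)
  then show ?case by (simp, intro pderiv_dir_cong[OF _ assms(2)])
qed (use assms in simp)

lemma differentiable_cong_open:
  assumes "f differentiable (at x)" "open S" "x \<in> S" "\<And>y. y \<in> S \<Longrightarrow> f y = g y"
  shows "g differentiable (at x)"
  using assms has_derivative_transform_within_open unfolding differentiable_def by blast

definition partial_list :: "('r::{finite,linorder} \<Rightarrow> nat) \<Rightarrow> 'r list" where
  "partial_list \<alpha> = concat (map (\<lambda>i. replicate (\<alpha> i) i) (sorted_list_of_set UNIV))"

lemma mixed_partial_eq: "mixed_partial \<alpha> \<phi> = foldr pderiv_dir (partial_list \<alpha>) \<phi>"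
proof -
  have "foldr f (replicate n i) = f i ^^ n" for f :: "'b \<Rightarrow> 'c \<Rightarrow> 'c" and n i
    by (induction n) auto
  then have "foldr (\<lambda>i. f i ^^ n i) xs x = foldr f (concat (map (\<lambda>i. replicate (n i) i) xs)) x"
    for f :: "'b \<Rightarrow> 'c \<Rightarrow> 'c" and n xs x
    by (induction xs) auto
  then show ?thesis by (simp add: mixed_partial_def partial_list_def)
qed

lemma prod_list_partial_list:
  fixes f :: "'r::{finite,linorder} \<Rightarrow> 'a::comm_monoid_mult"
  shows "prod_list (map f (partial_list \<alpha>)) = (\<Prod>i\<in>UNIV. f i ^ \<alpha> i)"
proof -
  have 1: "prod_list (map f (replicate n i)) = f i ^ n" for n i by (induction n) auto
  have "prod_list (map f (concat (map (\<lambda>i. replicate (\<alpha> i) i) xs)))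
      = prod_list (map (\<lambda>i. f i ^ \<alpha> i) xs)" for xs
    by (induction xs) (simp_all add: 1 del: map_replicate)
  then show ?thesis by (simp add: partial_list_def prod.distinct_set_conv_list[symmetric])
qed

lemma length_partial_list: "length (partial_list \<alpha>) = (\<Sum>i\<in>UNIV. \<alpha> i)"
proof -
  have "length (concat (map (\<lambda>i. replicate (\<alpha> i) i) xs)) = sum_list (map \<alpha> xs)" for xs :: "'a list"
    by (induction xs) auto
  then show ?thesis by (simp add: partial_list_def sum.distinct_set_conv_list[symmetric])
qed

text \<open>The operator sees only the germ at \<open>0\<close>. This is essential because the
  closed form of the integral holds just for admissible \<open>h\<close>.\<close>

lemma todd_at_0_cong:
  assumes "e > 0" "\<And>h. h \<in> ball 0 e \<Longrightarrow> \<phi> h = \<phi>' h" "todd_at_0 \<Gamma> K \<phi> s"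
  shows "todd_at_0 \<Gamma> K \<phi>' s"
proof -
  have mixed: "mixed_partial \<alpha> \<phi> 0 = mixed_partial \<alpha> \<phi>' 0" for \<alpha>
    unfolding mixed_partial_eq by (rule foldr_pderiv_cong[of "ball 0 e"]) (use assms in auto)
  obtain d where d: "d > 0" "\<And>js h. h \<in> ball 0 d \<Longrightarrow> foldr pderiv_dir js \<phi> differentiable (at h)"
    using assms(3) by (auto simp: todd_at_0_def smooth_near_0_def)
  have "foldr pderiv_dir js \<phi>' differentiable (at h)" if "h \<in> ball 0 (min d e)" for js h
    by (rule differentiable_cong_open[where f = "foldr pderiv_dir js \<phi>" and S = "ball 0 e"])
       (use d that assms in \<open>auto intro: foldr_pderiv_cong[of "ball 0 e"]\<close>)
  then have "smooth_near_0 \<phi>'"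
    unfolding smooth_near_0_def using d(1) assms(1) by (intro exI[of _ "min d e"]) auto
  then show ?thesis using assms(3) mixed by (simp add: todd_at_0_def)
qed

lemma differentiable_along:
  assumes "f differentiable (at (h :: 'a::real_normed_vector))"
  shows "(\<lambda>t::real. f (h + t *\<^sub>R x)) differentiable (at 0)"
proof -
  have "(f \<circ> (\<lambda>t. h + t *\<^sub>R x)) differentiable (at 0)"
    by (rule differentiable_chain_at) (use assms in \<open>auto intro!: derivative_intros\<close>)
  then show ?thesis by (simp add: o_def)
qed

lemma todd_at_0_lincomb:
  assumes "todd_at_0 \<Gamma> K \<phi> s" "todd_at_0 \<Gamma> K \<psi> t"
  shows "todd_at_0 \<Gamma> K (\<lambda>h. a * \<phi> h + \<psi> h) (a * s + t)"
proof -
  obtain d where d: "d > 0" "\<And>js h. h \<in> ball 0 d \<Longrightarrow> foldr pderiv_dir js \<phi> differentiable (at h)"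
    using assms(1) by (auto simp: todd_at_0_def smooth_near_0_def)
  obtain e where e: "e > 0" "\<And>js h. h \<in> ball 0 e \<Longrightarrow> foldr pderiv_dir js \<psi> differentiable (at h)"
    using assms(2) by (auto simp: todd_at_0_def smooth_near_0_def)
  let ?B = "ball 0 (min d e)"
  have eq: "foldr pderiv_dir js (\<lambda>h. a * \<phi> h + \<psi> h) h
      = a * foldr pderiv_dir js \<phi> h + foldr pderiv_dir js \<psi> h"
    if "h \<in> ?B" for js h
    using that
  proof (induction js arbitrary: h)
    case (Cons j js)
    let ?f = "foldr pderiv_dir js \<phi>" and ?g = "foldr pderiv_dir js \<psi>"
    have "foldr pderiv_dir (j # js) (\<lambda>h. a * \<phi> h + \<psi> h) h = pderiv_dir j (\<lambda>h. a * ?f h + ?g h) h"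
      using Cons.IH Cons.prems by (auto intro!: pderiv_dir_cong[of ?B])
    also have "\<dots> = a * pderiv_dir j ?f h + pderiv_dir j ?g h"
    proof -
      have f: "(\<lambda>t. ?f (h + t *\<^sub>R axis j 1)) differentiable (at 0)"
        and g: "(\<lambda>t. ?g (h + t *\<^sub>R axis j 1)) differentiable (at 0)"
        using d e Cons.prems by (auto intro!: differentiable_along)
      have "((\<lambda>t. a * ?f (h + t *\<^sub>R axis j 1) + ?g (h + t *\<^sub>R axis j 1)) has_vector_derivative
          a * vector_derivative (\<lambda>t. ?f (h + t *\<^sub>R axis j 1)) (at 0)
              + vector_derivative (\<lambda>t. ?g (h + t *\<^sub>R axis j 1)) (at 0)) (at 0)"
        using f g by (intro has_vector_derivative_add has_vector_derivative_mult_right)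
          (auto simp: vector_derivative_works)
      then show ?thesis unfolding pderiv_dir_def by (rule vector_derivative_at)
    qed
    finally show ?case by simp
  qed simp
  have diff: "foldr pderiv_dir js (\<lambda>h. a * \<phi> h + \<psi> h) differentiable (at h)" if "h \<in> ?B" for js h
    by (rule differentiable_cong_open[where f = "\<lambda>h. a * foldr pderiv_dir js \<phi> h
        + foldr pderiv_dir js \<psi> h" and S = ?B])
       (use that d e eq in \<open>auto intro!: differentiable_add differentiable_mult\<close>)
  then have sm: "smooth_near_0 (\<lambda>h. a * \<phi> h + \<psi> h)"
    unfolding smooth_near_0_def using d(1) e(1) by (intro exI[of _ "min d e"]) auto
  have mixed: "mixed_partial \<alpha> (\<lambda>h. a * \<phi> h + \<psi> h) 0
      = a * mixed_partial \<alpha> \<phi> 0 + mixed_partial \<alpha> \<psi> 0" for \<alpha>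
    unfolding mixed_partial_eq using eq[of 0] d(1) e(1) by simp
  have "(\<lambda>n. a * (\<Sum>\<alpha> | (\<Sum>i\<in>UNIV. \<alpha> i)
      \<le> n. todd_coeff \<Gamma> K \<alpha> * mixed_partial \<alpha> \<phi> 0)
      + (\<Sum>\<alpha> | (\<Sum>i\<in>UNIV. \<alpha> i)
          \<le> n. todd_coeff \<Gamma> K \<alpha> * mixed_partial \<alpha> \<psi> 0)) \<longlonglongrightarrow> a * s + t"
    using assms by (intro tendsto_intros) (auto simp: todd_at_0_def)
  moreover have "(\<Sum>\<alpha> | (\<Sum>i\<in>UNIV. \<alpha> i)
      \<le> n. todd_coeff \<Gamma> K \<alpha> * mixed_partial \<alpha> (\<lambda>h. a * \<phi> h + \<psi> h) 0)
    = a * (\<Sum>\<alpha> | (\<Sum>i\<in>UNIV. \<alpha> i)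
        \<le> n. todd_coeff \<Gamma> K \<alpha> * mixed_partial \<alpha> \<phi> 0)
      + (\<Sum>\<alpha> | (\<Sum>i\<in>UNIV. \<alpha> i)
          \<le> n. todd_coeff \<Gamma> K \<alpha> * mixed_partial \<alpha> \<psi> 0)" for n
    unfolding sum_distrib_left sum.distrib[symmetric] by (intro sum.cong refl) (simp add: mixed distrib_left)
  ultimately show ?thesis unfolding todd_at_0_def using sm by simp
qed

text \<open>The common shape of the integrals as functions of \<open>h\<close>: for each vertex
  \<open>x\<close>, a function \<open>\<psi>\<close> of one affine form. A mixed partial multiplies
  the weights by powers of the \<open>L x i\<close> and differentiates
  \<open>\<psi>\<close>.\<close>

definition ridge ::
  "'x set \<Rightarrow> ('x \<Rightarrow> complex) \<Rightarrow> ('x \<Rightarrow> real) \<Rightarrow> ('x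
      \<Rightarrow> 'r::finite \<Rightarrow> real) \<Rightarrow> (real \<Rightarrow> complex) \<Rightarrow> real ^
          'r \<Rightarrow> complex" where
  "ridge X \<kappa> C L \<psi> h = (\<Sum>x\<in>X. \<kappa> x * \<psi> (C x + (\<Sum>i\<in>UNIV. L x i * h $ i)))"

text \<open>\<open>\<psi>\<close> is given together with all its derivatives,
  \<open>\<psi> k\<close> being the \<open>k\<close>-th one, so that iterated partials stay in
  closed form.\<close>

lemma ridge_pderiv:
  fixes \<psi> :: "nat \<Rightarrow> real \<Rightarrow> complex"
  assumes \<psi>: "\<And>k y. (\<psi> k has_vector_derivative \<psi> (Suc k) y) (at y)"
  shows "pderiv_dir i (ridge X \<kappa> C L (\<psi> k))
      = ridge X (\<lambda>x. \<kappa> x * of_real (L x i)) C L (\<psi> (Suc k))"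
proof
  fix h
  have *: "((\<lambda>t. \<kappa> x * \<psi> k (C x + (\<Sum>j\<in>UNIV. L x j * (h
      + t *\<^sub>R axis i 1) $ j))) has_vector_derivative
      \<kappa> x * of_real (L x i) * \<psi> (Suc k) (C x + (\<Sum>j\<in>UNIV. L x j * h $ j))) (at 0)" for x
  proof -
    have lin: "C x + (\<Sum>j\<in>UNIV. L x j * (h + t *\<^sub>R axis i 1) $ j)
        = C x + (\<Sum>j\<in>UNIV. L x j * h $ j) + t * L x i" for t
    proof -
      have "(\<Sum>j\<in>UNIV. L x j * (t *\<^sub>R axis i 1) $ j) = (\<Sum>j\<in>UNIV. if j = i then t * L x j else 0)"
        by (intro sum.cong) (auto simp: axis_def)
      then show ?thesis by (simp add: distrib_left sum.distrib)
    qed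
    have "((\<psi> k \<circ> (\<lambda>t. C x + (\<Sum>j\<in>UNIV. L x j * h $ j) + t * L x i)) has_vector_derivative
        L x i *\<^sub>R \<psi> (Suc k) (C x + (\<Sum>j\<in>UNIV. L x j * h $ j) + 0 * L x i)) (at 0)"
      by (rule vector_diff_chain_at) (auto intro!: derivative_eq_intros \<psi>)
    then have "((\<lambda>t. \<psi> k (C x + (\<Sum>j\<in>UNIV. L x j * (h
        + t *\<^sub>R axis i 1) $ j))) has_vector_derivative
        L x i *\<^sub>R \<psi> (Suc k) (C x + (\<Sum>j\<in>UNIV. L x j * h $ j))) (at 0)"
      by (simp only: lin o_def) simp
    from has_vector_derivative_mult_right[OF this, of "\<kappa> x"] show ?thesis
      by (simp add: scaleR_conv_of_real mult.assoc)
  qed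
  show "pderiv_dir i (ridge X \<kappa> C L (\<psi> k)) h
      = ridge X (\<lambda>x. \<kappa> x * of_real (L x i)) C L (\<psi> (Suc k)) h"
    unfolding pderiv_dir_def ridge_def by (rule vector_derivative_at, rule has_vector_derivative_sum, rule *)
qed

lemma ridge_foldr:
  fixes \<psi> :: "nat \<Rightarrow> real \<Rightarrow> complex"
  assumes \<psi>: "\<And>k y. (\<psi> k has_vector_derivative \<psi> (Suc k) y) (at y)"
  shows "foldr pderiv_dir js (ridge X \<kappa> C L (\<psi> 0))
    = ridge X (\<lambda>x. \<kappa> x * prod_list (map (\<lambda>i. of_real (L x i)) js)) C L (\<psi> (length js))"
  by (induction js) (simp_all add: ridge_pderiv[where \<psi> = \<psi>, OF \<psi>] mult.assoc mult.commute[of "prod_list _"])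

lemma ridge_differentiable:
  assumes \<psi>: "\<And>y. (\<psi> has_vector_derivative \<psi>' y) (at y)"
  shows "ridge X \<kappa> C L \<psi> differentiable (at h)"
proof -
  have "(\<lambda>h. \<psi> (C x + (\<Sum>j\<in>UNIV. L x j * h $ j))) differentiable (at h)" for x
  proof -
    have "(\<psi> \<circ> (\<lambda>h. C x + (\<Sum>j\<in>UNIV. L x j * h $ j))) differentiable (at h)"
    proof (rule differentiable_chain_at)
      have "((\<lambda>h. C x + (\<Sum>j\<in>UNIV. L x j * h $ j)) has_derivative (\<lambda>h. 0
          + (\<Sum>j\<in>UNIV. L x j * h $ j))) (at h)"
        by (intro has_derivative_add has_derivative_const has_derivative_sum has_derivative_mult_right
              bounded_linear_imp_has_derivative bounded_linear_vec_nth)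
      then show "(\<lambda>h. C x + (\<Sum>j\<in>UNIV. L x j * h $ j)) differentiable (at h)"
        by (auto simp: differentiable_def)
      show "\<psi> differentiable (at (C x + (\<Sum>j\<in>UNIV. L x j * h $ j)))"
        using \<psi> by (rule differentiableI_vector)
    qed
    then show ?thesis by (simp add: o_def)
  qed
  then show ?thesis
    unfolding ridge_def[abs_def]
    by (cases "finite X") (auto intro!: differentiable_sum differentiable_mult)
qed

text \<open>The series \<open>f (c * X)\<close>. For \<open>c = 0\<close> it is the constant term,
  as \<open>0 ^ 0 = 1\<close>; that case occurs at rays outside a vertex cone.\<close>

definition fscale :: "complex \<Rightarrow> complex fps \<Rightarrow> complex fps" where
  "fscale c f = Abs_fps (\<lambda>n. c ^ n * fps_nth f n)"

lemma bij_betw_count_multisets: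
  "bij_betw count (multisets_of_size (UNIV :: 'r::finite set) n) {\<alpha>. (\<Sum>i\<in>UNIV. \<alpha> i) = n}"
proof (rule bij_betwI[where g = Abs_multiset])
  have sz: "size M = (\<Sum>i\<in>UNIV. count M i)" for M :: "'r multiset"
    unfolding size_multiset_overloaded_eq by (rule sum.mono_neutral_left) (auto simp: not_in_iff)
  show "count \<in> multisets_of_size UNIV n \<rightarrow> {\<alpha>. (\<Sum>i\<in>(UNIV::'r set). \<alpha> i) = n}"
    by (auto simp: multisets_of_size_def sz)
  show "Abs_multiset \<in> {\<alpha>. (\<Sum>i\<in>(UNIV::'r set). \<alpha> i) = n} \<rightarrow> multisets_of_size UNIV n"
    by (auto simp: multisets_of_size_def sz)
qed (auto simp: count_inverse)

lemma nth_prod_fscale: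
  fixes A :: "'r::finite \<Rightarrow> complex fps"
  shows "fps_nth (\<Prod>i\<in>UNIV. fscale (l i) (A i)) n
    = (\<Sum>\<alpha> | (\<Sum>i\<in>UNIV. \<alpha> i)
        = n. \<Prod>i\<in>UNIV. l i ^ \<alpha> i * fps_nth (A i) (\<alpha> i))"
  unfolding fps_prod_nth'[OF finite]
  by (subst sum.reindex_bij_betw[OF bij_betw_count_multisets, symmetric]) (simp add: fscale_def)

lemma finite_multi_indices: "finite {\<alpha> :: 'r::finite \<Rightarrow> nat. (\<Sum>i\<in>UNIV. \<alpha> i) \<le> n}"
proof (rule finite_subset)
  show "{\<alpha>. (\<Sum>i\<in>UNIV. \<alpha> i) \<le> n} \<subseteq> PiE UNIV (\<lambda>_ :: 'r. {..n})"
  proof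
    fix \<alpha> :: "'r \<Rightarrow> nat" assume \<alpha>: "\<alpha> \<in> {\<alpha>. (\<Sum>i\<in>UNIV. \<alpha>
        i) \<le> n}"
    have "\<alpha> i \<le> n" for i
      using member_le_sum[of i UNIV \<alpha>] \<alpha> by simp
    then show "\<alpha> \<in> PiE UNIV (\<lambda>_. {..n})" by auto
  qed
qed (auto intro: finite_PiE)

text \<open>The symbol of the Todd operator on functions of a single linear form with coefficients
  \<open>l\<close>: each \<open>\<partial>/\<partial>h\<^sub>i\<close> becomes
  \<open>l i * X\<close>.\<close>

definition todd_series :: "(complex ^ 'r::finite) set \<Rightarrow> 'r set \<Rightarrow> ('r \<Rightarrow> real)
    \<Rightarrow> complex fps" where
  "todd_series \<Gamma> K l = (\<Sum>g\<in>\<Gamma>. \<Prod>i\<in>UNIV. fscale (of_real (l i)) (todd_factor (i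
      \<in> K) (g $ i)))"

text \<open>Grouping the multi-indices by total order turns the truncations of the operator into
  truncations of one-variable series, with the \<open>k\<close>-th derivative of
  \<open>\<psi>\<close> in place of the \<open>k\<close>-th power.\<close>

lemma todd_at_0_ridge:
  fixes \<psi> :: "nat \<Rightarrow> real \<Rightarrow> complex"
  assumes \<psi>: "\<And>k y. (\<psi> k has_vector_derivative \<psi> (Suc k) y) (at y)"
    and lim: "(\<lambda>n. \<Sum>k\<le>n. \<Sum>x\<in>X. \<kappa> x * \<psi> k (C x) * fps_nth (todd_series
        \<Gamma> K (L x)) k) \<longlonglongrightarrow> s"
  shows "todd_at_0 \<Gamma> K (ridge X \<kappa> C L (\<psi> 0)) s"
proof -
  have "smooth_near_0 (ridge X \<kappa> C L (\<psi> 0))"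
    unfolding smooth_near_0_def ridge_foldr[where \<psi> = \<psi>, OF \<psi>] using ridge_differentiable[OF \<psi>]
    by (intro exI[of _ 1]) auto
  moreover have "(\<Sum>\<alpha> | (\<Sum>i\<in>UNIV. \<alpha> i)
      \<le> n. todd_coeff \<Gamma> K \<alpha> * mixed_partial \<alpha> (ridge X \<kappa> C L (\<psi> 0)) 0)
      = (\<Sum>k\<le>n. \<Sum>x\<in>X. \<kappa> x * \<psi> k (C x) * fps_nth (todd_series \<Gamma> K (L x)) k)"
          (is "?lhs = _") for n
  proof -
    define F where "F \<alpha> k = (\<Sum>x\<in>X. \<kappa> x * \<psi> k (C x)
        * (\<Sum>g\<in>\<Gamma>. \<Prod>i\<in>UNIV. of_real (L x i) ^ \<alpha> i * fps_nth (todd_factor (i \<in>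
            K) (g $ i)) (\<alpha> i)))"
      for \<alpha> :: "'b \<Rightarrow> nat" and k
    have m: "mixed_partial \<alpha> (ridge X \<kappa> C L (\<psi> 0)) 0
        = (\<Sum>x\<in>X. \<kappa> x * (\<Prod>i\<in>UNIV. of_real (L x i) ^ \<alpha> i) * \<psi>
            (\<Sum>i\<in>UNIV. \<alpha> i) (C x))" for \<alpha>
      by (simp add: mixed_partial_eq ridge_foldr[where \<psi>
          = \<psi>, OF \<psi>] prod_list_partial_list length_partial_list ridge_def)
    have "?lhs = (\<Sum>\<alpha> | (\<Sum>i\<in>UNIV. \<alpha> i) \<le> n. F \<alpha> (\<Sum>i\<in>UNIV. \<alpha> i))"
      unfolding F_def m todd_coeff_def prod.distrib
      by (simp add: sum_distrib_left sum_distrib_right ac_simps)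
    also have "\<dots> = (\<Sum>k\<le>n. \<Sum>\<alpha> | (\<Sum>i\<in>UNIV. \<alpha> i)
        = k. F \<alpha> (\<Sum>i\<in>UNIV. \<alpha> i))"
    proof -
      have "(\<Sum>k\<le>n. \<Sum>\<alpha> \<in> {\<alpha>\<in>{\<alpha>. (\<Sum>i\<in>UNIV. \<alpha> i)
          \<le> n}. (\<Sum>i\<in>UNIV. \<alpha> i) = k}. F \<alpha> (\<Sum>i\<in>UNIV. \<alpha> i))
        = (\<Sum>\<alpha> | (\<Sum>i\<in>UNIV. \<alpha> i) \<le> n. F \<alpha> (\<Sum>i\<in>UNIV. \<alpha> i))"
        by (rule sum.group) (auto simp: finite_multi_indices)
      moreover have "{\<alpha>\<in>{\<alpha>. (\<Sum>i\<in>UNIV. \<alpha> i)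
          \<le> n}. (\<Sum>i\<in>UNIV. \<alpha> i) = k}
              = {\<alpha> :: 'b \<Rightarrow> nat. (\<Sum>i\<in>UNIV. \<alpha> i) = k}"
        if "k \<le> n" for k using that by auto
      ultimately show ?thesis by (simp cong: sum.cong_simp)
    qed
    also have "\<dots> = (\<Sum>k\<le>n. \<Sum>\<alpha> | (\<Sum>i\<in>UNIV. \<alpha> i) = k. F \<alpha> k)"
      by (intro sum.cong) auto
    also have "\<dots> = (\<Sum>k\<le>n. \<Sum>x\<in>X. \<kappa> x * \<psi> k (C x) * fps_nth (todd_series
        \<Gamma> K (L x)) k)"
    proof (intro sum.cong refl)
      fix k
      have "(\<Sum>\<alpha> | (\<Sum>i\<in>UNIV. \<alpha> i) = k. F \<alpha> k)
          = (\<Sum>x\<in>X. \<kappa> x * \<psi> k (C x) *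
         (\<Sum>g\<in>\<Gamma>. \<Sum>\<alpha> | (\<Sum>i\<in>UNIV. \<alpha> i)
             = k. \<Prod>i\<in>UNIV. of_real (L x i) ^ \<alpha> i * fps_nth (todd_factor (i \<in> K) (g $ i)) (\<alpha> i)))"
        unfolding F_def sum_distrib_left
        by (subst sum.swap) (intro sum.cong refl, subst sum.swap, simp)
      then show "(\<Sum>\<alpha> | (\<Sum>i\<in>UNIV. \<alpha> i) = k. F \<alpha> k)
          = (\<Sum>x\<in>X. \<kappa> x * \<psi> k (C x) * fps_nth (todd_series \<Gamma> K (L x)) k)"
        by (simp add: todd_series_def fps_sum_nth nth_prod_fscale)
    qed
    finally show ?thesis .
  qed
  ultimately show ?thesis using lim by (simp add: todd_at_0_def)
qed

section \<open>Evaluating Todd series\<close>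

text \<open>The constant and the linear coefficient, \<open>1 - a\<close> and \<open>a\<close>,
  cannot both be zero, so the denominator has order at most \<open>1\<close>.\<close>

lemma todd_denominator:
  fixes a :: complex
  defines "D \<equiv> 1 - fps_const a * fps_exp (-1)"
  shows "D \<noteq> 0" "D dvd fps_X"
proof -
  have nth: "fps_nth D 0 = 1 - a" "fps_nth D 1 = a" by (simp_all add: D_def)
  then show nz: "D \<noteq> 0" by (metis diff_zero fps_zero_nth zero_neq_one)
  have "subdegree D \<le> 1"
    using nth by (cases "a = 0") (auto intro!: subdegree_leI simp: order_trans[OF subdegree_leI[of _ 0]])
  then show "D dvd fps_X" using nz by (simp add: fps_dvd_iff)
qed

lemma todd_factor_eq:
  "todd_factor b a = (fps_X / (1 - fps_const a * fps_exp (-1))) * (if b then fps_const a * fps_exp (-1) else 1)"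
  by (simp add: todd_factor_def div_mult_swap[OF todd_denominator(2)] dvd_div_mult[OF todd_denominator(2)] ac_simps)

lemma todd_factor_times:
  "todd_factor b a * (1 - fps_const a * fps_exp (-1)) = fps_X * (if b then fps_const a * fps_exp (-1) else 1)"
proof -
  define D where "D = 1 - fps_const a * fps_exp (-1 :: complex)"
  define N where "N = (if b then fps_const a * fps_exp (-1 :: complex) else 1)"
  have "fps_X / D * N * D = (fps_X / D * D) * N" by (simp only: ac_simps)
  also have "fps_X / D * D = fps_X"
    unfolding D_def by (rule dvd_div_mult_self[OF todd_denominator(2)])
  finally show ?thesis by (simp only: todd_factor_eq D_def N_def)
qed

lemma fps_conv_radius_const_exp: "fps_conv_radius (fps_const a * fps_exp (-1 :: complex)) = \<infinity>"
  using fps_conv_radius_mult[of "fps_const a" "fps_exp (-1 :: complex)"] by simp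

lemma fps_conv_radius_todd_denominator: "fps_conv_radius (1 - fps_const a * fps_exp (-1 :: complex)) = \<infinity>"
  using fps_conv_radius_diff[of 1 "fps_const a * fps_exp (-1 :: complex)"] by (simp add: fps_conv_radius_const_exp)

lemma todd_factor_radius: "fps_conv_radius (todd_factor b a) > 0"
proof -
  let ?D = "1 - fps_const a * fps_exp (-1 :: complex)"
  have "subdegree ?D \<le> subdegree (fps_X :: complex fps)"
    using todd_denominator[of a] by (intro dvd_imp_subdegree_le) auto
  then have "(\<lambda>x. if x = 0 then fps_nth fps_X (subdegree ?D) / fps_nth ?D (subdegree ?D) else x / eval_fps ?D x)
      has_fps_expansion (fps_X / ?D)"
    using todd_denominator(1)[of a]
    by (intro has_fps_expansion_divide has_fps_expansion_fps_X eval_fps_has_fps_expansion)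
       (auto simp: fps_conv_radius_todd_denominator)
  then have "fps_conv_radius (fps_X / ?D) > 0" by (simp add: has_fps_expansion_def)
  moreover have "fps_conv_radius (if b then fps_const a * fps_exp (-1 :: complex) else 1) = \<infinity>"
    by (simp add: fps_conv_radius_const_exp)
  ultimately show ?thesis
    unfolding todd_factor_eq
    using fps_conv_radius_mult[of "fps_X / ?D" "if b then fps_const a * fps_exp (-1 :: complex) else 1"]
    by (auto intro: less_le_trans)
qed

lemma todd_factor_eval:
  assumes "norm x < fps_conv_radius (todd_factor b a)"
  shows "eval_fps (todd_factor b a) x * (1 - a * exp (- x)) = x * (if b then a * exp (- x) else 1)"
proof -
  have ae: "eval_fps (fps_const a * fps_exp (-1)) x = a * exp (- x)"
    by (subst eval_fps_mult) auto
  have "eval_fps (todd_factor b a) x * eval_fps (1 - fps_const a * fps_exp (-1)) x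
      = eval_fps (fps_X * (if b then fps_const a * fps_exp (-1) else 1)) x"
    unfolding todd_factor_times[symmetric] using assms
    by (subst eval_fps_mult) (auto simp: fps_conv_radius_todd_denominator)
  also have "\<dots> = x * (if b then a * exp (- x) else 1)"
    by (subst eval_fps_mult) (auto simp: fps_conv_radius_const_exp ae)
  also have "eval_fps (1 - fps_const a * fps_exp (-1)) x = 1 - a * exp (- x)"
    by (subst eval_fps_diff) (auto simp: fps_conv_radius_const_exp ae)
  finally show ?thesis .
qed

text \<open>For unimodular \<open>a\<close> and real nonzero \<open>x\<close> the denominator is
  nonzero. The exponent \<open>of_bool b\<close> is where \<open>K\<close> enters: on a removed
  facet the geometric series starts at slack \<open>1\<close> instead of \<open>0\<close>.\<close>

lemma todd_factor_eval_unimodular: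
  assumes "norm (complex_of_real x) < fps_conv_radius (todd_factor b a)" "norm a = 1" "x \<noteq> 0"
  shows "eval_fps (todd_factor b a) (of_real x) =
    of_real x * geom_value (of_bool b) (a * exp (- of_real x))"
proof -
  have "norm (a * exp (- complex_of_real x)) \<noteq> 1" using assms by (simp add: norm_mult)
  then have "1 - a * exp (- complex_of_real x) \<noteq> 0" by auto
  then show ?thesis using todd_factor_eval[OF assms(1)] by (cases b) (auto simp: geom_value_def field_simps)
qed

text \<open>At a vanishing coordinate the Todd factor reduces to its constant term. A group element
  that is nontrivial at a ray off the cone is thereby annihilated.\<close>

lemma todd_factor_nth_0: "fps_nth (todd_factor b a) 0 = of_bool (a = 1)"
proof (cases "a = 1")
  case True
  show ?thesis
    using arg_cong[OF todd_factor_times[of b a], of "\<lambda>f. fps_nth f 1"] True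
    by (simp add: fps_mult_nth split: if_splits)
next
  case False
  then show ?thesis
    using arg_cong[OF todd_factor_times[of b a], of "\<lambda>f. fps_nth f 0"] by simp
qed

lemma fscale_0: "fscale 0 f = fps_const (fps_nth f 0)"
  by (simp add: fscale_def fps_eq_iff power_0_left)

lemma eval_fscale: "eval_fps (fscale c f) z = eval_fps f (c * z)"
  by (simp add: eval_fps_def fscale_def power_mult_distrib ac_simps)

section \<open>Radii of convergence and evaluation of the products and sums\<close>

lemma fscale_radius:
  assumes "ereal (norm c * R) < fps_conv_radius f"
  shows "ereal R < fps_conv_radius (fscale c f)"
proof (cases "c = 0")
  case False
  then have "fps_conv_radius (fscale c f) = fps_conv_radius f / ereal (norm c)"
    by (simp add: fscale_def fps_conv_radius_def conv_radius_mult_power)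
  then show ?thesis using False assms by (simp add: ereal_less_divide_pos)
qed (simp add: fscale_0)

lemma fps_prod_radius:
  fixes f :: "'a \<Rightarrow> complex fps"
  assumes "\<And>i. i \<in> A \<Longrightarrow> ereal R < fps_conv_radius (f i)"
  shows "ereal R < fps_conv_radius (\<Prod>i\<in>A. f i)"
  using assms
proof (induction A rule: infinite_finite_induct)
  case (insert i A)
  then show ?case
    using less_le_trans[OF _ fps_conv_radius_mult[of "f i" "\<Prod>i\<in>A. f i"]] by auto
qed auto

lemma fps_sum_radius:
  fixes f :: "'a \<Rightarrow> complex fps"
  assumes "\<And>i. i \<in> A \<Longrightarrow> ereal R < fps_conv_radius (f i)"
  shows "ereal R < fps_conv_radius (\<Sum>i\<in>A. f i)"
  using assms
proof (induction A rule: infinite_finite_induct)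
  case (insert i A)
  then show ?case
    using less_le_trans[OF _ fps_conv_radius_add[of "f i" "\<Sum>i\<in>A. f i"]] by auto
qed auto

lemma eval_fps_prod:
  fixes f :: "'a \<Rightarrow> complex fps"
  assumes "\<And>i. i \<in> A \<Longrightarrow> norm z < fps_conv_radius (f i)"
  shows "eval_fps (\<Prod>i\<in>A. f i) z = (\<Prod>i\<in>A. eval_fps (f i) z)"
  using assms
proof (induction A rule: infinite_finite_induct)
  case (insert i A)
  then show ?case by (simp add: eval_fps_mult fps_prod_radius)
qed auto

lemma eval_fps_sum:
  fixes f :: "'a \<Rightarrow> complex fps"
  assumes "\<And>i. i \<in> A \<Longrightarrow> norm z < fps_conv_radius (f i)"
  shows "eval_fps (\<Sum>i\<in>A. f i) z = (\<Sum>i\<in>A. eval_fps (f i) z)"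
  using assms
proof (induction A rule: infinite_finite_induct)
  case (insert i A)
  then show ?case by (simp add: eval_fps_add fps_sum_radius)
qed auto

lemma common_radius:
  fixes S :: "complex fps set"
  assumes "finite S" "\<And>f. f \<in> S \<Longrightarrow> fps_conv_radius f > 0"
  shows "\<exists>r>0. \<forall>f\<in>S. ereal r < fps_conv_radius f"
  using assms
proof (induction S rule: finite_induct)
  case empty
  show ?case by (intro exI[of _ 1]) auto
next
  case (insert f S)
  then obtain r where r: "r > 0" "\<forall>f\<in>S. ereal r < fps_conv_radius f" by auto
  obtain q where q: "0 < ereal q" "ereal q < fps_conv_radius f"
    using ereal_dense2[of 0 "fps_conv_radius f"] insert.prems by auto
  show ?case
    by (intro exI[of _ "min r q"]) (use r q in \<open>auto intro: le_less_trans[of _ "ereal r"] le_less_trans[of _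
        "ereal q"]\<close>)
qed

lemma todd_common_radius:
  fixes \<Gamma> :: "(complex ^ 'r::finite) set"
  assumes "finite \<Gamma>"
  obtains r where "r > 0" "\<And>g i b. g \<in> \<Gamma> \<Longrightarrow> ereal r < fps_conv_radius (todd_factor b (g $ i))"
proof -
  let ?S = "(\<lambda>(g, i, b). todd_factor b (g $ i)) ` (\<Gamma> \<times> UNIV \<times> UNIV)"
  have "\<exists>r>0. \<forall>f\<in>?S. ereal r < fps_conv_radius f"
    using assms by (intro common_radius) (auto simp: todd_factor_radius)
  then show ?thesis using that by force
qed

lemma todd_series_radius:
  assumes "\<And>g i. g \<in> \<Gamma> \<Longrightarrow> ereal (\<bar>l i\<bar> * R)
      < fps_conv_radius (todd_factor (i \<in> K) (g $ i))"
  shows "ereal R < fps_conv_radius (todd_series \<Gamma> K l)"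
  unfolding todd_series_def using assms
  by (intro fps_sum_radius fps_prod_radius fscale_radius) auto

lemma todd_series_eval:
  assumes "\<And>g i. g \<in> \<Gamma> \<Longrightarrow> ereal (\<bar>l i\<bar> * norm z)
      < fps_conv_radius (todd_factor (i \<in> K) (g $ i))"
  shows "eval_fps (todd_series \<Gamma> K l) z = (\<Sum>g\<in>\<Gamma>. \<Prod>i\<in>UNIV. eval_fps (todd_factor
      (i \<in> K) (g $ i)) (of_real (l i) * z))"
proof -
  have *: "norm z < fps_conv_radius (fscale (of_real (l i)) (todd_factor (i \<in> K) (g $ i)))" if "g \<in> \<Gamma>" for g i
    using assms[OF that] by (intro fscale_radius) auto
  then show ?thesis
    unfolding todd_series_def by (simp add: eval_fps_sum eval_fps_prod fps_prod_radius eval_fscale)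
qed

text \<open>An identity theorem from positive reals alone, where the cone integrals and sums
  converge. After division by the lowest power of \<open>X\<close>, the quotient vanishes for small
  \<open>t > 0\<close>, hence at \<open>0\<close> by continuity.\<close>

lemma fps_eq_of_eval_eq:
  fixes A B :: "complex fps"
  assumes "fps_conv_radius A > 0" "fps_conv_radius B > 0" and e: "e > 0"
    and eq: "\<And>t. 0 < t \<Longrightarrow> t < e \<Longrightarrow> eval_fps A (of_real t) = eval_fps B (of_real t)"
  shows "A = B"
proof (rule ccontr)
  assume "A \<noteq> B"
  define F where "F = A - B"
  have F0: "F \<noteq> 0" using \<open>A \<noteq> B\<close> by (simp add: F_def)
  define k where "k = subdegree F"
  define G where "G = fps_shift k F"
  have FG: "F = G * fps_X ^ k" unfolding G_def k_def by (rule subdegree_decompose)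
  have G0: "fps_nth G 0 \<noteq> 0" using F0 by (simp add: G_def k_def)
  have radF: "fps_conv_radius F > 0"
    unfolding F_def using assms(1,2) by (intro less_le_trans[OF _ fps_conv_radius_diff]) auto
  then have radG: "fps_conv_radius G > 0" by (simp add: G_def)
  obtain r where r: "r > 0" "ereal r < fps_conv_radius A" "ereal r < fps_conv_radius B" "ereal r < fps_conv_radius G"
    using common_radius[of "{A, B, G}"] assms(1,2) radG by auto
  have small: "ereal (norm z) < fps_conv_radius f" if "norm z < r" "f \<in> {A, B, G}" for z :: complex and f
    using that r by (auto intro: less_trans[of _ "ereal r"])
  have G_zero: "eval_fps G (of_real t) = 0" if t: "0 < t" "t < min e r" for t
  proof -
    have n: "norm (complex_of_real t) < r" using t by simp
    have "eval_fps F (of_real t) = 0"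
      unfolding F_def using eq[of t] t small[OF n] by (subst eval_fps_diff) auto
    moreover have "eval_fps F (of_real t) = eval_fps G (of_real t) * of_real t ^ k"
      unfolding FG using small[OF n] by (subst eval_fps_mult) auto
    ultimately show ?thesis using t by simp
  qed
  have "isCont (eval_fps G) 0"
    using radG by (intro continuous_eval_fps) (auto simp: zero_ereal_def)
  then have lim: "((\<lambda>t. eval_fps G (complex_of_real t)) \<longlongrightarrow> eval_fps G 0) (at_right 0)"
    by (intro isCont_tendsto_compose[of 0 "eval_fps G"]) (auto intro!: tendsto_eq_intros)
  have "\<forall>\<^sub>F t in at_right 0. eval_fps G (complex_of_real t) = 0"
    unfolding eventually_at_right_field using G_zero e r(1) by (intro exI[of _ "min e r"]) auto
  then have "((\<lambda>t. eval_fps G (complex_of_real t)) \<longlongrightarrow> 0) (at_right 0)"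
    by (rule tendsto_eventually)
  with lim have "eval_fps G 0 = 0" using tendsto_unique[OF trivial_limit_at_right_real] by blast
  then show False using G0 by (simp add: eval_fps_at_0)
qed

section \<open>The operator on powers and on exponentials\<close>

definition divided_power :: "nat \<Rightarrow> nat \<Rightarrow> real \<Rightarrow> complex" where
  "divided_power N k y = (if k \<le> N then of_real (y ^ (N - k) / fact (N - k)) else 0)"

lemma divided_power_deriv:
  "(divided_power N k has_vector_derivative divided_power N (Suc k) y) (at y)"
proof -
  have "((\<lambda>y. y ^ m / fact m) has_real_derivative (if m = 0 then 0 else y ^ (m - 1) / fact (m - 1))) (at y)" for m
  proof (cases m)
    case (Suc j)
    have "((\<lambda>y. y ^ Suc j / fact (Suc j)) has_real_derivative (of_nat (Suc j) * (1 * y ^ j) / fact (Suc j))) (at y)"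
      by (rule DERIV_cdivide) (use DERIV_pow[of "Suc j" y] in simp)
    then show ?thesis using Suc by (simp add: field_simps del: of_nat_Suc power_Suc)
  qed simp
  then have "((\<lambda>y. complex_of_real (y ^ m / fact m)) has_vector_derivative
      of_real (if m = 0 then 0 else y ^ (m - 1) / fact (m - 1))) (at y)" for m
    by (intro has_vector_derivative_of_real) (simp add: has_real_derivative_iff_has_vector_derivative)
  from this[of "N - k"] show ?thesis
    unfolding divided_power_def[abs_def] by (cases "k \<le> N"; cases "k = N") (auto simp: Suc_le_eq Suc_diff_le)
qed

text \<open>With the normalisation \<open>y ^ N / fact N\<close> the \<open>k\<close>-th derivative
  at \<open>C x\<close> is the coefficient of order \<open>N - k\<close> of
  \<open>fps_exp (of_real (C x))\<close>. The operator thus yields a coefficient of a Cauchy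
  product, and orders above \<open>N\<close> contribute nothing.\<close>

lemma todd_at_0_power:
  "todd_at_0 \<Gamma> K (ridge X \<kappa> C L (\<lambda>y. of_real (y ^ N / fact N)))
     (\<Sum>x\<in>X. \<kappa> x * fps_nth (todd_series \<Gamma> K (L x) * fps_exp (of_real (C x))) N)"
proof -
  have eq: "(\<Sum>k\<le>n. \<Sum>x\<in>X. \<kappa> x * divided_power N k (C x) * fps_nth (todd_series \<Gamma> K (L x)) k)
     = (\<Sum>x\<in>X. \<kappa> x * fps_nth (todd_series \<Gamma> K (L x) * fps_exp (of_real (C x))) N)" if "n \<ge> N" for n
  proof -
    have "(\<Sum>k\<le>n. \<kappa> x * divided_power N k (C x) * fps_nth (todd_series \<Gamma> K (L x)) k)
       = \<kappa> x * fps_nth (todd_series \<Gamma> K (L x) * fps_exp (of_real (C x))) N" for x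
    proof -
      have "(\<Sum>k\<le>n. \<kappa> x * divided_power N k (C x) * fps_nth (todd_series \<Gamma> K (L x)) k)
        = (\<Sum>k\<le>N. \<kappa> x * divided_power N k (C x) * fps_nth (todd_series \<Gamma> K (L x)) k)"
        using that by (intro sum.mono_neutral_right) (auto simp: divided_power_def)
      also have "\<dots> = \<kappa> x * fps_nth (todd_series \<Gamma> K (L x) * fps_exp (of_real (C x))) N"
        by (simp add: fps_mult_nth divided_power_def atLeast0AtMost sum_distrib_left mult.assoc mult.left_commute)
          (simp add: mult.commute)
      finally show ?thesis .
    qed
    then show ?thesis by (subst sum.swap) simp
  qed
  have "(\<lambda>n. \<Sum>k\<le>n. \<Sum>x\<in>X. \<kappa> x * divided_power N k (C x) * fps_nth (todd_series
      \<Gamma> K (L x)) k)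
     \<longlonglongrightarrow> (\<Sum>x\<in>X. \<kappa> x * fps_nth (todd_series \<Gamma> K (L x) * fps_exp
         (of_real (C x))) N)"
    by (rule tendsto_eventually) (use eq in \<open>auto simp: eventually_sequentially\<close>)
  from todd_at_0_ridge[where \<psi> = "divided_power N", OF divided_power_deriv this]
  show ?thesis by (simp add: divided_power_def[abs_def])
qed

text \<open>All derivatives of the exponential coincide, so the truncations are partial sums of the
  symbol at \<open>1\<close>. The radius condition is the reason why \<open>z\<close> has to be
  small in the local formula.\<close>

lemma todd_at_0_exp:
  assumes "1 < fps_conv_radius (todd_series \<Gamma> K L)"
  shows "todd_at_0 \<Gamma> K (\<lambda>h. \<kappa> * exp (of_real (C + (\<Sum>i\<in>UNIV. L i * h $ i))))
     (\<kappa> * exp (of_real C) * eval_fps (todd_series \<Gamma> K L) 1)"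
proof -
  have "((\<lambda>y. exp (complex_of_real y)) has_vector_derivative exp (of_real y)) (at y)" for y
    using has_vector_derivative_of_real[of exp "exp y" "at y"]
    by (simp add: exp_of_real has_real_derivative_iff_has_vector_derivative[symmetric])
  note deriv = this
  have "(\<lambda>n. fps_nth (todd_series \<Gamma> K L) n * 1 ^ n) sums eval_fps (todd_series \<Gamma> K L) 1"
    by (rule sums_eval_fps) (use assms in \<open>simp add: one_ereal_def\<close>)
  then have "(\<lambda>n. \<Sum>k\<le>n. fps_nth (todd_series \<Gamma> K L) k) \<longlonglongrightarrow> eval_fps
      (todd_series \<Gamma> K L) 1"
    by (simp add: sums_def_le)
  then have "(\<lambda>n. \<kappa> * exp (of_real C)
      * (\<Sum>k\<le>n. fps_nth (todd_series \<Gamma> K L) k)) \<longlonglongrightarrow> \<kappa> * exp (of_real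
          C) * eval_fps (todd_series \<Gamma> K L) 1"
    by (rule tendsto_mult_left)
  then have lim: "(\<lambda>n. \<Sum>k\<le>n. \<Sum>x\<in>{()}. \<kappa> * exp (of_real C) * fps_nth (todd_series
      \<Gamma> K L) k) \<longlonglongrightarrow> \<kappa> * exp (of_real C) * eval_fps (todd_series \<Gamma> K L) 1"
    by (simp add: sum_distrib_left)
  have "todd_at_0 \<Gamma> K (ridge {()} (\<lambda>_. \<kappa>) (\<lambda>_. C) (\<lambda>_. L) (\<lambda>y. exp
      (complex_of_real y))) (\<kappa> * exp (of_real C) * eval_fps (todd_series \<Gamma> K L) 1)"
    by (rule todd_at_0_ridge[where \<psi> = "\<lambda>_ y. exp (complex_of_real y)", OF deriv lim])
  then show ?thesis by (simp add: ridge_def[abs_def])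
qed

section \<open>Vertex contributions\<close>

lemma of_real_of_bool: "of_real (of_bool P) = of_bool P"
  by (cases P) auto

locale lattice_hpolytope =
  simple_hpolytope "\<lambda>i. rvec (u i)" "\<lambda>i. real_of_int (c i)"
  for u :: "'r::{finite,linorder} \<Rightarrow> int ^ 'n" and c :: "'r \<Rightarrow> int" +
  assumes vertex_integral: "v \<in> V \<Longrightarrow> \<exists>m. v = rvec m"
    and nonempty: "hpoly 0 \<noteq> {}"
begin

text \<open>A \<open>lattice_frame\<close> is indexed by the dimension type \<open>'n\<close>, while
  tight sets consist of facet indices; simplicity provides the bijection.\<close>

definition en :: "real ^ 'n \<Rightarrow> 'n \<Rightarrow> 'r" where
  "en v = (SOME e. bij_betw e UNIV (tight v))"

lemma bij_en: "v \<in> V \<Longrightarrow> bij_betw (en v) UNIV (tight v)"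
proof -
  assume "v \<in> V"
  then have "\<exists>e :: 'n \<Rightarrow> 'r. bij_betw e UNIV (tight v)"
    by (intro finite_same_card_bij) (simp_all add: card_tight)
  then show ?thesis unfolding en_def by (rule someI_ex)
qed

lemma en_tight: "v \<in> V \<Longrightarrow> en v j \<in> tight v"
  using bij_en by (auto simp: bij_betw_def)

lemma frame: "v \<in> V \<Longrightarrow> lattice_frame (\<lambda>j. u (en v j)) (\<lambda>j. d v (en v j))"
  using bij_en[of v]
  by unfold_locales (auto simp: dual_tight en_tight bij_betw_def inj_on_eq_iff)

lemma prod_tight: "v \<in> V \<Longrightarrow> (\<Prod>i\<in>tight v. f i) = (\<Prod>j\<in>UNIV. f (en v j))"
  by (rule prod.reindex_bij_betw[OF bij_en, symmetric])

lemma sum_tight: "v \<in> V \<Longrightarrow> (\<Sum>i\<in>tight v. f i) = (\<Sum>j\<in>UNIV. f (en v j))"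
  by (rule sum.reindex_bij_betw[OF bij_en, symmetric])

definition Gamv :: "real ^ 'n \<Rightarrow> ('n \<Rightarrow> complex) set" where
  "Gamv v = lattice_frame.Gam (\<lambda>j. u (en v j))"

lemma Gamv_eq:
  "v \<in> V \<Longrightarrow> Gamv v = {g. (\<forall>j. g j \<noteq> 0)
      \<and> (\<forall>l. (\<Prod>j\<in>UNIV. g j powi (u (en v j) $ l)) = 1)}"
  unfolding Gamv_def by (rule lattice_frame.Gam_def[OF frame])

lemma bij_Gamv:
  assumes v: "v \<in> V"
  shows "bij_betw (\<lambda>g j. g $ en v j) {g\<in>grp_G u. \<forall>i. i \<notin> tight v \<longrightarrow> g $
      i = 1} (Gamv v)"
proof -
  define ext where "ext \<gamma> = (\<chi> i. (if i \<in> tight v then \<gamma> (inv (en v) i) else (1 ::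
      complex)))" for \<gamma> :: "'n \<Rightarrow> complex"
  have inj: "inj (en v)" using bij_en[OF v] by (auto simp: bij_betw_def)
  have inv: "inv (en v) (en v j) = j" for j using inj by simp
  have inv2: "en v (inv (en v) i) = i" if "i \<in> tight v" for i
    using that bij_en[OF v] by (metis bij_betw_def f_inv_into_f)
  have iff: "g \<in> grp_G u \<longleftrightarrow> (\<lambda>j. g $ en v j) \<in> Gamv v" if g: "\<forall>i. i
      \<notin> tight v \<longrightarrow> g $ i = 1" for g
  proof -
    have nz: "(\<forall>i. g $ i \<noteq> 0) \<longleftrightarrow> (\<forall>j. g $ en v j \<noteq> 0)"
      using g inv2 by (metis zero_neq_one)
    have "(\<Prod>i\<in>UNIV. one_param (u i) (g $ i)) $ l = (\<Prod>i\<in>UNIV. g $ i powi (u i $ l))" for l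
    proof -
      have "(\<Prod>i\<in>A. one_param (u i) (g $ i)) $ l = (\<Prod>i\<in>A. g $ i powi (u i $ l))" for A
        by (induction A rule: infinite_finite_induct) (auto simp: one_param_def)
      then show ?thesis .
    qed
    moreover have "(\<Prod>i\<in>UNIV. g $ i powi (u i $ l)) = (\<Prod>i\<in>tight v. g $ i powi (u i $ l))" for l
      using g by (intro prod.mono_neutral_right) auto
    ultimately have "(\<Prod>i\<in>UNIV. one_param (u i) (g $ i)) $ l
        = (\<Prod>j\<in>UNIV. g $ en v j powi (u (en v j) $ l))" for l
      by (simp add: prod_tight[OF v])
    then show ?thesis
      by (simp add: grp_G_def Gamv_eq[OF v] nz vec_eq_iff[of _ 1])
  qed
  show ?thesis
  proof (rule bij_betwI[where g = ext])
    show "(\<lambda>g j. g $ en v j) \<in> {g \<in> grp_G u. \<forall>i. i \<notin> tight v \<longrightarrow> g $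
        i = 1} \<rightarrow> Gamv v"
      using iff by auto
    have e: "(\<lambda>j. ext \<gamma> $ en v j) = \<gamma>" for \<gamma> by (simp add: ext_def en_tight[OF v] inv)
    show "ext \<in> Gamv v \<rightarrow> {g \<in> grp_G u. \<forall>i. i \<notin> tight v \<longrightarrow> g $ i = 1}"
      using iff[of "ext _"] by (auto simp: e) (auto simp: ext_def)
    show "(\<lambda>j. ext \<gamma> $ en v j) = \<gamma>" for \<gamma> by (rule e)
    show "ext (\<lambda>j. g $ en v j) = g" if "g \<in> {g \<in> grp_G u. \<forall>i. i \<notin> tight v
        \<longrightarrow> g $ i = 1}" for g
      using that by (auto simp: ext_def vec_eq_iff inv2)
  qed
qed

lemma finite_grp_vertex:
  "v \<in> V \<Longrightarrow> finite {g\<in>grp_G u. \<forall>i. i \<notin> tight v \<longrightarrow> g $ i = 1}"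
  using bij_betw_finite[OF bij_Gamv] lattice_frame.finite_Gam[OF frame] by (simp add: Gamv_def)

definition mult :: "real ^ 'n \<Rightarrow> real" where
  "mult v = real (card (Gamv v))"

definition coord :: "real ^ 'n \<Rightarrow> real ^ 'n \<Rightarrow> 'r \<Rightarrow> real" where
  "coord v \<xi> i = (if i \<in> tight v then \<xi> \<bullet> d v i else 0)"

definition regular :: "real ^ 'n \<Rightarrow> real ^ 'n \<Rightarrow> bool" where
  "regular v \<xi> \<longleftrightarrow> (\<forall>i\<in>tight v. \<xi> \<bullet> d v i \<noteq> 0)"

text \<open>The coordinates enter without absolute values: the signs of the flipped inequalities are
  absorbed here.\<close>

definition weight :: "real ^ 'n \<Rightarrow> real ^ 'n \<Rightarrow> real" where
  "weight v \<xi> = 1 / (mult v * (\<Prod>i\<in>tight v. \<xi> \<bullet> d v i))"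

text \<open>For a vertex this is \<open>- (v \<bullet> \<xi>)\<close>, because \<open>c i\<close> is
  minus the pairing of \<open>v\<close> with \<open>u i\<close> at tight \<open>i\<close>. Written
  through \<open>c\<close>, it shows how a shift \<open>h\<close> acts.\<close>

definition offset :: "real ^ 'n \<Rightarrow> real ^ 'n \<Rightarrow> real" where
  "offset v \<xi> = (\<Sum>i\<in>tight v. (\<xi> \<bullet> d v i) * c i)"

end

text \<open>\<open>\<Gamma>\<close> stands for \<open>G\<^sub>\<Sigma>\<close>; all that matters is which of
  its elements are trivial off a vertex cone.\<close>

locale lattice_hpolytope_todd = lattice_hpolytope u c
  for u :: "'r::{finite,linorder} \<Rightarrow> int ^ 'n" and c :: "'r \<Rightarrow> int" +
  fixes \<Gamma> :: "(complex ^ 'r::{finite,linorder}) set" and K :: "'r set"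
  assumes finite_\<Gamma>: "finite \<Gamma>"
    and \<Gamma>_vertex: "v \<in> V \<Longrightarrow> {g\<in>\<Gamma>. \<forall>i. i \<notin> tight v
        \<longrightarrow> g $ i = 1} = {g\<in>grp_G u. \<forall>i. i \<notin> tight v \<longrightarrow> g $ i = 1}"
begin

text \<open>Outside the vertex cone every factor is \<open>1\<close> or \<open>0\<close> according
  as \<open>g $ i = 1\<close> or not, which cuts \<open>\<Gamma>\<close> down to the group of the
  vertex. On the cone the factors are geometric terms.\<close>

lemma todd_series_vertex:
  assumes v: "v \<in> V" and reg: "regular v \<xi>" and t: "t \<noteq> 0"
    and r: "\<And>g i b. g \<in> \<Gamma> \<Longrightarrow> ereal r < fps_conv_radius (todd_factor b (g $ i))"
    and small: "\<And>i. \<bar>coord v \<xi> i * t\<bar> \<le> r"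
  shows "eval_fps (todd_series \<Gamma> K (coord v \<xi>)) (of_real t) =
    (\<Sum>\<gamma>\<in>Gamv v. \<Prod>j\<in>UNIV. of_real (t * (\<xi> \<bullet> d v (en v j))) *
      geom_value (of_bool (en v j \<in> K)) (\<gamma> j * exp (- of_real (t * (\<xi> \<bullet> d v (en v j))))))"
proof -
  let ?\<Gamma>v = "{g\<in>\<Gamma>. \<forall>i. i \<notin> tight v \<longrightarrow> g $ i = 1}"
  define E where "E g i = eval_fps (todd_factor (i \<in> K) (g $ i)) (of_real (coord v \<xi> i * t))" for g i
  have rad: "ereal (\<bar>coord v \<xi> i * t\<bar>)
      < fps_conv_radius (todd_factor b (g $ i))" if "g \<in> \<Gamma>" for g i b
    using small[of i] r[OF that, of b i] by (metis ereal_less_eq(3) le_less_trans)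
  have off: "E g i = of_bool (g $ i = 1)" if "i \<notin> tight v" for g i
    using that by (simp add: E_def coord_def eval_fps_at_0 todd_factor_nth_0)
  have "eval_fps (todd_series \<Gamma> K (coord v \<xi>)) (of_real t) = (\<Sum>g\<in>\<Gamma>. \<Prod>i\<in>UNIV. E g i)"
    using rad by (subst todd_series_eval) (auto simp: E_def abs_mult)
  also have "\<dots> = (\<Sum>g\<in>?\<Gamma>v. \<Prod>i\<in>UNIV. E g i)"
  proof (rule sum.mono_neutral_right[OF finite_\<Gamma>])
    show "\<forall>g\<in>\<Gamma> - ?\<Gamma>v. (\<Prod>i\<in>UNIV. E g i) = 0"
      by (auto intro!: prod_zero) (metis of_bool_eq(1) off)
  qed auto
  also have "\<dots> = (\<Sum>g\<in>?\<Gamma>v. \<Prod>j\<in>UNIV. E g (en v j))"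
  proof (intro sum.cong refl)
    fix g assume "g \<in> ?\<Gamma>v"
    then have "(\<Prod>i\<in>UNIV. E g i) = (\<Prod>i\<in>tight v. E g i)"
      by (intro prod.mono_neutral_right) (auto simp: off)
    then show "(\<Prod>i\<in>UNIV. E g i) = (\<Prod>j\<in>UNIV. E g (en v j))" by (simp add: prod_tight[OF v])
  qed
  also have "\<dots> = (\<Sum>g\<in>?\<Gamma>v. \<Prod>j\<in>UNIV. of_real (t * (\<xi> \<bullet> d v (en v j))) *
      geom_value (of_bool (en v j \<in> K)) (g $ en v j * exp (- of_real (t * (\<xi> \<bullet> d v (en v j))))))"
  proof (intro sum.cong prod.cong refl)
    fix g j assume g: "g \<in> ?\<Gamma>v"
    have "(\<lambda>j. g $ en v j) \<in> Gamv v" using bij_Gamv[OF v] g \<Gamma>_vertex[OF v] by (auto simp: bij_betw_def)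
    then have n: "norm (g $ en v j) = 1"
      using lattice_frame.norm_Gam[OF frame[OF v]] by (simp add: Gamv_def)
    have co: "coord v \<xi> (en v j) * t = t * (\<xi> \<bullet> d v (en v j))" by (simp add: coord_def en_tight[OF v])
    have "norm (complex_of_real (t * (\<xi> \<bullet> d v (en v j))))
        < fps_conv_radius (todd_factor (en v j \<in> K) (g $ en v j))"
      using rad[of g "en v j"] g unfolding co norm_of_real by simp
    moreover have "t * (\<xi> \<bullet> d v (en v j)) \<noteq> 0" using reg t en_tight[OF v] by (auto simp: regular_def)
    ultimately show "E g (en v j) = of_real (t * (\<xi> \<bullet> d v (en v j))) *
      geom_value (of_bool (en v j \<in> K)) (g $ en v j * exp (- of_real (t * (\<xi> \<bullet> d v (en v j)))))"
      unfolding E_def co using n by (intro todd_factor_eval_unimodular)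
  qed
  finally show ?thesis
    unfolding \<Gamma>_vertex[OF v] by (simp add: sum.reindex_bij_betw[OF bij_Gamv[OF v], symmetric])
qed

lemma inner_coords:
  assumes "v \<in> V" shows "x \<bullet> \<xi> = (\<Sum>j\<in>UNIV. (\<xi> \<bullet> d v (en v j))
      * (x \<bullet> rvec (u (en v j))))"
  using expand_tight[OF assms, of x \<xi>] by (simp add: sum_tight[OF assms] mult.commute)

lemma prod_mult_const: "(\<Prod>j\<in>(UNIV :: 'n set). t * f j)
    = (t :: 'a :: comm_monoid_mult) ^ CARD('n) * (\<Prod>j\<in>UNIV. f j)"
  by (simp add: prod.distrib)

lemma polar_factor_eq: "l \<noteq> 0 \<Longrightarrow> polar_factor l s
    = sgn l * of_bool (if l > 0 then 0 \<le> s else s < 0)"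
  by (auto simp: polar_factor_def)

text \<open>The product of polar factors is a sign times the indicator of the flipped cone, and this
  sign turns the absolute values of \<open>cone_integral\<close> into plain products.\<close>

lemma vertex_integral_exp:
  assumes v: "v \<in> V" and reg: "regular v \<xi>" and t: "t > 0"
  shows "has_bochner_integral lborel
    (\<lambda>x. (\<Prod>i\<in>tight v. polar_factor (\<xi> \<bullet> d v i) (x \<bullet> rvec (u i) + c i
        + h $ i)) * exp (- (t * (x \<bullet> \<xi>))))
    (weight v \<xi> * exp (t * (offset v \<xi> + (\<Sum>i\<in>UNIV. coord v \<xi> i * h $ i))) / t ^ CARD('n))"
proof -
  define l where "l j = \<xi> \<bullet> d v (en v j)" for j
  have l: "l j \<noteq> 0" for j using reg en_tight[OF v] by (auto simp: l_def regular_def)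
  define s where "s = (\<Prod>j\<in>(UNIV::'n set). sgn (l j))"
  have tl: "t * l j \<noteq> 0" "sgn (t * l j) = sgn (l j)" "t * l j > 0 \<longleftrightarrow> l j > 0" for j
    using l t by (auto simp: sgn_mult zero_less_mult_iff)
  have "has_bochner_integral lborel
    (\<lambda>x. \<Prod>j\<in>UNIV. indicator (halfline (t * l j) (c (en v j)
        + h $ en v j)) (x \<bullet> rvec (u (en v j))) * exp (- (t * l j * (x \<bullet> rvec (u (en v j))))))
    ((\<Prod>j\<in>UNIV. exp (t * l j * (c (en v j) + h $ en v j)) / \<bar>t * l j\<bar>) / mult v)"
    unfolding mult_def Gamv_def by (rule lattice_frame.cone_integral[OF frame[OF v]]) (rule tl(1))
  from has_bochner_integral_mult_right[OF this, of s]
  show ?thesis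
  proof (rule has_bochner_integral_cong[THEN iffD1, rotated -1])
    fix x :: "real ^ 'n"
    have "exp (- (t * (x \<bullet> \<xi>))) = (\<Prod>j\<in>UNIV. exp (- (t * l j * (x \<bullet> rvec (u (en v j))))))"
      unfolding inner_coords[OF v, of x \<xi>] by (simp add: exp_sum[symmetric] sum_negf sum_distrib_left l_def mult.assoc)
    then show "s * (\<Prod>j\<in>UNIV. indicator (halfline (t * l j) (c (en v j)
        + h $ en v j)) (x \<bullet> rvec (u (en v j))) * exp (- (t * l j * (x \<bullet> rvec (u (en v j)))))) =
      (\<Prod>i\<in>tight v. polar_factor (\<xi> \<bullet> d v i) (x \<bullet> rvec (u i) + c i
          + h $ i)) * exp (- (t * (x \<bullet> \<xi>)))"
      unfolding prod_tight[OF v] s_def prod.distrib[symmetric] l_def[symmetric]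
      by (simp only:) (auto simp: prod.distrib[symmetric] polar_factor_eq l halfline_def tl add.assoc
          indicator_def intro!: prod.cong)
  next
    have "s * ((\<Prod>j\<in>UNIV. exp (t * l j * (c (en v j) + h $ en v j)) / \<bar>t * l j\<bar>))
        = (\<Prod>j\<in>UNIV. exp (t * l j * (c (en v j) + h $ en v j)) / (t * l j))"
      unfolding s_def prod.distrib[symmetric]
    proof (intro prod.cong refl)
      fix j show "sgn (l j) * (exp (t * l j * (c (en v j) + h $ en v j)) / \<bar>t * l j\<bar>)
          = exp (t * l j * (c (en v j) + h $ en v j)) / (t * l j)"
        using l[of j] t by (cases "l j > 0") (auto simp: abs_mult)
    qed
    also have "\<dots> = exp (t * (offset v \<xi> + (\<Sum>i\<in>UNIV. coord v \<xi> i * h $ i))) / (t ^ CARD('n)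
        * (\<Prod>j\<in>UNIV. l j))"
    proof -
      have "(\<Sum>i\<in>UNIV. coord v \<xi> i * h $ i) = (\<Sum>i\<in>tight v. coord v \<xi> i * h $ i)"
        by (intro sum.mono_neutral_right) (auto simp: coord_def)
      also have "\<dots> = (\<Sum>j\<in>UNIV. l j * h $ en v j)"
        by (simp add: sum_tight[OF v] coord_def en_tight[OF v] l_def)
      finally have "t * (offset v \<xi> + (\<Sum>i\<in>UNIV. coord v \<xi> i * h $ i))
          = (\<Sum>j\<in>UNIV. t * l j * (c (en v j) + h $ en v j))"
        by (simp add: offset_def sum_tight[OF v] l_def[symmetric] sum.distrib[symmetric] sum_distrib_left algebra_simps)
      then show ?thesis by (simp add: prod_dividef exp_sum prod_mult_const)
    qed
    finally show "s * ((\<Prod>j\<in>UNIV. exp (t * l j * (c (en v j) + h $ en v j)) / \<bar>t * l j\<bar>) / mult v) =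
       weight v \<xi> * exp (t * (offset v \<xi> + (\<Sum>i\<in>UNIV. coord v \<xi> i * h $ i))) / t ^ CARD('n)"
      by (simp add: weight_def prod_tight[OF v] l_def[symmetric] field_simps)
  qed simp
qed

text \<open>Compared with \<open>vertex_integral_exp\<close>, each factor
  \<open>1 / (t * l j)\<close> is replaced by a geometric term. Their quotient is a Todd factor
  evaluated at \<open>t * l j\<close>, which explains the extra factor
  \<open>todd_series\<close>.\<close>

lemma vertex_sum_exp:
  assumes v: "v \<in> V" and reg: "regular v \<xi>" and t: "t > 0"
    and r: "\<And>g i b. g \<in> \<Gamma> \<Longrightarrow> ereal r < fps_conv_radius (todd_factor b (g $ i))"
    and small: "\<And>i. \<bar>coord v \<xi> i * t\<bar> \<le> r"
    and \<delta>: "0 < \<delta>" "\<delta> \<le> 1"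
  shows "((\<lambda>m. of_real ((\<Prod>i\<in>tight v. polar_factor (\<xi> \<bullet> d v i) (rvec m \<bullet> rvec
      (u i) + c i - \<delta> * of_bool (i \<in> K))) * exp (- (t * (rvec m \<bullet> \<xi>)))))
     has_sum
     (of_real (weight v \<xi>) * exp (of_real (t * offset v \<xi>)) * eval_fps (todd_series \<Gamma> K (coord v
         \<xi>)) (of_real t) / of_real (t ^ CARD('n)))) UNIV"
proof -
  define l where "l j = \<xi> \<bullet> d v (en v j)" for j
  have l: "l j \<noteq> 0" for j using reg en_tight[OF v] by (auto simp: l_def regular_def)
  define s where "s = (\<Prod>j\<in>(UNIV::'n set). sgn (l j))"
  have tl: "t * l j \<noteq> 0" "sgn (t * l j) = sgn (l j)" "t * l j > 0 \<longleftrightarrow> l j > 0" for j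
    using l t by (auto simp: sgn_mult zero_less_mult_iff)
  define b where "b j = (of_bool (en v j \<in> K) :: int)" for j
  obtain m0 where m0: "v = rvec m0" using vertex_integral[OF v] by blast
  have cm: "c (en v j) = - ipair m0 (u (en v j))" for j
  proof -
    have "real_of_int (ipair m0 (u (en v j)) + c (en v j)) = 0"
      using en_tight[OF v, of j] by (simp add: tight_def m0 rvec_inner)
    then show ?thesis by linarith
  qed
  define W where "W \<gamma> j = geom_value (b j) (\<gamma> j * exp (- complex_of_real (t * l j)))" for \<gamma> j
  have "((\<lambda>m. (\<Prod>j\<in>UNIV. of_bool (ipair m (u (en v j))
      + c (en v j) \<in> halfints (t * l j) (b j)) * exp (- (of_real (t * l j) * of_int (ipair m (u (en v j)))))))
      has_sum
      (\<Sum>\<gamma>\<in>Gamv v. \<Prod>j\<in>UNIV. exp (of_real (t * l j) * of_int (c (en v j)))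
          * (of_real (sgn (l j)) * W \<gamma> j)) / (of_nat (card (Gamv v)) :: complex)) UNIV"
    using lattice_frame.cone_sum[OF frame[OF v], of "\<lambda>j. t * l j" "\<lambda>j. c (en v j)" m0 b] tl cm
    by (simp add: Gamv_def W_def)
  from has_sum_cmult_right[OF this, of "of_real s"]
  show ?thesis
  proof (rule has_sum_cong[THEN iffD1, rotated -1, OF back_subst[where P = "\<lambda>S. (_ has_sum S) UNIV"]])
    \<comment> \<open>The sign of a polar factor meets the sign of a geometric series summed outside
      the unit disk, and the two cancel.\<close>
    have sg: "complex_of_real (sgn (l j)) * of_real (sgn (l j)) = 1" for j
      using l[of j] by (simp add: sgn_if)
    have "complex_of_real s * (\<Sum>\<gamma>\<in>Gamv v. \<Prod>j\<in>UNIV. exp (of_real (t * l j) * of_int (c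
        (en v j))) * (of_real (sgn (l j)) * W \<gamma> j))
      = (\<Sum>\<gamma>\<in>Gamv v. \<Prod>j\<in>UNIV. exp (of_real (t * l j) * of_int (c (en v j))) * W \<gamma> j)"
      unfolding s_def sum_distrib_left of_real_prod prod.distrib[symmetric]
    proof (intro sum.cong prod.cong refl)
      fix \<gamma> j
      show "complex_of_real (sgn (l j)) * (exp (of_real (t * l j) * of_int (c (en v j)))
          * (of_real (sgn (l j)) * W \<gamma> j))
        = exp (of_real (t * l j) * of_int (c (en v j))) * W \<gamma> j"
        using sg[of j] by (simp add: sgn_if split: if_splits)
    qed
    also have "\<dots> = exp (of_real (t * offset v \<xi>)) * (\<Sum>\<gamma>\<in>Gamv v. \<Prod>j\<in>UNIV. W \<gamma> j)"
      by (simp add: prod.distrib sum_distrib_left offset_def sum_tight[OF v] l_def[symmetric] exp_sum mult.assoc)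
    also have "(\<Sum>\<gamma>\<in>Gamv v. \<Prod>j\<in>UNIV. W \<gamma> j)
        = eval_fps (todd_series \<Gamma> K (coord v \<xi>)) (of_real t) / of_real (t ^ CARD('n) * (\<Prod>j\<in>UNIV. l j))"
    proof -
      have "eval_fps (todd_series \<Gamma> K (coord v \<xi>)) (of_real t)
          = (\<Sum>\<gamma>\<in>Gamv v. \<Prod>j\<in>UNIV. of_real (t * l j) * W \<gamma> j)"
        using todd_series_vertex[OF v reg _ r small] t by (simp add: W_def b_def l_def)
      also have "\<dots> = of_real (t ^ CARD('n) * (\<Prod>j\<in>UNIV. l j))
          * (\<Sum>\<gamma>\<in>Gamv v. \<Prod>j\<in>UNIV. W \<gamma> j)"
        by (simp add: prod.distrib sum_distrib_left mult.assoc)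
      finally show ?thesis using l t by (simp add: field_simps)
    qed
    finally show "complex_of_real s * ((\<Sum>\<gamma>\<in>Gamv v. \<Prod>j\<in>UNIV. exp (of_real (t * l j) *
        of_int (c (en v j))) * (of_real (sgn (l j)) * W \<gamma> j)) / of_nat (card (Gamv v)))
      = of_real (weight v \<xi>) * exp (of_real (t * offset v \<xi>)) * eval_fps (todd_series \<Gamma> K (coord v
          \<xi>)) (of_real t) / of_real (t ^ CARD('n))"
      by (simp add: weight_def prod_tight[OF v] l_def[symmetric] mult_def field_simps)
  next
    fix m :: "int ^ 'n"
    have ex: "exp (- (t * (rvec m \<bullet> \<xi>))) = (\<Prod>j\<in>UNIV. exp (- (t * l j * ipair m (u (en v j)))))"
      unfolding inner_coords[OF v, of "rvec m" \<xi>]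
          by (simp add: exp_sum[symmetric] sum_negf sum_distrib_left l_def mult.assoc rvec_inner)
    have mem: "polar_factor (l j) (rvec m \<bullet> rvec (u (en v j)) + c (en v j) - \<delta> * of_bool (en v j \<in> K))
       = sgn (l j) * of_bool (ipair m (u (en v j)) + c (en v j) \<in> halfints (t * l j) (b j))" for j
    proof -
      define p where "p = ipair m (u (en v j)) + c (en v j)"
      \<comment> \<open>Since \<open>p\<close> is an integer and
        \<open>0 < \<delta> \<le> 1\<close>, subtracting \<open>\<delta>\<close> has the effect of
        demanding \<open>1 \<le> p\<close>.\<close>
      have "0 \<le> real_of_int p - \<delta> * of_bool (en v j \<in> K) \<longleftrightarrow> b j \<le> p"
        using \<delta> by (auto simp: b_def)
      then have "0 \<le> rvec m \<bullet> rvec (u (en v j))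
          + c (en v j) - \<delta> * of_bool (en v j \<in> K) \<longleftrightarrow> b j \<le> p"
        by (simp add: rvec_inner p_def)
      then show ?thesis
        using l[of j] by (auto simp: polar_factor_eq halfints_def tl p_def[symmetric])
    qed
    have "(\<Prod>i\<in>tight v. polar_factor (\<xi> \<bullet> d v i) (rvec m \<bullet> rvec (u i)
        + c i - \<delta> * of_bool (i \<in> K))) * exp (- (t * (rvec m \<bullet> \<xi>)))
      = s * (\<Prod>j\<in>UNIV. of_bool (ipair m (u (en v j))
          + c (en v j) \<in> halfints (t * l j) (b j)) * exp (- (t * l j * ipair m (u (en v j)))))"
      unfolding prod_tight[OF v] l_def[symmetric] mem ex s_def prod.distrib[symmetric] by (simp add: mult.assoc)
    then show "complex_of_real s * (\<Prod>j\<in>UNIV. of_bool (ipair m (u (en v j))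
        + c (en v j) \<in> halfints (t * l j) (b j)) * exp (- (of_real (t * l j) * of_int (ipair m (u (en v j))))))
       = of_real ((\<Prod>i\<in>tight v. polar_factor (\<xi> \<bullet> d v i) (rvec m \<bullet> rvec (u i)
           + c i - \<delta> * of_bool (i \<in> K))) * exp (- (t * (rvec m \<bullet> \<xi>))))"
      by (simp only:) (simp add: exp_of_real[symmetric] of_real_of_bool)
  qed
qed

end

section \<open>Moments and power sums\<close>

context lattice_hpolytope_todd
begin

lemma generic_regular: "generic \<xi> \<longleftrightarrow> (\<forall>v\<in>V. regular v \<xi>)"
  by (simp add: generic_def regular_def)

lemma hpoly_integral_exp:
  assumes h: "admissible h" and gen: "generic \<xi>" and t: "t > 0"
  shows "has_bochner_integral lborel (\<lambda>x. indicator (hpoly h) x * exp (- (t * (x \<bullet> \<xi>))))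
    ((\<Sum>v\<in>V. weight v \<xi> * exp (t * (offset v \<xi>
        + (\<Sum>i\<in>UNIV. coord v \<xi> i * h $ i)))) / t ^ CARD('n))"
proof -
  have "has_bochner_integral lborel
    (\<lambda>x. \<Sum>v\<in>V. (\<Prod>i\<in>tight v. polar_factor (\<xi> \<bullet> d v i) (x \<bullet> rvec (u
        i) + c i + h $ i)) * exp (- (t * (x \<bullet> \<xi>))))
    (\<Sum>v\<in>V. weight v \<xi> * exp (t * (offset v \<xi>
        + (\<Sum>i\<in>UNIV. coord v \<xi> i * h $ i))) / t ^ CARD('n))"
    using gen t by (intro has_bochner_integral_sum vertex_integral_exp) (auto simp: generic_regular)
  moreover have "(\<Sum>v\<in>V. (\<Prod>i\<in>tight v. polar_factor (\<xi> \<bullet> d v i) (x \<bullet> rvec (u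
      i) + c i + h $ i)) * exp (- (t * (x \<bullet> \<xi>))))
     = indicator (hpoly h) x * exp (- (t * (x \<bullet> \<xi>)))" for x
    using polar_decomposition[OF nonempty h gen, of x]
    by (simp add: sum_distrib_right[symmetric] polar_sum_def indicator_def)
  ultimately show ?thesis by (simp add: sum_divide_distrib)
qed

lemma compact_hpoly: "compact (hpoly h)"
  by (simp add: compact_eq_bounded_closed bounded_hpoly nonempty closed_hpoly)

lemma hpoly_borel [measurable]: "hpoly h \<in> sets borel"
  by (simp add: closed_hpoly borel_closed)

lemma integrable_hpoly:
  fixes f :: "real ^ 'n \<Rightarrow> 'a::euclidean_space"
  assumes "continuous_on UNIV f"
  shows "set_integrable lborel (hpoly h) f"
  unfolding set_integrable_def
  by (rule borel_integrable_compact[OF compact_hpoly continuous_on_subset[OF assms]]) simp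

definition moment :: "real ^ 'n \<Rightarrow> nat \<Rightarrow> real ^ 'r::{finite,linorder} \<Rightarrow> real" where
  "moment \<xi> k h = (LINT x:hpoly h|lborel. (x \<bullet> \<xi>) ^ k)"

text \<open>Termwise integration of the exponential series, dominated on the compact polytope by the
  series of \<open>exp (\<bar>t\<bar> * \<bar>R\<bar>)\<close>.\<close>

lemma moment_sums:
  "(\<lambda>k. (- t) ^ k / fact k * moment \<xi> k h) sums (\<integral>x. indicator (hpoly h) x * exp (- (t
      * (x \<bullet> \<xi>))) \<partial>lborel)"
proof -
  obtain R where R: "\<And>x. x \<in> hpoly h \<Longrightarrow> \<bar>x \<bullet> \<xi>\<bar> \<le> R"
  proof -
    have "bounded ((\<lambda>x. x \<bullet> \<xi>) ` hpoly h)"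
      by (rule compact_imp_bounded, rule compact_continuous_image) (auto intro!: continuous_intros compact_hpoly)
    then show ?thesis using that by (auto simp: bounded_iff)
  qed
  define f where "f k x = indicator (hpoly h) x *\<^sub>R ((- (t * (x \<bullet> \<xi>))) ^ k / fact k)" for k x
  have int: "integrable lborel (f k)" for k
    unfolding f_def set_integrable_def[symmetric]
    by (rule integrable_hpoly) (auto intro!: continuous_intros)
  have bound: "norm (f k x) \<le> indicator (hpoly h) x * ((\<bar>t\<bar> * \<bar>R\<bar>) ^ k / fact k)" for k x
  proof (cases "x \<in> hpoly h")
    case True
    then have "\<bar>x \<bullet> \<xi>\<bar> \<le> \<bar>R\<bar>" using R by force
    then have "\<bar>t * (x \<bullet> \<xi>)\<bar>
        \<le> \<bar>t\<bar> * \<bar>R\<bar>" by (simp add: abs_mult mult_left_mono)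
    then show ?thesis using True
      by (auto simp: f_def power_abs abs_mult intro!: divide_right_mono power_mono)
  qed (simp add: f_def)
  have ind: "integrable lborel (\<lambda>x. indicator (hpoly h) x * (b :: real))" for b
    using integrable_hpoly[of "\<lambda>_. b" h] by (simp add: set_integrable_def)
  have "(\<lambda>k. \<integral>x. f k x \<partial>lborel) sums (\<integral>x. (\<Sum>k. f k x) \<partial>lborel)"
  proof (rule sums_integral[OF int])
    have "summable (\<lambda>k. norm (f k x))" for x
    proof (rule summable_comparison_test')
      show "summable (\<lambda>k. (\<bar>t\<bar> * \<bar>R\<bar>) ^ k / fact k)"
        using summable_exp_generic[of "\<bar>t\<bar> * \<bar>R\<bar>"] by (simp add: divide_inverse mult.commute)
      show "norm (norm (f k x)) \<le> (\<bar>t\<bar> * \<bar>R\<bar>) ^ k / fact k" if "k \<ge> 0" for k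
        using bound[of k x] by (auto simp: indicator_def split: if_splits intro: order_trans)
    qed
    then show "AE x in lborel. summable (\<lambda>k. norm (f k x))" by simp
    show "summable (\<lambda>k. \<integral>x. norm (f k x) \<partial>lborel)"
    proof (rule summable_comparison_test')
      show "summable (\<lambda>k. (\<integral>x. indicator (hpoly h) x * 1 \<partial>lborel)
          * ((\<bar>t\<bar> * \<bar>R\<bar>) ^ k / fact k))"
        using summable_exp_generic[of "\<bar>t\<bar> * \<bar>R\<bar>"]
            by (intro summable_mult) (simp add: divide_inverse mult.commute)
      fix k :: nat
      have "(\<integral>x. norm (f k x) \<partial>lborel)
          \<le> (\<integral>x. indicator (hpoly h) x * ((\<bar>t\<bar> * \<bar>R\<bar>) ^ k / fact k) \<partial>lborel)"
        by (rule integral_mono[OF integrable_norm[OF int] ind bound])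
      also have "\<dots> = (\<integral>x. indicator (hpoly h) x * 1 \<partial>lborel)
          * ((\<bar>t\<bar> * \<bar>R\<bar>) ^ k / fact k)"
        by simp
      finally show "norm (\<integral>x. norm (f k x) \<partial>lborel)
          \<le> (\<integral>x. indicator (hpoly h) x * 1 \<partial>lborel) * ((\<bar>t\<bar> * \<bar>R\<bar>) ^ k / fact k)"
        by simp
    qed
  qed
  moreover have "(\<Sum>k. f k x) = indicator (hpoly h) x * exp (- (t * (x \<bullet> \<xi>)))" for x
    using suminf_mult[OF summable_exp_generic[of "- (t * (x \<bullet> \<xi>))"], of "indicator (hpoly h) x"]
    by (simp add: f_def exp_def scaleR_conv_of_real divide_inverse mult.commute mult.left_commute)
  moreover have "(\<integral>x. f k x \<partial>lborel) = (- t) ^ k / fact k * moment \<xi> k h" for k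
  proof -
    have "f k x = ((- t) ^ k / fact k) * (indicator (hpoly h) x *\<^sub>R (x \<bullet> \<xi>) ^ k)" for x
      by (simp add: f_def power_mult_distrib[symmetric])
    then show ?thesis by (simp add: moment_def set_lebesgue_integral_def)
  qed
  ultimately show ?thesis by simp
qed

text \<open>The coefficient of order \<open>CARD('n) + k\<close> in
  \<open>hpoly_integral_exp\<close> after clearing the poles. As the left side is divisible by
  \<open>X ^ CARD('n)\<close>, the lower coefficients of the vertex terms cancel in the sum.\<close>

lemma moment_formula:
  assumes h: "admissible h" and gen: "generic \<xi>"
  shows "(-1) ^ k / fact k * moment \<xi> k h
    = (\<Sum>v\<in>V. weight v \<xi> * ((offset v \<xi>
        + (\<Sum>i\<in>UNIV. coord v \<xi> i * h $ i)) ^ (CARD('n) + k) / fact (CARD('n) + k)))"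
proof -
  define q where "q v = offset v \<xi> + (\<Sum>i\<in>UNIV. coord v \<xi> i * h $ i)" for v
  define A :: "complex fps" where "A = Abs_fps (\<lambda>k. of_real ((-1) ^ k / fact k * moment \<xi> k h))"
  define B :: "complex fps" where "B = (\<Sum>v\<in>V. fps_const (of_real (weight v \<xi>)) * fps_exp (of_real (q v)))"
  have A_sums: "(\<lambda>k. fps_nth A k * of_real t ^ k) sums of_real (\<integral>x. indicator (hpoly h) x * exp
      (- (t * (x \<bullet> \<xi>))) \<partial>lborel)" for t :: real
  proof -
    have "fps_nth A k * of_real t ^ k = of_real ((- t) ^ k / fact k * moment \<xi> k h)" for k
      by (simp add: A_def power_minus[of t] mult_ac)
    then show ?thesis using moment_sums[of t \<xi> h] by (simp only: sums_of_real_iff)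
  qed
  have "summable (\<lambda>k. fps_nth A k * of_real 1 ^ k)" using A_sums[of 1] by (rule sums_summable)
  then have "1 \<le> fps_conv_radius A"
    unfolding fps_conv_radius_def using conv_radius_geI[of "fps_nth A" "1 :: complex"] by (simp add: one_ereal_def)
  then have radA: "fps_conv_radius A > 0" by (auto intro: less_le_trans[of _ 1])
  have radE: "fps_conv_radius (fps_const a * fps_exp b) = \<infinity>" for a b :: complex
    using fps_conv_radius_mult[of "fps_const a" "fps_exp b"] by simp
  have B_rad: "ereal R < fps_conv_radius B" for R
    unfolding B_def by (rule fps_sum_radius) (simp add: radE)
  have eqAB: "fps_X ^ CARD('n) * A = B"
  proof (rule fps_eq_of_eval_eq[where e = 1])
    show "0 < fps_conv_radius (fps_X ^ CARD('n) * A)"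
      by (rule less_le_trans[OF _ fps_conv_radius_mult]) (simp add: radA)
    show "0 < fps_conv_radius B" using B_rad[of 0] by (simp add: zero_ereal_def)
    fix t :: real assume t: "0 < t" "t < 1"
    have tA: "norm (complex_of_real t) < fps_conv_radius A"
      using t \<open>1 \<le> fps_conv_radius A\<close> by (auto intro: less_le_trans[of _ 1])
    have "eval_fps A (of_real t) = of_real (\<integral>x. indicator (hpoly h) x * exp (- (t
        * (x \<bullet> \<xi>))) \<partial>lborel)"
      unfolding eval_fps_def using A_sums[of t] by (rule sums_unique[symmetric])
    also have "(\<integral>x. indicator (hpoly h) x * exp (- (t * (x \<bullet> \<xi>))) \<partial>lborel)
       = (\<Sum>v\<in>V. weight v \<xi> * exp (t * q v)) / t ^ CARD('n)"
      unfolding q_def by (rule has_bochner_integral_integral_eq[OF hpoly_integral_exp[OF h gen t(1)]])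
    finally have "eval_fps A (of_real t) = of_real (\<Sum>v\<in>V. weight v \<xi> * exp (t * q v)) / of_real t ^ CARD('n)"
      by simp
    then have "eval_fps (fps_X ^ CARD('n) * A) (of_real t) = of_real (\<Sum>v\<in>V. weight v \<xi> * exp (t * q v))"
      using t tA by (subst eval_fps_mult) auto
    also have "\<dots> = eval_fps B (of_real t)"
      unfolding B_def
      by (subst eval_fps_sum) (auto simp: radE eval_fps_mult exp_of_real[symmetric] mult.commute[of "complex_of_real (q _)"])
    finally show "eval_fps (fps_X ^ CARD('n) * A) (of_real t) = eval_fps B (of_real t)" .
  qed simp
  have "fps_nth (fps_X ^ CARD('n) * A) (CARD('n) + k) = of_real ((-1) ^ k / fact k * moment \<xi> k h)"
    by (simp add: fps_X_power_mult_nth A_def)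
  moreover have "fps_nth B (CARD('n) + k) = of_real (\<Sum>v\<in>V. weight v \<xi> * (q v ^ (CARD('n)
      + k) / fact (CARD('n) + k)))"
    by (simp add: B_def fps_sum_nth)
  ultimately have "complex_of_real ((-1) ^ k / fact k * moment \<xi> k h) =
      of_real (\<Sum>v\<in>V. weight v \<xi> * (q v ^ (CARD('n) + k) / fact (CARD('n) + k)))"
    unfolding eqAB by (rule trans[OF sym])
  then show ?thesis unfolding q_def[symmetric] of_real_eq_iff .
qed

text \<open>The facets with index in \<open>K\<close> are removed by moving them inwards by \<open>\<delta>
  \<le> 1\<close>: at lattice points all slacks are integers.\<close>

definition shifted :: "real \<Rightarrow> real ^ 'r::{finite,linorder}" where
  "shifted \<delta> = (\<chi> i. - \<delta> * of_bool (i \<in> K))"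

definition lattice_K :: "(int ^ 'n) set" where
  "lattice_K = {m. \<forall>i. of_bool (i \<in> K) \<le> rvec m \<bullet> rvec (u i) + c i}"

lemma lattice_K_iff:
  assumes "0 < \<delta>" "\<delta> \<le> 1"
  shows "m \<in> lattice_K \<longleftrightarrow> rvec m \<in> hpoly (shifted \<delta>)"
proof -
  have "of_bool (i \<in> K) \<le> rvec m \<bullet> rvec (u i) + c i
      \<longleftrightarrow> 0 \<le> rvec m \<bullet> rvec (u i) + c i - \<delta> * of_bool (i \<in> K)" for i
  proof -
    define p where "p = ipair m (u i) + c i"
    have "of_bool (i \<in> K) \<le> real_of_int p \<longleftrightarrow> 0
        \<le> real_of_int p - \<delta> * of_bool (i \<in> K)"
      using assms by (auto simp: of_bool_def)
    then show ?thesis by (simp add: p_def rvec_inner)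
  qed
  then show ?thesis by (simp add: lattice_K_def hpoly_def shifted_def)
qed

lemma finite_lattice_bounded: "bounded S \<Longrightarrow> finite {m :: int ^ 'n. rvec m \<in> S}"
proof -
  assume "bounded S"
  then obtain b where "\<And>x. x \<in> S \<Longrightarrow> norm x \<le> b" by (auto simp: bounded_iff)
  then have "{m. rvec m \<in> S} \<subseteq> {m. norm (rvec m) \<le> b}" by auto
  moreover obtain v where "v \<in> V" using V_min_exists[OF nonempty] by blast
  ultimately show ?thesis
    using lattice_frame.finite_int_vec_norm[OF frame] finite_subset by blast
qed

lemma finite_lattice_K: "finite lattice_K"
proof -
  have "lattice_K = {m. rvec m \<in> hpoly (shifted 1)}" using lattice_K_iff[of 1] by auto
  then show ?thesis by (simp add: finite_lattice_bounded bounded_hpoly nonempty)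
qed

lemma coord_bound:
  obtains M where "M > 0" "\<And>v i. v \<in> V \<Longrightarrow> \<bar>coord v \<xi> i\<bar> \<le> M"
proof -
  let ?S = "insert 1 ((\<lambda>(v, i). \<bar>coord v \<xi> i\<bar>) ` (V \<times> UNIV))"
  have fin: "finite ?S" using finite_V by simp
  show ?thesis
  proof (rule that[of "Max ?S"])
    have "1 \<le> Max ?S" using fin by (intro Max_ge) auto
    then show "Max ?S > 0" by linarith
    show "\<bar>coord v \<xi> i\<bar> \<le> Max ?S" if "v \<in> V" for v i
      using fin that by (intro Max_ge) (auto intro!: image_eqI[of _ _ "(v, i)"])
  qed
qed

text \<open>The lattice points of \<open>P\<close> off the removed facets are those of a slightly
  shrunken polytope with admissible shift, to which the polar decomposition applies. The infinite
  sums over the cones then combine to a finite sum.\<close>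

lemma lattice_sum_exp:
  assumes gen: "generic \<xi>"
    and r: "\<And>g i b. g \<in> \<Gamma> \<Longrightarrow> ereal r < fps_conv_radius (todd_factor b (g $ i))"
    and t: "t > 0" and small: "\<And>v i. v \<in> V \<Longrightarrow> \<bar>coord v \<xi> i * t\<bar> \<le> r"
  shows "(\<Sum>m\<in>lattice_K. exp (- of_real (t * (rvec m \<bullet> \<xi>)))) =
    (\<Sum>v\<in>V. of_real (weight v \<xi>) * exp (of_real (t * offset v \<xi>)) * eval_fps (todd_series \<Gamma>
        K (coord v \<xi>)) (of_real t)) / of_real t ^ CARD('n)"
proof -
  obtain e where e: "e > 0" "\<And>h. h \<in> ball 0 e \<Longrightarrow> admissible h" using admissible_nearby by blast
  obtain \<delta> where \<delta>: "0 < \<delta>" "\<delta> \<le> 1" "admissible (shifted \<delta>)"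
  proof -
    have "norm (shifted \<delta>) \<le> \<delta> * norm (shifted 1)" if "\<delta> > 0" for \<delta>
    proof -
      have "shifted \<delta> = \<delta> *\<^sub>R shifted 1" by (simp add: shifted_def vec_eq_iff)
      then show ?thesis using that by simp
    qed
    \<comment> \<open>The factor \<open>2\<close> makes the shift strictly shorter than
      \<open>e\<close>, and the \<open>+ 1\<close> keeps the denominator positive.\<close>
    moreover define \<delta> where "\<delta> = min 1 (e / (2 * (norm (shifted 1) + 1)))"
    moreover have "\<delta> > 0" using e(1) by (simp add: \<delta>_def add_nonneg_pos)
    moreover have "\<delta> * norm (shifted 1) < e"
    proof -
      have p: "norm (shifted 1) + 1 > 0" by (simp add: add_nonneg_pos)
      have "\<delta> * norm (shifted 1) \<le> e / (2 * (norm (shifted 1) + 1)) * (norm (shifted 1) + 1)"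
        using \<open>\<delta> > 0\<close> e(1) by (intro mult_mono) (auto simp: \<delta>_def)
      also have "\<dots> = e / 2" using p by (simp add: field_simps)
      finally show ?thesis using e(1) by linarith
    qed
    ultimately show ?thesis using that[of \<delta>] e(2)[of "shifted \<delta>"] by (force simp: dist_norm)
  qed
  define F :: "real ^ 'n \<Rightarrow> int ^ 'n \<Rightarrow> complex" where "F v m
      = of_real ((\<Prod>i\<in>tight v. polar_factor (\<xi> \<bullet> d v i) (rvec m \<bullet> rvec (u i)
          + c i - \<delta> * of_bool (i \<in> K))) * exp (- (t * (rvec m \<bullet> \<xi>))))" for v m
  have "((\<lambda>m. \<Sum>v\<in>V. F v m) has_sum (\<Sum>v\<in>V. of_real (weight v \<xi>) * exp (of_real (t *
      offset v \<xi>)) * eval_fps (todd_series \<Gamma> K (coord v \<xi>)) (of_real t) / of_real (t ^ CARD('n)))) UNIV"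
    unfolding F_def using gen small \<delta>
    by (intro has_sum_finite_sum finite_V vertex_sum_exp[OF _ _ t r]) (auto simp: generic_regular)
  also have "(\<lambda>m. \<Sum>v\<in>V. F v m) = (\<lambda>m. of_bool (m \<in> lattice_K) * exp (- of_real (t
      * (rvec m \<bullet> \<xi>))))"
  proof
    fix m
    have "(\<Sum>v\<in>V. F v m) = of_real (polar_sum (\<lambda>i. rvec m \<bullet> rvec (u i) + c i
        + shifted \<delta> $ i) \<xi> * exp (- (t * (rvec m \<bullet> \<xi>))))"
      by (simp add: F_def polar_sum_def shifted_def sum_distrib_right)
    also have "\<dots> = of_bool (m \<in> lattice_K) * exp (- of_real (t * (rvec m \<bullet> \<xi>)))"
      using polar_decomposition[OF nonempty \<delta>(3) gen, of "rvec m"]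
          by (simp add: lattice_K_iff[OF \<delta>(1,2)] exp_of_real[symmetric])
    finally show "(\<Sum>v\<in>V. F v m) = of_bool (m \<in> lattice_K) * exp (- of_real (t * (rvec m \<bullet> \<xi>)))" .
  qed
  finally have 1: "((\<lambda>m. of_bool (m \<in> lattice_K) * exp (- of_real (t
      * (rvec m \<bullet> \<xi>)))) has_sum (\<Sum>v\<in>V. of_real (weight v \<xi>) * exp (of_real (t * offset v
          \<xi>)) * eval_fps (todd_series \<Gamma> K (coord v \<xi>)) (of_real t) / of_real (t ^ CARD('n)))) UNIV" .
  have "((\<lambda>m. exp (- of_real (t * (rvec m \<bullet> \<xi>))))
      has_sum (\<Sum>m\<in>lattice_K. exp (- complex_of_real (t * (rvec m \<bullet> \<xi>))))) lattice_K"
    by (simp add: finite_lattice_K)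
  also have "?this \<longleftrightarrow> ((\<lambda>m. of_bool (m \<in> lattice_K) * exp (- of_real (t
      * (rvec m \<bullet> \<xi>)))) has_sum (\<Sum>m\<in>lattice_K. exp (- complex_of_real (t
          * (rvec m \<bullet> \<xi>))))) UNIV"
    by (rule has_sum_cong_neutral) auto
  finally show ?thesis using has_sum_unique[OF 1] by (simp add: sum_divide_distrib)
qed

text \<open>The discrete counterpart of \<open>moment_formula\<close>: comparing the two, the
  operator has to replace the exponential of a vertex by its product with the Todd series.\<close>

lemma lattice_power_sum:
  assumes gen: "generic \<xi>"
  shows "(\<Sum>m\<in>lattice_K. of_real ((-1) ^ k / fact k * (rvec m \<bullet> \<xi>) ^ k)) =
    (\<Sum>v\<in>V. of_real (weight v \<xi>) * fps_nth (todd_series \<Gamma> K (coord v \<xi>) * fps_exp (of_real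
        (offset v \<xi>))) (CARD('n) + k))"
proof -
  define A :: "complex fps" where "A = (\<Sum>m\<in>lattice_K. fps_exp (- of_real (rvec m \<bullet> \<xi>)))"
  define B where "B = (\<Sum>v\<in>V. fps_const (of_real (weight v \<xi>))
      * (todd_series \<Gamma> K (coord v \<xi>) * fps_exp (of_real (offset v \<xi>))))"
  obtain r where r: "r > 0" "\<And>g i b. g \<in> \<Gamma>
      \<Longrightarrow> ereal r < fps_conv_radius (todd_factor b (g $ i))"
    using todd_common_radius[OF finite_\<Gamma>] by blast
  obtain M where M: "M > 0" "\<And>v i. v \<in> V \<Longrightarrow> \<bar>coord v \<xi> i\<bar>
      \<le> M" using coord_bound by blast
  have radA: "ereal R < fps_conv_radius A" for R
    unfolding A_def by (rule fps_sum_radius) simp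
  \<comment> \<open>For \<open>t\<close> up to \<open>e\<close> all arguments of Todd factors stay
    within the common radius \<open>r\<close>.\<close>
  define e where "e = r / M"
  have e: "e > 0" using r M by (simp add: e_def)
  have small: "\<bar>coord v \<xi> i * t\<bar> \<le> r" if "v \<in> V" "\<bar>t\<bar> \<le> e" for v i t
  proof -
    have "\<bar>coord v \<xi> i * t\<bar> \<le> M * e" unfolding abs_mult using that M by (intro mult_mono) auto
    then show ?thesis using M by (simp add: e_def)
  qed
  have radT: "ereal e < fps_conv_radius (todd_series \<Gamma> K (coord v \<xi>))" if v: "v \<in> V" for v
  proof (rule todd_series_radius)
    fix g i assume g: "g \<in> \<Gamma>"
    show "ereal (\<bar>coord v \<xi> i\<bar> * e) < fps_conv_radius (todd_factor (i \<in> K) (g $ i))"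
      by (rule le_less_trans[OF _ r(2)[OF g]]) (use small[OF v, of e i] e in \<open>simp add: abs_mult\<close>)
  qed
  have radTE: "ereal e < fps_conv_radius (todd_series \<Gamma> K (coord v \<xi>) * fps_exp (of_real (offset v
      \<xi>)))" if v: "v \<in> V" for v
    using less_le_trans[OF _ fps_conv_radius_mult[of "todd_series \<Gamma> K (coord v \<xi>)" "fps_exp (of_real
        (offset v \<xi>))"]] radT[OF v] by auto
  have radCTE: "ereal e < fps_conv_radius (fps_const a
      * (todd_series \<Gamma> K (coord v \<xi>) * fps_exp (of_real (offset v \<xi>))))" if v: "v \<in> V" for v a
    using less_le_trans[OF _ fps_conv_radius_mult[of "fps_const a" "todd_series \<Gamma> K (coord v \<xi>) *
        fps_exp (of_real (offset v \<xi>))"]] radTE[OF v] by auto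
  have radB: "ereal e < fps_conv_radius B"
    unfolding B_def by (rule fps_sum_radius) (rule radCTE)
  have eqAB: "fps_X ^ CARD('n) * A = B"
  proof (rule fps_eq_of_eval_eq[OF _ _ e])
    show "0 < fps_conv_radius (fps_X ^ CARD('n) * A)"
      by (rule less_le_trans[OF _ fps_conv_radius_mult]) (use radA[of 0] in \<open>simp add: zero_ereal_def\<close>)
    show "0 < fps_conv_radius B" using radB e by (auto intro: less_trans[of _ "ereal e"])
    fix t :: real assume t: "0 < t" "t < e"
    have te: "ereal (norm (complex_of_real t)) < f" if "ereal e < f" for f
      using that t by (auto intro: less_trans[of _ "ereal e"])
    have "eval_fps (fps_X ^ CARD('n) * A) (of_real t)
        = of_real t ^ CARD('n) * (\<Sum>m\<in>lattice_K. exp (- of_real (t * (rvec m \<bullet> \<xi>))))"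
      by (subst eval_fps_mult) (use radA in \<open>auto simp: A_def eval_fps_sum mult.commute\<close>)
    also have "\<dots> = (\<Sum>v\<in>V. of_real (weight v \<xi>) * exp (of_real (t * offset v \<xi>)) * eval_fps
        (todd_series \<Gamma> K (coord v \<xi>)) (of_real t))"
      using lattice_sum_exp[OF gen r(2) t(1)] small t by simp
    also have "\<dots> = eval_fps B (of_real t)"
      unfolding B_def
    proof (subst eval_fps_sum)
      show "(\<Sum>v\<in>V. of_real (weight v \<xi>) * exp (of_real (t * offset v \<xi>)) * eval_fps (todd_series
          \<Gamma> K (coord v \<xi>)) (of_real t))
        = (\<Sum>v\<in>V. eval_fps (fps_const (of_real (weight v \<xi>))
            * (todd_series \<Gamma> K (coord v \<xi>) * fps_exp (of_real (offset v \<xi>)))) (of_real t))"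
      proof (intro sum.cong refl)
        fix v assume v: "v \<in> V"
        show "of_real (weight v \<xi>) * exp (of_real (t * offset v \<xi>)) * eval_fps (todd_series \<Gamma> K
            (coord v \<xi>)) (of_real t)
          = eval_fps (fps_const (of_real (weight v \<xi>))
              * (todd_series \<Gamma> K (coord v \<xi>) * fps_exp (of_real (offset v \<xi>)))) (of_real t)"
          using te[OF radT[OF v]] te[OF radTE[OF v]] by (simp add: eval_fps_mult mult.commute)
      qed
    qed (use te[OF radCTE] in auto)
    finally show "eval_fps (fps_X ^ CARD('n) * A) (of_real t) = eval_fps B (of_real t)" .
  qed
  have "fps_nth (fps_X ^ CARD('n) * A) (CARD('n) + k)
      = (\<Sum>m\<in>lattice_K. of_real ((-1) ^ k / fact k * (rvec m \<bullet> \<xi>) ^ k))"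
    by (simp add: fps_X_power_mult_nth A_def fps_sum_nth power_minus[of "complex_of_real _"])
  moreover have "fps_nth B (CARD('n) + k) = (\<Sum>v\<in>V. of_real (weight v \<xi>) * fps_nth (todd_series
      \<Gamma> K (coord v \<xi>) * fps_exp (of_real (offset v \<xi>))) (CARD('n) + k))"
    by (simp add: B_def fps_sum_nth)
  ultimately show ?thesis using eqAB by simp
qed

text \<open>Up to the factor \<open>(-1) ^ k / fact k\<close>, the moment is near
  \<open>h = 0\<close> a ridge function with profile \<open>y ^ N / fact N\<close>,
  \<open>N = CARD('n) + k\<close>. Its image under the operator is the vertex sum of
  \<open>lattice_power_sum\<close>.\<close>

lemma todd_generic_power:
  assumes gen: "generic \<xi>"
  shows "todd_at_0 \<Gamma> K (\<lambda>h. of_real (moment \<xi> k h)) (\<Sum>m\<in>lattice_K. of_real ((rvec m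
      \<bullet> \<xi>) ^ k))"
proof -
  let ?N = "CARD('n) + k"
  let ?\<phi> = "\<lambda>h. complex_of_real ((-1) ^ k / fact k * moment \<xi> k h)"
  obtain e where e: "e > 0" "\<And>h. h \<in> ball 0 e \<Longrightarrow> admissible h" using admissible_nearby by blast
  have "todd_at_0 \<Gamma> K (ridge V (\<lambda>v. of_real (weight v \<xi>)) (\<lambda>v. offset v \<xi>)
      (\<lambda>v. coord v \<xi>) (\<lambda>y. of_real (y ^ ?N / fact ?N)))
     (\<Sum>m\<in>lattice_K. of_real ((-1) ^ k / fact k * (rvec m \<bullet> \<xi>) ^ k))"
    unfolding lattice_power_sum[OF gen] by (rule todd_at_0_power)
  then have todd: "todd_at_0 \<Gamma> K ?\<phi> (\<Sum>m\<in>lattice_K. of_real ((-1) ^ k / fact k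
      * (rvec m \<bullet> \<xi>) ^ k))"
  proof (rule todd_at_0_cong[OF e(1), rotated])
    fix h :: "real ^ 'r::{finite,linorder}" assume h: "h \<in> ball 0 e"
    then show "ridge V (\<lambda>v. of_real (weight v \<xi>)) (\<lambda>v. offset v \<xi>) (\<lambda>v. coord v
        \<xi>) (\<lambda>y. of_real (y ^ ?N / fact ?N)) h = ?\<phi> h"
      unfolding moment_formula[OF e(2)[OF h] gen] ridge_def by simp
  qed
  \<comment> \<open>A multiple \<open>a * z\<close> is obtained from the linear combination rule
    with equal functions and the coefficient \<open>a - 1\<close>; here
    \<open>a = (-1) ^ k * fact k\<close>.\<close>
  have e: "(a - 1) * z + z = a * z" for a z :: complex by (simp add: algebra_simps)
  from todd_at_0_lincomb[OF todd todd, of "(-1) ^ k * fact k - 1"]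
  have 1: "todd_at_0 \<Gamma> K (\<lambda>h. ((-1) ^ k * fact k) * ?\<phi> h)
     (((-1) ^ k * fact k) * (\<Sum>m\<in>lattice_K. of_real ((-1) ^ k / fact k * (rvec m \<bullet> \<xi>) ^ k)))"
    unfolding e .
  have c: "((-1) ^ k * fact k) * complex_of_real ((-1) ^ k / fact k * x) = of_real x" for x
    by (simp add: power_mult_distrib[symmetric] flip: mult.assoc)
  show ?thesis using 1 by (simp only: sum_distrib_left c)
qed

end

section \<open>Polynomials and tangent cones\<close>

text \<open>A linear property of \<open>p(s)\<close> for infinitely many \<open>s\<close> passes to
  the coefficients of \<open>p\<close>. Induction on the degree through the divided difference
  \<open>(p(s) - p(s0)) / (s - s0)\<close>. It serves both to polarise powers and to leave generic
  directions.\<close>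

lemma interpolate_coefficients:
  fixes Q :: "('a \<Rightarrow> real) \<Rightarrow> bool" and F :: "nat \<Rightarrow> 'a \<Rightarrow> real"
  assumes lin: "\<And>f g b. Q f \<Longrightarrow> Q g \<Longrightarrow> Q (\<lambda>x. b * f x + g x)"
    and "infinite S" "\<And>s. s \<in> S \<Longrightarrow> Q (\<lambda>x. \<Sum>j\<le>d. s ^ j * F j x)" "j \<le> d"
  shows "Q (F j)"
  using assms(2-)
proof (induction d arbitrary: F S j)
  case 0
  then obtain s where "s \<in> S" by (metis all_not_in_conv finite.emptyI)
  then show ?case using "0.prems"(2)[of s] "0.prems"(3) by simp
next
  case (Suc d)
  obtain s0 where s0: "s0 \<in> S" using Suc.prems(1) by (metis all_not_in_conv finite.emptyI)
  \<comment> \<open>The coefficients of the divided difference at \<open>s0\<close>, in which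
    \<open>s\<close> has degree \<open>d\<close> only.\<close>
  define G where "G i x = (\<Sum>j\<le>Suc d. if i < j then s0 ^ (j - Suc i) * F j x else 0)" for i x
  have Qp: "Q (\<lambda>x. \<Sum>j\<le>Suc d. s ^ j * F j x)" if "s \<in> S" for s using Suc.prems(2) that by blast
  have quot: "(\<Sum>i\<le>d. s ^ i * G i x) = 1 / (s - s0) * (\<Sum>j\<le>Suc d. s ^ j * F j x)
      + (- 1 / (s - s0)) * (\<Sum>j\<le>Suc d. s0 ^ j * F j x)"
    if "s \<noteq> s0" for s x
  proof -
    have "(\<Sum>i\<le>d. s ^ i * G i x) = (\<Sum>j\<le>Suc d. \<Sum>i\<le>d. if i
        < j then s ^ i * (s0 ^ (j - Suc i) * F j x) else 0)"
      unfolding G_def sum_distrib_left by (subst sum.swap) (intro sum.cong refl, simp)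
    also have "\<dots> = (\<Sum>j\<le>Suc d. (s ^ j - s0 ^ j) / (s - s0) * F j x)"
    proof (intro sum.cong refl)
      fix j assume "j \<in> {..Suc d}"
      then have "(\<Sum>i\<le>d. if i < j then s ^ i * (s0 ^ (j - Suc i) * F j x) else 0)
          = (\<Sum>i<j. s ^ i * (s0 ^ (j - Suc i) * F j x))"
        by (intro sum.mono_neutral_cong_right) auto
      also have "\<dots> = (s ^ j - s0 ^ j) / (s - s0) * F j x"
      proof -
        have "(s ^ j - s0 ^ j) / (s - s0) = (\<Sum>i<j. s0 ^ (j - Suc i) * s ^ i)"
          using that by (simp add: power_diff_sumr2[of s j s0])
        then show ?thesis by (simp only: sum_distrib_right) (simp add: mult_ac)
      qed
      finally show "(\<Sum>i\<le>d. if i < j then s ^ i * (s0 ^ (j - Suc i) * F j x) else 0)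
          = (s ^ j - s0 ^ j) / (s - s0) * F j x" .
    qed
    also have "\<dots> = 1 / (s - s0) * (\<Sum>j\<le>Suc d. s ^ j * F j x)
        + (- 1 / (s - s0)) * (\<Sum>j\<le>Suc d. s0 ^ j * F j x)"
      unfolding sum_distrib_left sum.distrib[symmetric]
          by (intro sum.cong refl) (simp add: diff_divide_distrib algebra_simps)
    finally show ?thesis .
  qed
  have Q0: "Q (\<lambda>x. 0)"
    using lin[OF Qp[OF s0] Qp[OF s0], of "-1"] by simp
  have scale: "Q (\<lambda>x. b * f x)" if "Q f" for f b
    using lin[OF that Q0, of b] by simp
  have QG: "Q (G i)" if "i \<le> d" for i
  proof (rule Suc.IH[of "S - {s0}"])
    fix s assume "s \<in> S - {s0}"
    then have "s \<in> S" "s \<noteq> s0" by auto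
    then show "Q (\<lambda>x. \<Sum>i\<le>d. s ^ i * G i x)"
      unfolding quot[OF \<open>s \<noteq> s0\<close>] by (intro lin scale Qp s0)
  qed (use Suc.prems(1) that in auto)
  have Gtop: "G (Suc d) x = 0" for x by (simp add: G_def)
  have QG': "Q (G i)" if "i \<le> Suc d" for i
  proof (cases "i = Suc d")
    case True
    then have "G i = (\<lambda>x. 0)" using Gtop by auto
    then show ?thesis using Q0 by simp
  qed (use that QG in auto)
  show ?case
  proof (cases j)
    case 0
    have "F 0 x = - s0 * G 0 x + (\<Sum>j\<le>Suc d. s0 ^ j * F j x)" for x
    proof -
      have "s0 * G 0 x = (\<Sum>j\<le>Suc d. if 0 < j then s0 ^ j * F j x else 0)"
        unfolding G_def sum_distrib_left by (intro sum.cong refl) (auto simp: power_eq_if)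
      then have "(\<Sum>j\<le>Suc d. s0 ^ j * F j x) - s0 * G 0 x = (\<Sum>j\<le>Suc d. if j = 0 then F j x else 0)"
        by (simp only: sum_subtractf[symmetric]) (intro sum.cong refl, auto)
      then show ?thesis by simp
    qed
    then have "F 0 = (\<lambda>x. - s0 * G 0 x + (\<Sum>j\<le>Suc d. s0 ^ j * F j x))" by blast
    then show ?thesis using lin[OF QG[of 0] Qp[OF s0], of "- s0"] 0 by simp
  next
    case (Suc i)
    then have i: "i \<le> d" using Suc.prems(3) by simp
    have "F (Suc i) x = - s0 * G (Suc i) x + G i x" for x
    proof -
      have "s0 * G (Suc i) x = (\<Sum>j\<le>Suc d. if Suc i < j then s0 ^ (j - Suc i) * F j x else 0)"
        unfolding G_def sum_distrib_left
        by (intro sum.cong refl) (auto simp: Suc_diff_Suc simp flip: power_Suc mult.assoc)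
      then have "G i x - s0 * G (Suc i) x = (\<Sum>j\<le>Suc d. if j = Suc i then F j x else 0)"
        unfolding G_def by (simp only: sum_subtractf[symmetric]) (intro sum.cong refl, auto)
      then show ?thesis using i by simp
    qed
    then have "F (Suc i) = (\<lambda>x. - s0 * G (Suc i) x + G i x)" by blast
    then show ?thesis using lin[OF QG'[of "Suc i"] QG[OF i], of "- s0"] i Suc by simp
  qed
qed

section \<open>Powers of linear forms span the polynomials\<close>

inductive power_span :: "('a::euclidean_space \<Rightarrow> real) \<Rightarrow> bool" where
  pow: "power_span (\<lambda>m. (m \<bullet> w) ^ k)"
| lin: "power_span f \<Longrightarrow> power_span g \<Longrightarrow> power_span (\<lambda>m. b * f m + g m)"

lemma power_span_scale:
  fixes f :: "'a::euclidean_space \<Rightarrow> real"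
  assumes f: "power_span f" shows "power_span (\<lambda>m. b * f m)"
proof -
  have "power_span (\<lambda>m. (-1) * f m + f m)" using f f by (rule power_span.lin)
  then have "power_span (\<lambda>m :: 'a. 0)" by simp
  from power_span.lin[OF f this, of b] show ?thesis by simp
qed

text \<open>Polarisation: up to a binomial factor the product is the coefficient of
  \<open>s ^ j\<close> in the power of order \<open>j + k\<close> of the form
  \<open>s *\<^sub>R w + w'\<close>.\<close>

lemma power_span_pow_mult:
  "power_span (\<lambda>m. (m \<bullet> w) ^ j * (m \<bullet> w') ^ k :: real)"
proof -
  define F where "F i m = of_nat ((j + k) choose i) * ((m \<bullet> w) ^ i * (m \<bullet> w') ^ (j + k - i))"
      for i and m :: 'a
  have "power_span (F j)"
  proof (rule interpolate_coefficients[where Q = power_span and S = UNIV and d = "j + k" and F = F])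
    fix s :: real
    have "(m \<bullet> (s *\<^sub>R w + w')) ^ (j + k) = (\<Sum>i\<le>j + k. s ^ i * F i m)" for m
      by (simp add: inner_add_right binomial_ring F_def power_mult_distrib mult_ac)
    then show "power_span (\<lambda>m. \<Sum>i\<le>j + k. s ^ i * F i m)"
      using power_span.pow[of "s *\<^sub>R w + w'" "j + k"] by simp
  qed (auto intro: power_span.lin simp: infinite_UNIV_char_0)
  from power_span_scale[OF this, of "1 / of_nat ((j + k) choose j)"]
  show ?thesis by (simp add: F_def)
qed

lemma power_span_mult:
  assumes "power_span f" "power_span g"
  shows "power_span (\<lambda>m. f m * g m)"
  using assms(1)
proof induction
  case (pow w k)
  show ?case using assms(2)
  proof induction
    case (lin f g b)
    then show ?case
      using power_span.lin[OF lin.IH, of b] by (simp add: algebra_simps)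
  qed (rule power_span_pow_mult)
next
  case (lin f f' b)
  then show ?case
    using power_span.lin[OF lin.IH, of b] by (simp add: algebra_simps)
qed

lemma power_span_polynomial:
  assumes "real_polynomial_function f" shows "power_span f"
  using assms
proof induction
  case (linear f)
  then have "linear f" by (simp add: bounded_linear.linear)
  then have "f = (\<lambda>m. (m \<bullet> adjoint f 1) ^ 1)" by (simp add: adjoint_works fun_eq_iff)
  then show ?case using power_span.pow by metis
next
  case (const c)
  \<comment> \<open>The constant \<open>1\<close> is the zeroth power of the zero form.\<close>
  show ?case using power_span_scale[OF power_span.pow[of 0 0], of c] by simp
next
  case (add f g)
  then show ?case using power_span.lin[of f g 1] by simp
next
  case (mult f g)
  show ?case by (rule power_span_mult[OF mult.IH])
qed

context lattice_hpolytope_todd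
begin

text \<open>Continuity is carried along to make \<open>f\<close> integrable over the compact
  \<open>hpoly h\<close>, so that the integral is linear in \<open>f\<close>.\<close>

definition todd_formula :: "(real ^ 'n \<Rightarrow> complex) \<Rightarrow> bool" where
  "todd_formula f \<longleftrightarrow> continuous_on UNIV f \<and>
     todd_at_0 \<Gamma> K (\<lambda>h. LINT m:hpoly h|lborel. f m) (\<Sum>m\<in>lattice_K. f (rvec m))"

lemma todd_formula_lincomb:
  assumes "todd_formula f" "todd_formula g" shows "todd_formula (\<lambda>m. b * f m + g m)"
proof -
  have f: "continuous_on UNIV f" and g: "continuous_on UNIV g" using assms by (auto simp: todd_formula_def)
  have "(LINT m:hpoly h|lborel. b * f m + g m) = b * (LINT m:hpoly h|lborel. f m) + (LINT m:hpoly h|lborel. g m)" for h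
    using integrable_hpoly[OF f, of h] integrable_hpoly[OF g, of h]
    by (simp add: set_integral_add(2) set_integrable_mult_right)
  moreover have "(\<Sum>m\<in>lattice_K. b * f (rvec m) + g (rvec m))
      = b * (\<Sum>m\<in>lattice_K. f (rvec m)) + (\<Sum>m\<in>lattice_K. g (rvec m))"
    by (simp add: sum.distrib sum_distrib_left)
  ultimately show ?thesis
    using todd_at_0_lincomb[of \<Gamma> K _ _ _ _ b] assms f g
    by (simp add: todd_formula_def continuous_intros)
qed

lemma todd_formula_generic_power:
  assumes "generic w" shows "todd_formula (\<lambda>m. of_real ((m \<bullet> w) ^ k))"
  unfolding todd_formula_def set_integral_complex_of_real moment_def[symmetric]
  by (intro conjI continuous_intros todd_generic_power assms)

text \<open>An arbitrary \<open>w\<close> is perturbed to \<open>s *\<^sub>R w' + w\<close>, which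
  is generic for all but finitely many \<open>s\<close>. The constant coefficient in
  \<open>s\<close> of the perturbed power is the power for \<open>w\<close> itself.\<close>

lemma todd_formula_power: "todd_formula (\<lambda>m. of_real ((m \<bullet> w) ^ k))"
proof -
  let ?A = "\<Union>v\<in>V. d v ` tight v"
  have "0 \<notin> ?A"
  proof
    assume "0 \<in> ?A"
    then obtain v i where vi: "v \<in> V" "i \<in> tight v" "0 = d v i" by blast
    then show False using dual_tight[of v i i] by (simp flip: vi(3))
  qed
  then obtain w' where w': "\<And>x. x \<in> ?A \<Longrightarrow> w' \<bullet> x \<noteq> 0"
    using open_avoids_hyperplanes[of UNIV ?A] finite_V by auto
  define S where "S = {s. generic (s *\<^sub>R w' + w)}"
  have "- S \<subseteq> (\<lambda>(v, i). - (w \<bullet> d v i) / (w' \<bullet> d v i)) ` (SIGMA v:V. tight v)"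
  proof
    fix s assume "s \<in> - S"
    then obtain v i where vi: "v \<in> V" "i \<in> tight v" "(s *\<^sub>R w' + w) \<bullet> d v i = 0"
      by (auto simp: S_def generic_def)
    have "w' \<bullet> d v i \<noteq> 0" using vi by (intro w') auto
    then have "s = - (w \<bullet> d v i) / (w' \<bullet> d v i)"
        using vi(3) by (simp add: inner_add_left field_simps eq_neg_iff_add_eq_0)
    then show "s \<in> (\<lambda>(v, i). - (w \<bullet> d v i) / (w' \<bullet> d v i)) ` (SIGMA v:V. tight v)"
      using vi by force
  qed
  then have "finite (- S)" by (rule finite_subset) (simp add: finite_V)
  then have inf: "infinite S" by (metis finite_Un Compl_partition infinite_UNIV_char_0)
  define F where "F i m = of_nat (k choose i) * ((m \<bullet> w') ^ i * (m \<bullet> w) ^ (k - i))"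
      for i and m :: "real ^ 'n"
  have "todd_formula (\<lambda>m. of_real (F 0 m))"
  proof (rule interpolate_coefficients[where Q = "\<lambda>f. todd_formula (\<lambda>m. of_real (f m))" and S
      = S and d = k and F = F])
    fix s assume "s \<in> S"
    have "(m \<bullet> (s *\<^sub>R w' + w)) ^ k = (\<Sum>i\<le>k. s ^ i * F i m)" for m
      by (simp add: inner_add_right binomial_ring F_def power_mult_distrib mult_ac)
    then show "todd_formula (\<lambda>m. of_real (\<Sum>i\<le>k. s ^ i * F i m))"
      using todd_formula_generic_power[of "s *\<^sub>R w' + w" k] \<open>s \<in> S\<close> by (simp add: S_def)
  next
    fix f g :: "real ^ 'n \<Rightarrow> real" and b :: real
    assume "todd_formula (\<lambda>m. of_real (f m))" "todd_formula (\<lambda>m. of_real (g m))"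
    from todd_formula_lincomb[OF this, of "of_real b"] show "todd_formula (\<lambda>m. of_real (b * f m + g m))" by simp
  qed (use inf in auto)
  then show ?thesis by (simp add: F_def)
qed

lemma todd_formula_power_span: "power_span f \<Longrightarrow> todd_formula (\<lambda>m. of_real (f m))"
proof (induction rule: power_span.induct)
  case (lin f g b)
  from todd_formula_lincomb[OF lin.IH, of "of_real b"] show ?case by simp
qed (rule todd_formula_power)

lemma todd_formula_polynomial:
  fixes f :: "real ^ 'n \<Rightarrow> complex"
  assumes "polynomial_function f" shows "todd_formula f"
proof -
  have "real_polynomial_function (Re \<circ> f)" "real_polynomial_function (Im \<circ> f)"
    using assms bounded_linear_Re bounded_linear_Im by (auto simp: polynomial_function_def)
  then have "todd_formula (\<lambda>m. of_real (Re (f m)))" "todd_formula (\<lambda>m. of_real (Im (f m)))"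
    using todd_formula_power_span[OF power_span_polynomial] by (auto simp: o_def)
  from todd_formula_lincomb[OF this(2,1), of \<i>] show ?thesis
    by (simp add: complex_eq[symmetric] add.commute mult.commute)
qed

section \<open>A single tangent cone\<close>

definition cone_region :: "real ^ 'n \<Rightarrow> real ^ 'r::{finite,linorder} \<Rightarrow> (real ^ 'n) set" where
  "cone_region v h = {m. \<forall>i\<in>tight v. 0 \<le> m \<bullet> rvec (u i) + c i + h $ i}"

definition cone_lattice_K :: "real ^ 'n \<Rightarrow> (int ^ 'n) set" where
  "cone_lattice_K v = {m. \<forall>i\<in>tight v. of_bool (i \<in> K) \<le> rvec m \<bullet> rvec (u i) + c i}"

lemma prod_polar_factor_pos:
  assumes "\<And>i. i \<in> tight v \<Longrightarrow> \<xi> \<bullet> d v i > 0"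
  shows "(\<Prod>i\<in>tight v. polar_factor (\<xi> \<bullet> d v i) (s i)) = of_bool (\<forall>i\<in>tight v. 0 \<le> s i)"
proof -
  have "(\<Prod>i\<in>tight v. polar_factor (\<xi> \<bullet> d v i) (s i)) = (\<Prod>i\<in>tight v. of_bool (0 \<le> s i))"
    using assms by (intro prod.cong refl) (simp add: polar_factor_pos)
  then show ?thesis by (auto simp: of_bool_def intro!: prod.neutral prod_zero)
qed

text \<open>When all coordinates are positive nothing is flipped, and the product of polar factors
  is the indicator of the tangent cone itself. The factor \<open>2\<close> in the bound gives the
  symbol a radius above \<open>1\<close>, where it is evaluated.\<close>

lemma cone_local:
  assumes v: "v \<in> V" and pos: "\<And>i. i \<in> tight v \<Longrightarrow> \<xi> \<bullet> d v i > 0"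
    and r: "\<And>g i b. g \<in> \<Gamma> \<Longrightarrow> ereal r < fps_conv_radius (todd_factor b (g $ i))"
    and small: "\<And>i. \<bar>coord v \<xi> i\<bar> * 2 \<le> r"
  shows "set_integrable lborel (cone_region v h) (\<lambda>m. exp (- of_real (m \<bullet> \<xi>)) :: complex)"
    and "((\<lambda>m. exp (- of_real (rvec m \<bullet> \<xi>))) has_sum
       (of_real (weight v \<xi>) * exp (of_real (offset v \<xi>)) * eval_fps (todd_series \<Gamma> K (coord v
           \<xi>)) 1)) (cone_lattice_K v)"
    and "todd_at_0 \<Gamma> K (\<lambda>h. LINT m:cone_region v h|lborel. exp (- of_real (m \<bullet> \<xi>)))
       (of_real (weight v \<xi>) * exp (of_real (offset v \<xi>)) * eval_fps (todd_series \<Gamma> K (coord v \<xi>)) 1)"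
proof -
  have reg: "regular v \<xi>" using pos by (force simp: regular_def)
  have int: "has_bochner_integral lborel (\<lambda>x. indicator (cone_region v h) x *\<^sub>R exp (-
      complex_of_real (x \<bullet> \<xi>)))
      (of_real (weight v \<xi>) * exp (of_real (offset v \<xi> + (\<Sum>i\<in>UNIV. coord v \<xi> i * h $ i))))" for h
  proof -
    have "has_bochner_integral lborel (\<lambda>x. indicator (cone_region v h) x * exp (- (x \<bullet> \<xi>)))
      (weight v \<xi> * exp (offset v \<xi> + (\<Sum>i\<in>UNIV. coord v \<xi> i * h $ i)))"
      using vertex_integral_exp[OF v reg, of 1 h]
      by (simp add: prod_polar_factor_pos[OF pos] cone_region_def indicator_def)
    from has_bochner_integral_of_real[OF this, where 'a = complex]
    show ?thesis by (simp add: exp_of_real[symmetric] scaleR_conv_of_real)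
  qed
  then show "set_integrable lborel (cone_region v h) (\<lambda>m. exp (- of_real (m \<bullet> \<xi>)) :: complex)"
    unfolding set_integrable_def by (auto simp: has_bochner_integral_iff)
  have eq: "(LINT m:cone_region v h|lborel. exp (- complex_of_real (m \<bullet> \<xi>))) =
      of_real (weight v \<xi>) * exp (of_real (offset v \<xi> + (\<Sum>i\<in>UNIV. coord v \<xi> i * h $ i)))" for h
    unfolding set_lebesgue_integral_def by (rule has_bochner_integral_integral_eq[OF int])
  have "ereal 2 < fps_conv_radius (todd_series \<Gamma> K (coord v \<xi>))"
  proof (rule todd_series_radius)
    fix g i assume "g \<in> \<Gamma>"
    then show "ereal (\<bar>coord v \<xi> i\<bar> * 2) < fps_conv_radius (todd_factor (i \<in> K) (g $ i))"
      using small[of i] by (intro le_less_trans[OF _ r]) auto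
  qed
  then have "1 < fps_conv_radius (todd_series \<Gamma> K (coord v \<xi>))"
    by (rule less_trans[rotated]) (simp add: one_ereal_def)
  then show "todd_at_0 \<Gamma> K (\<lambda>h. LINT m:cone_region v h|lborel. exp (- of_real (m \<bullet> \<xi>)))
       (of_real (weight v \<xi>) * exp (of_real (offset v \<xi>)) * eval_fps (todd_series \<Gamma> K (coord v \<xi>)) 1)"
    unfolding eq by (rule todd_at_0_exp)
  have small': "\<bar>coord v \<xi> i * 1\<bar> \<le> r" for i
    using small[of i] by (smt (verit) abs_ge_zero mult.right_neutral)
  define S where "S = of_real (weight v \<xi>) * exp (of_real (offset v \<xi>)) * eval_fps (todd_series \<Gamma> K
      (coord v \<xi>)) 1"
  \<comment> \<open>\<open>vertex_sum_exp\<close> is taken at the largest shift that it allows,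
    \<open>\<delta> = 1\<close>.\<close>
  have mem: "(\<forall>i\<in>tight v. 0 \<le> rvec m \<bullet> rvec (u i)
      + c i - 1 * of_bool (i \<in> K)) \<longleftrightarrow> m \<in> cone_lattice_K v" for m
    by (auto simp: cone_lattice_K_def)
  have "((\<lambda>m. of_bool (m \<in> cone_lattice_K v) * exp (- of_real (rvec m \<bullet> \<xi>))) has_sum S) UNIV"
    using vertex_sum_exp[OF v reg _ r small', of 1]
    by (simp add: prod_polar_factor_pos[OF pos] mem[simplified] S_def exp_of_real[symmetric] of_real_of_bool)
  also have "?this \<longleftrightarrow> ((\<lambda>m. exp (- of_real (rvec m \<bullet> \<xi>)))
      has_sum S) (cone_lattice_K v)"
    by (rule has_sum_cong_neutral) auto
  finally show "((\<lambda>m. exp (- of_real (rvec m \<bullet> \<xi>))) has_sum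
       (of_real (weight v \<xi>) * exp (of_real (offset v \<xi>)) * eval_fps (todd_series \<Gamma> K (coord v
           \<xi>)) 1)) (cone_lattice_K v)"
    by (simp add: S_def)
qed

end

section \<open>Polytopes and their normal fans\<close>

locale simple_lattice_polytope =
  fixes P :: "(real ^ 'n) set"
    and F :: "'r::{finite,linorder} \<Rightarrow> (real ^ 'n) set"
    and \<rho> :: "'r \<Rightarrow> (real ^ 'n) set"
    and u :: "'r \<Rightarrow> int ^ 'n"
    and c :: "'r \<Rightarrow> int"
    and K :: "'r set"
  assumes lattice_P: "lattice_polytope P"
    and full: "aff_dim P = int CARD('n)"
    and simple_P: "simple_polytope P"
    and bij_F: "bij_betw F UNIV {Q. Q facet_of P}"
    and \<rho>_def: "\<And>i. \<rho> i = normal_cone P (F i)"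
    and ray: "\<And>i. ray_generator (\<rho> i) (u i)"
    and P_eq: "P = {m. \<forall>i. 0 \<le> m \<bullet> rvec (u i) + of_int (c i)}"
begin

lemma facet_F: "F i facet_of P"
  using bij_F by (auto simp: bij_betw_def)

lemma mem_P: "m \<in> P \<longleftrightarrow> (\<forall>i. 0 \<le> m \<bullet> rvec (u i) + of_int (c i))"
  using P_eq by auto

lemma polytope_P: "polytope P"
proof -
  obtain W :: "(int ^ 'n) set" where "finite W" "P = convex hull (rvec ` W)"
    using lattice_P by (auto simp: lattice_polytope_def)
  then show ?thesis by (auto simp: polytope_def)
qed

section \<open>Facets and their inequalities\<close>

lemma not_in_hyperplane: "a \<noteq> 0 \<Longrightarrow> \<not> P \<subseteq> {m. a \<bullet> m = b}"
proof
  assume a: "a \<noteq> 0" and "P \<subseteq> {m. a \<bullet> m = b}"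
  then have "aff_dim P \<le> aff_dim {m. a \<bullet> m = b}" by (intro aff_dim_subset)
  then show False using a full by (simp add: aff_dim_hyperplane)
qed

lemma tight_face: "P \<inter> {m. m \<bullet> rvec (u j) + c j = 0} face_of P"
proof -
  have "P \<inter> {m. rvec (u j) \<bullet> m = - c j} face_of P"
  proof (rule face_of_Int_supporting_hyperplane_ge[OF polytope_imp_convex[OF polytope_P]])
    fix m assume "m \<in> P"
    then have "0 \<le> m \<bullet> rvec (u j) + c j" by (simp add: mem_P)
    then show "rvec (u j) \<bullet> m \<ge> - c j" unfolding inner_commute[of _ m] by linarith
  qed
  moreover have "{m. rvec (u j) \<bullet> m = - c j} = {m. m \<bullet> rvec (u j) + c j = 0}"
    by (auto simp: inner_commute)
  ultimately show ?thesis by simp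
qed

lemma tight_proper: "u j \<noteq> 0 \<Longrightarrow> P \<inter> {m. m \<bullet> rvec (u j) + c j = 0} \<noteq> P"
proof
  assume "u j \<noteq> 0" and "P \<inter> {m. m \<bullet> rvec (u j) + c j = 0} = P"
  then have "P \<subseteq> {m. m \<bullet> rvec (u j) + c j = 0}" by blast
  then have "P \<subseteq> {m. rvec (u j) \<bullet> m = - c j}" by (auto simp: inner_commute)
  moreover have "rvec (u j) \<noteq> 0" using \<open>u j \<noteq> 0\<close> by (metis rvec_eq_iff rvec_simps(4))
  ultimately show False using not_in_hyperplane by blast
qed

text \<open>A relative interior point of a facet is no interior point of \<open>P\<close>, so some
  nontrivial inequality is tight there. The face that it cuts out meets the relative interior of the
  facet and hence contains the facet.\<close>

lemma facet_in_tight: "\<exists>j. u j \<noteq> 0 \<and> F i \<subseteq> P \<inter> {m. m \<bullet> rvec (u j) + c j = 0}"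
proof -
  have face: "F i face_of P" and ne: "F i \<noteq> {}" and dim: "aff_dim (F i) = aff_dim P - 1"
    using facet_F[of i] by (auto simp: facet_of_def)
  have conv: "convex (F i)" using face by (rule face_of_imp_convex)
  then obtain p where p: "p \<in> rel_interior (F i)" using ne rel_interior_eq_empty by blast
  have pF: "p \<in> F i" using p rel_interior_subset by blast
  have pP: "p \<in> P" using pF face face_of_imp_subset by blast
  have "F i \<noteq> P" using dim by auto
  then have "F i \<inter> interior P = {}" using face by (intro face_of_disjoint_interior)
  then have "p \<notin> interior P" using pF by blast
  have "\<exists>j. u j \<noteq> 0 \<and> p \<bullet> rvec (u j) + c j = 0"
  proof (rule ccontr)
    assume "\<not> ?thesis"
    then have strict: "0 < p \<bullet> rvec (u j) + c j" if "u j \<noteq> 0" for j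
      using that pP by (auto simp: mem_P less_le)
    let ?S = "{m. \<forall>j. u j \<noteq> 0 \<longrightarrow> 0 < m \<bullet> rvec (u j) + c j}"
    have "?S = (\<Inter>j\<in>{j. u j \<noteq> 0}. {m. 0 < m \<bullet> rvec (u j) + c j})" by auto
    then have "open ?S" by (auto intro!: open_INT open_Collect_less continuous_intros)
    moreover have "?S \<subseteq> P"
    proof
      fix m assume m: "m \<in> ?S"
      have "0 \<le> m \<bullet> rvec (u j) + c j" for j
      proof (cases "u j = 0")
        case True
        have "0 \<le> p \<bullet> rvec (u j) + c j" using pP by (simp add: mem_P)
        then show ?thesis using True by simp
      next
        case False
        then show ?thesis using m by (simp add: less_imp_le)
      qed
      then show "m \<in> P" by (simp add: mem_P)
    qed
    moreover have "p \<in> ?S" using strict by auto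
    ultimately have "p \<in> interior P" using interiorI[of ?S p P] by blast
    then show False using \<open>p \<notin> interior P\<close> by blast
  qed
  then obtain j where j: "u j \<noteq> 0" "p \<bullet> rvec (u j) + c j = 0" by blast
  have "F i \<subseteq> P \<inter> {m. m \<bullet> rvec (u j) + c j = 0}"
    by (rule subset_of_face_of[OF tight_face face_of_imp_subset[OF face]])
       (use j(2) p pP in \<open>auto simp: disjnt_def\<close>)
  then show ?thesis using j(1) by blast
qed

lemma facet_eq_face:
  assumes "F i \<subseteq> T" "T face_of P" "T \<noteq> P" shows "F i = T"
proof (rule ccontr)
  assume ne: "F i \<noteq> T"
  have "F i face_of T"
    using facet_F[of i] assms(1) face_of_imp_subset[OF assms(2)]
    by (rule face_of_subset[OF facet_of_imp_face_of])
  moreover have "convex T" using assms(2) by (rule face_of_imp_convex)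
  ultimately have "aff_dim (F i) < aff_dim T" using ne by (intro face_of_aff_dim_lt)
  moreover have "aff_dim T < aff_dim P"
    using assms polytope_P by (intro face_of_aff_dim_lt) (auto simp: polytope_imp_convex)
  ultimately show False using facet_F[of i] by (simp add: facet_of_def)
qed

lemma ray_mem: "rvec w \<in> \<rho> i \<longleftrightarrow> (\<exists>k::nat. w = of_nat k *s u i)"
  using ray[of i] by (auto simp: ray_generator_def lattice_pts_def)

lemma u_mem_\<rho>: "rvec (u i) \<in> \<rho> i"
  unfolding ray_mem by (intro exI[of _ 1]) simp

text \<open>The inequality that cuts out \<open>F i\<close> could a priori have another index
  \<open>j\<close>. But \<open>u j\<close> lies in the normal cone of \<open>F j\<close>, so its
  minimum over \<open>P\<close> is attained on \<open>F j\<close>, and the same face equals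
  \<open>F j\<close>; injectivity of \<open>F\<close> gives \<open>i = j\<close>.\<close>

lemma F_eq: "F i = P \<inter> {m. m \<bullet> rvec (u i) + c i = 0}" and u_nz: "u i \<noteq> 0"
proof -
  obtain j where j: "u j \<noteq> 0" "F i \<subseteq> P \<inter> {m. m \<bullet> rvec (u j) + c j = 0}"
    using facet_in_tight by blast
  let ?T = "P \<inter> {m. m \<bullet> rvec (u j) + c j = 0}"
  have Fi: "F i = ?T" by (rule facet_eq_face[OF j(2) tight_face tight_proper[OF j(1)]])
  obtain p where p: "p \<in> F i" using facet_F[of i] by (auto simp: facet_of_def)
  then have pP: "p \<in> P" "p \<bullet> rvec (u j) + c j = 0" using Fi by auto
  have "F j \<subseteq> ?T"
  proof
    fix m assume m: "m \<in> F j"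
    then have mP: "m \<in> P" using facet_F[of j] by (auto simp: facet_of_def dest: face_of_imp_subset)
    have "m \<bullet> rvec (u j) \<le> p \<bullet> rvec (u j)"
      using u_mem_\<rho>[of j] m pP by (auto simp: \<rho>_def normal_cone_def)
    moreover have "0 \<le> m \<bullet> rvec (u j) + c j" using mP by (simp add: mem_P)
    ultimately show "m \<in> ?T" using pP mP by auto
  qed
  then have "F j = ?T" by (rule facet_eq_face[OF _ tight_face tight_proper[OF j(1)]])
  then have "F i = F j" using Fi by simp
  then have "i = j" using bij_F by (auto simp: bij_betw_def inj_on_def)
  then show "F i = P \<inter> {m. m \<bullet> rvec (u i) + c i = 0}" "u i \<noteq> 0" using Fi j by auto
qed

lemma card_tight_P:
  assumes "v extreme_point_of P"
  shows "card {i. v \<bullet> rvec (u i) + c i = 0} = CARD('n)"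
proof -
  have vP: "v \<in> P" using assms by (simp add: extreme_point_of_def)
  have "card {Q. Q facet_of P \<and> v \<in> Q} = CARD('n)"
    using simple_P assms by (simp add: simple_polytope_def)
  moreover have "{Q. Q facet_of P \<and> v \<in> Q} = F ` {i. v \<bullet> rvec (u i) + c i = 0}"
  proof -
    have "{Q. Q facet_of P \<and> v \<in> Q} = F ` {i. v \<in> F i}" using bij_F by (auto simp: bij_betw_def)
    then show ?thesis using vP by (auto simp: F_eq)
  qed
  moreover have "card (F ` {i. v \<bullet> rvec (u i) + c i = 0}) = card {i. v \<bullet> rvec (u i) + c i = 0}"
    using bij_F by (intro card_image) (auto simp: bij_betw_def intro: inj_on_subset)
  ultimately show ?thesis by simp
qed

sublocale simple_hpolytope "\<lambda>i. rvec (u i)" "\<lambda>i. real_of_int (c i)"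
proof
  show "bounded {m. \<forall>i. 0 \<le> m \<bullet> rvec (u i) + real_of_int (c i)}"
    using polytope_imp_bounded[OF polytope_P] P_eq by simp
  show "card {i. v \<bullet> rvec (u i) + real_of_int (c i) = 0} = CARD('n)"
    if "v extreme_point_of {m. \<forall>i. 0 \<le> m \<bullet> rvec (u i) + real_of_int (c i)}" for v
    using card_tight_P that P_eq by simp
qed

lemma P_hpoly: "P = hpoly 0"
  using P_eq by (simp add: hpoly_def)

lemma V_iff: "v \<in> V \<longleftrightarrow> v extreme_point_of P"
  by (simp add: V_def P_hpoly)

sublocale lattice_hpolytope u c
proof
  show "\<exists>m. v = rvec m" if "v \<in> V" for v
  proof -
    obtain W :: "(int ^ 'n) set" where "P = convex hull (rvec ` W)"
      using lattice_P by (auto simp: lattice_polytope_def)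
    then show ?thesis using that extreme_point_of_convex_hull by (fastforce simp: V_iff)
  qed
  show "hpoly 0 \<noteq> {}" using full P_hpoly by auto
qed

section \<open>Normal cones and rays at a vertex\<close>

lemma vertex_normal_cone:
  assumes v: "v \<in> V"
  shows "normal_cone P {v} = {w. \<forall>i\<in>tight v. 0 \<le> w \<bullet> d v i}"
proof (intro equalityI subsetI)
  fix w assume "w \<in> normal_cone P {v}"
  then show "w \<in> {w. \<forall>i\<in>tight v. 0 \<le> w \<bullet> d v i}"
    using min_coords_nonneg[OF v] by (auto simp: normal_cone_def P_hpoly)
next
  fix w assume w: "w \<in> {w. \<forall>i\<in>tight v. 0 \<le> w \<bullet> d v i}"
  have "v \<bullet> w \<le> m \<bullet> w" if "m \<in> P" for m
  proof -
    have "0 \<le> (\<Sum>i\<in>tight v. ((m - v) \<bullet> rvec (u i)) * (w \<bullet> d v i))"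
    proof (intro sum_nonneg mult_nonneg_nonneg)
      fix i assume i: "i \<in> tight v"
      have "v \<bullet> rvec (u i) + c i = 0" using i by (simp add: tight_def)
      moreover have "0 \<le> m \<bullet> rvec (u i) + c i" using that by (simp add: mem_P)
      ultimately show "0 \<le> (m - v) \<bullet> rvec (u i)" unfolding inner_diff_left by linarith
      show "0 \<le> w \<bullet> d v i" using w i by simp
    qed
    also have "\<dots> = (m - v) \<bullet> w" by (rule expand_tight[OF v, symmetric])
    finally show ?thesis by (simp add: inner_diff_left)
  qed
  then show "w \<in> normal_cone P {v}" by (auto simp: normal_cone_def)
qed

text \<open>The facet \<open>i\<close> contains an initial piece of every edge at \<open>v\<close>
  other than \<open>d v i\<close>, and its normals are constant along these edges.\<close>

lemma \<rho>_vertex: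
  assumes v: "v \<in> V" and i: "i \<in> tight v"
  shows "\<rho> i = {w \<in> normal_cone P {v}. \<forall>k\<in>tight v - {i}. w \<bullet> d v k = 0}"
proof (intro equalityI subsetI)
  have vP: "v \<in> P" using v by (simp add: V_iff extreme_point_of_def)
  have vF: "v \<in> F i" using vP i by (simp add: F_eq tight_def)
  fix w assume "w \<in> \<rho> i"
  then have w: "\<And>m m'. m \<in> F i \<Longrightarrow> m' \<in> P
      \<Longrightarrow> m \<bullet> w \<le> m' \<bullet> w" by (simp add: \<rho>_def normal_cone_def)
  have w1: "w \<in> normal_cone P {v}" using w vF by (auto simp: normal_cone_def)
  have "w \<bullet> d v k = 0" if k: "k \<in> tight v - {i}" for k
  proof -
    have dk: "d v k \<bullet> rvec (u j) = (if j = k then 1 else 0)" if "j \<in> tight v" for j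
      using dual_tight[OF v, of k j] k that by auto
    obtain e where e: "e > 0" "\<And>t. 0 \<le> t \<Longrightarrow> t \<le> e
        \<Longrightarrow> v + t *\<^sub>R d v k \<in> hpoly 0"
      using small_step[of v "d v k"] V_in[OF v] dk by (metis le_numeral_extra(3) zero_le_one)
    have "v + e *\<^sub>R d v k \<in> P" using e by (simp add: P_hpoly)
    moreover have "(v + e *\<^sub>R d v k) \<bullet> rvec (u i) + c i = 0"
      using i dk[OF i] k by (auto simp: tight_def inner_add_left)
    ultimately have "v + e *\<^sub>R d v k \<in> F i" by (simp add: F_eq)
    then have "(v + e *\<^sub>R d v k) \<bullet> w \<le> v \<bullet> w" using w vP by blast
    then have "e * (w \<bullet> d v k) \<le> 0" by (simp add: inner_add_left inner_commute[of w])
    then have "w \<bullet> d v k \<le> 0" using e(1) by (simp add: mult_le_0_iff)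
    moreover have "0 \<le> w \<bullet> d v k" using w1 k by (auto simp: vertex_normal_cone[OF v])
    ultimately show ?thesis by simp
  qed
  then show "w \<in> {w \<in> normal_cone P {v}. \<forall>k\<in>tight v - {i}. w \<bullet> d v k = 0}" using w1 by simp
next
  fix w assume "w \<in> {w \<in> normal_cone P {v}. \<forall>k\<in>tight v - {i}. w \<bullet> d v k = 0}"
  then have w: "0 \<le> w \<bullet> d v i" "\<And>k. k \<in> tight v - {i} \<Longrightarrow> w \<bullet> d v k = 0"
    using i by (auto simp: vertex_normal_cone[OF v])
  have exp: "m \<bullet> w = (m \<bullet> rvec (u i)) * (w \<bullet> d v i)" for m
  proof -
    have "m \<bullet> w = (\<Sum>k\<in>tight v. (m \<bullet> rvec (u k)) * (w \<bullet> d v k))" by (rule expand_tight[OF v])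
    also have "\<dots> = (\<Sum>k\<in>tight v. if k = i then (m \<bullet> rvec (u i)) * (w \<bullet> d v i) else 0)"
      using w(2) by (intro sum.cong) auto
    finally show ?thesis using i by simp
  qed
  have "m \<bullet> w \<le> m' \<bullet> w" if m: "m \<in> F i" "m' \<in> P" for m m'
  proof -
    have "m \<bullet> rvec (u i) + c i = 0" "0 \<le> m' \<bullet> rvec (u i) + c i" using m by (auto simp: F_eq mem_P)
    then have "m \<bullet> rvec (u i) \<le> m' \<bullet> rvec (u i)" by linarith
    then show ?thesis unfolding exp using w(1) by (intro mult_right_mono)
  qed
  then show "w \<in> \<rho> i" by (simp add: \<rho>_def normal_cone_def)
qed

lemma vertex_ray:
  assumes v: "v \<in> V" and i: "i \<in> tight v"
  shows "\<rho> i \<in> cone_rays (normal_cone P {v})"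
proof -
  let ?\<sigma> = "normal_cone P {v}"
  \<comment> \<open>The hyperplane orthogonal to the sum of the other edge directions supports the
    cone exactly along the ray.\<close>
  define s where "s = (\<Sum>k\<in>tight v - {i}. d v k)"
  have nn: "0 \<le> w \<bullet> d v k" if "w \<in> ?\<sigma>" "k \<in> tight v" for w k
    using that by (simp add: vertex_normal_cone[OF v])
  have sw: "s \<bullet> w = (\<Sum>k\<in>tight v - {i}. w \<bullet> d v k)" for w
    unfolding s_def inner_sum_left by (intro sum.cong refl inner_commute)
  have ge: "s \<bullet> w \<ge> 0" if "w \<in> ?\<sigma>" for w
    unfolding sw using nn[OF that] by (intro sum_nonneg) auto
  have "\<rho> i = ?\<sigma> \<inter> {w. s \<bullet> w = 0}"
  proof -
    have "s \<bullet> w = 0 \<longleftrightarrow> (\<forall>k\<in>tight v - {i}. w \<bullet> d v k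
        = 0)" if "w \<in> ?\<sigma>" for w
      unfolding sw by (rule sum_nonneg_eq_0_iff) (use nn[OF that] in auto)
    then show ?thesis unfolding \<rho>_vertex[OF v i] by blast
  qed
  moreover have "convex ?\<sigma>"
  proof -
    have "?\<sigma> = (\<Inter>k\<in>tight v. {w. d v k \<bullet> w \<ge> 0})"
        by (auto simp: vertex_normal_cone[OF v] inner_commute)
    then show ?thesis by (simp add: convex_INT convex_halfspace_ge)
  qed
  ultimately have face: "\<rho> i face_of ?\<sigma>"
    using ge by (simp add: face_of_Int_supporting_hyperplane_ge)
  have unz: "rvec (u i) \<noteq> 0" using u_nz[of i] by (metis rvec_eq_iff rvec_simps(4))
  have "\<rho> i \<subseteq> span {rvec (u i)}"
  proof
    fix w assume "w \<in> \<rho> i"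
    then have w: "w \<bullet> d v k = 0" if "k \<in> tight v - {i}" for k using that by (auto simp: \<rho>_vertex[OF v i])
    have "w \<bullet> y = ((w \<bullet> d v i) *\<^sub>R rvec (u i)) \<bullet> y" for y
    proof -
      have "w \<bullet> y = y \<bullet> w" by (rule inner_commute)
      also have "\<dots> = (\<Sum>k\<in>tight v. (y \<bullet> rvec (u k)) * (w \<bullet> d v k))"
          by (rule expand_tight[OF v])
      also have "\<dots> = (\<Sum>k\<in>tight v. if k = i then (y \<bullet> rvec (u i)) * (w \<bullet> d v i) else 0)"
        using w by (intro sum.cong) auto
      finally show ?thesis using i by (simp add: inner_commute)
    qed
    then have "w = (w \<bullet> d v i) *\<^sub>R rvec (u i)" by (metis vector_eq_rdot)
    then show "w \<in> span {rvec (u i)}" by (metis span_base span_scale singletonI)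
  qed
  then have "dim (\<rho> i) \<le> dim {rvec (u i)}" by (metis dim_subset dim_span)
  moreover have "dim {rvec (u i)} \<le> dim (\<rho> i)" using u_mem_\<rho> by (intro dim_subset) auto
  moreover have "dim {rvec (u i)} = 1"
    using unz by (subst dim_eq_card_independent) auto
  ultimately have "dim (\<rho> i) = 1" by simp
  then show ?thesis using face by (simp add: cone_rays_def)
qed

text \<open>The generator \<open>u i\<close> attains its minimum over \<open>P\<close> at every
  point of \<open>Q\<close>, as it does on \<open>F i\<close>; so \<open>v\<close> lies on the facet
  \<open>i\<close>.\<close>

lemma ray_tight:
  assumes "\<rho> i \<in> cone_rays (normal_cone P Q)" "v \<in> Q" "v \<in> P"
  shows "i \<in> tight v"
proof -
  have "\<rho> i \<subseteq> normal_cone P Q" using assms(1) by (auto simp: cone_rays_def dest: face_of_imp_subset)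
  then have le: "v \<bullet> rvec (u i) \<le> m \<bullet> rvec (u i)" if "m \<in> P" for m
    using u_mem_\<rho>[of i] assms(2) that by (auto simp: normal_cone_def)
  obtain p where p: "p \<in> F i" using facet_F[of i] by (auto simp: facet_of_def)
  then have "v \<bullet> rvec (u i) + c i \<le> 0" using le[of p] by (auto simp: F_eq)
  moreover have "0 \<le> v \<bullet> rvec (u i) + c i" using assms(3) by (simp add: mem_P)
  ultimately show ?thesis by (simp add: tight_def)
qed

lemma vertex_rays_iff:
  assumes "v \<in> V" shows "\<rho> i \<in> cone_rays (normal_cone P {v}) \<longleftrightarrow> i \<in> tight v"
  using vertex_ray[OF assms] ray_tight[of i "{v}" v] assms by (auto simp: V_iff extreme_point_of_def)

lemma vertex_cone_in_fan: "v \<in> V \<Longrightarrow> normal_cone P {v} \<in> normal_fan P"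
  unfolding normal_fan_def V_iff by (auto simp: face_of_singleton intro!: exI[of _ "{v}"])

section \<open>The finite group of the fan\<close>

abbreviation "G\<Sigma> \<equiv> grp_fan \<rho> u (normal_fan P)"

text \<open>Every cone of the fan is contained in that of a vertex: a nonempty face has an extreme
  point, and the rays of the normal cone of the face are tight there. Finiteness of the union
  follows from finiteness at each vertex.\<close>

lemma grp_fan_subset: "G\<Sigma> \<subseteq> (\<Union>v\<in>V. {g\<in>grp_G u. \<forall>i. i \<notin> tight v
    \<longrightarrow> g $ i = 1})"
proof
  fix g assume "g \<in> G\<Sigma>"
  then obtain Q where Q: "Q face_of P" "Q \<noteq> {}" "g \<in> grp_cone \<rho> u (normal_cone P Q)"
    by (auto simp: grp_fan_def normal_fan_def)
  have "compact P" "convex P" using polytope_P polytope_imp_compact polytope_imp_convex by auto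
  then have "compact Q" "convex Q" using Q(1) face_of_imp_compact face_of_imp_convex by blast+
  then obtain v where v: "v extreme_point_of Q" using Q(2) extreme_point_exists_convex by blast
  then have vV: "v \<in> V" and vQ: "v \<in> Q" using extreme_point_of_face[OF Q(1)] by (auto simp: V_iff)
  have vP: "v \<in> P" using vV by (simp add: V_iff extreme_point_of_def)
  have "g $ i = 1" if "i \<notin> tight v" for i
    using that ray_tight[of i Q v] vQ vP Q(3) by (auto simp: grp_cone_def)
  moreover have "g \<in> grp_G u" using Q(3) by (simp add: grp_cone_def)
  ultimately show "g \<in> (\<Union>v\<in>V. {g\<in>grp_G u. \<forall>i. i \<notin> tight v \<longrightarrow> g $
      i = 1})" using vV by blast
qed

sublocale lattice_hpolytope_todd u c G\<Sigma> K
proof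
  show "finite G\<Sigma>"
    by (rule finite_subset[OF grp_fan_subset]) (use finite_V finite_grp_vertex in auto)
  fix v assume v: "v \<in> V"
  show "{g \<in> G\<Sigma>. \<forall>i. i \<notin> tight v \<longrightarrow> g $ i = 1}
      = {g \<in> grp_G u. \<forall>i. i \<notin> tight v \<longrightarrow> g $ i = 1}"
  proof (intro equalityI subsetI)
    fix g assume "g \<in> {g \<in> grp_G u. \<forall>i. i \<notin> tight v \<longrightarrow> g $ i = 1}"
    then have "g \<in> grp_cone \<rho> u (normal_cone P {v})"
      using vertex_ray[OF v] by (auto simp: grp_cone_def)
    then show "g \<in> {g \<in> G\<Sigma>. \<forall>i. i \<notin> tight v \<longrightarrow> g $ i = 1}"
      using vertex_cone_in_fan[OF v] \<open>g \<in> {g \<in> grp_G u. _}\<close> by (auto simp: grp_fan_def)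
  qed (use grp_fan_subset in auto)
qed

lemma of_bool_le_slack:
  "of_bool b \<le> rvec m \<bullet> rvec (u i) + c i \<longleftrightarrow>
     0 \<le> rvec m \<bullet> rvec (u i) + c i \<and> (b \<longrightarrow> rvec m \<bullet> rvec (u i) + c i \<noteq> 0)"
proof -
  have "rvec m \<bullet> rvec (u i) + c i = real_of_int (ipair m (u i) + c i)" by (simp add: rvec_inner)
  moreover have "of_bool b \<le> real_of_int n \<longleftrightarrow> 0
      \<le> real_of_int n \<and> (b \<longrightarrow> real_of_int n \<noteq> 0)" for n
    by (cases b) auto
  ultimately show ?thesis by metis
qed

lemma lattice_pts_removed: "lattice_pts (P - (\<Union>i\<in>K. F i)) = lattice_K"
  unfolding lattice_pts_def lattice_K_def of_bool_le_slack
  by (auto simp: F_eq mem_P)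

theorem polynomial_case:
  fixes f :: "real ^ 'n \<Rightarrow> complex"
  assumes "polynomial_function f"
  shows "todd_at_0 G\<Sigma> K (\<lambda>h. LINT m:polytope_shift u c h|lborel. f m)
             (\<Sum>m\<in>lattice_pts (P - (\<Union>i\<in>K. F i)). f (rvec m))"
proof -
  have "polytope_shift u c h = hpoly h" for h by (simp add: polytope_shift_def hpoly_def)
  then show ?thesis using todd_formula_polynomial[OF assms] by (simp add: todd_formula_def lattice_pts_removed)
qed

section \<open>Tangent cones at the vertices\<close>

lemma lattice_hull: obtains W where "W \<subseteq> lattice_pts P" "P = convex hull (rvec ` W)"
proof -
  obtain W :: "(int ^ 'n) set" where W: "P = convex hull (rvec ` W)"
    using lattice_P by (auto simp: lattice_polytope_def)
  then have "rvec ` W \<subseteq> P" by (simp add: hull_subset)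
  then have "W \<subseteq> lattice_pts P" by (auto simp: lattice_pts_def)
  then show ?thesis using W by (rule that)
qed

lemma dual_vertex_cone:
  assumes v: "v \<in> V"
  shows "dual_cone (vertex_cone P v) = normal_cone P {v}"
proof (intro equalityI subsetI)
  fix w assume w: "w \<in> dual_cone (vertex_cone P v)"
  obtain W where W: "W \<subseteq> lattice_pts P" "P = convex hull (rvec ` W)" using lattice_hull by blast
  have "v \<bullet> w \<le> rvec m \<bullet> w" if "m \<in> W" for m
  proof -
    have "rvec m - v \<in> vertex_cone P v"
      unfolding vertex_cone_def using that W(1) by (intro hull_inc) auto
    then have "0 \<le> (rvec m - v) \<bullet> w" using w by (simp add: dual_cone_def)
    then show ?thesis by (simp add: inner_diff_left)
  qed
  then have "P \<subseteq> {m. w \<bullet> m \<ge> v \<bullet> w}"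
    unfolding W(2) by (intro hull_minimal convex_halfspace_ge) (auto simp: inner_commute)
  then show "w \<in> normal_cone P {v}" by (auto simp: normal_cone_def inner_commute)
next
  fix w assume w: "w \<in> normal_cone P {v}"
  have "vertex_cone P v \<subseteq> {x. w \<bullet> x \<ge> 0}"
    unfolding vertex_cone_def
    by (intro hull_minimal convex_cone_halfspace_ge)
       (use w in \<open>auto simp: normal_cone_def lattice_pts_def inner_diff_right inner_commute\<close>)
  then show "w \<in> dual_cone (vertex_cone P v)" by (auto simp: dual_cone_def inner_commute)
qed

lemma vertex_cone_eq:
  assumes v: "v \<in> V"
  shows "vertex_cone P v = {x. \<forall>i\<in>tight v. 0 \<le> x \<bullet> rvec (u i)}"
proof (intro equalityI)
  have cc: "convex_cone {x. \<forall>i\<in>tight v. 0 \<le> x \<bullet> rvec (u i)}"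
  proof -
    have "{x. \<forall>i\<in>tight v. 0 \<le> x \<bullet> rvec (u i)}
        = \<Inter> ((\<lambda>i. {x. rvec (u i) \<bullet> x \<ge> 0}) ` tight v)"
      by (auto simp: inner_commute)
    moreover have "convex_cone \<dots>"
      by (rule convex_cone_Inter) (auto simp: convex_cone_halfspace_ge)
    ultimately show ?thesis by simp
  qed
  show "vertex_cone P v \<subseteq> {x. \<forall>i\<in>tight v. 0 \<le> x \<bullet> rvec (u i)}"
    unfolding vertex_cone_def
  proof (rule hull_minimal[where S = convex_cone, OF _ cc], clarify)
    fix m i assume "m \<in> lattice_pts P" "i \<in> tight v"
    then have "0 \<le> rvec m \<bullet> rvec (u i) + c i" "v \<bullet> rvec (u i) + c i = 0"
      by (auto simp: lattice_pts_def mem_P tight_def)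
    then show "0 \<le> (rvec m - v) \<bullet> rvec (u i)" unfolding inner_diff_left by linarith
  qed
  show "{x. \<forall>i\<in>tight v. 0 \<le> x \<bullet> rvec (u i)} \<subseteq> vertex_cone P v"
  proof
    let ?C = "vertex_cone P v"
    have C: "convex_cone ?C" unfolding vertex_cone_def by (rule convex_cone_convex_cone_hull)
    obtain W where W: "W \<subseteq> lattice_pts P" "P = convex hull (rvec ` W)" using lattice_hull by blast
    have "convex ((\<lambda>x. v + x) ` ?C)" using C by (intro convex_translation) (simp add: convex_cone_def)
    moreover have "rvec ` W \<subseteq> (\<lambda>x. v + x) ` ?C"
    proof (rule image_subsetI)
      fix m assume "m \<in> W"
      then have "rvec m - v \<in> ?C" unfolding vertex_cone_def using W(1) by (intro hull_inc) auto
      then show "rvec m \<in> (\<lambda>x. v + x) ` ?C" by (intro image_eqI[of _ _ "rvec m - v"]) auto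
    qed
    ultimately have PC: "P \<subseteq> (\<lambda>x. v + x) ` ?C" unfolding W(2) by (intro hull_minimal)
    fix x assume "x \<in> {x. \<forall>i\<in>tight v. 0 \<le> x \<bullet> rvec (u i)}"
    then obtain e where e: "e > 0" "\<And>t. 0 \<le> t \<Longrightarrow> t \<le> e
        \<Longrightarrow> v + t *\<^sub>R x \<in> hpoly 0"
      using small_step[of v x] V_in[OF v] by auto
    have "v + e *\<^sub>R x \<in> P" using e by (simp add: P_hpoly)
    then have "e *\<^sub>R x \<in> ?C" using PC by auto
    then show "x \<in> ?C" using convex_cone_scaleR[OF C, of "1 / e" "e *\<^sub>R x"] e(1) by simp
  qed
qed

lemma lattice_pts_tangent_removed:
  assumes v: "v \<in> V"
  shows "lattice_pts (tangent_removed \<rho> u c P v (normal_cone P {v}) K) = cone_lattice_K v"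
proof -
  have "m \<in> tangent P v \<longleftrightarrow> (\<forall>i\<in>tight v. 0 \<le> m \<bullet> rvec (u i) + c i)" for m
  proof -
    have "m \<in> tangent P v \<longleftrightarrow> m - v \<in> vertex_cone P v"
      unfolding tangent_def by (auto intro!: image_eqI[of _ _ "m - v"])
    also have "\<dots> \<longleftrightarrow> (\<forall>i\<in>tight v. 0 \<le> m \<bullet> rvec (u i) + c i)"
      unfolding vertex_cone_eq[OF v] by (auto simp: tight_def inner_diff_left)
    finally show ?thesis .
  qed
  then show ?thesis
    unfolding lattice_pts_def cone_lattice_K_def of_bool_le_slack tangent_removed_def vertex_rays_iff[OF v]
    by auto
qed

lemma norm_cvec: "norm (cvec w) = norm w"
  by (simp add: norm_vec_def cvec_def L2_set_def)

lemma cpair_cvec: "cpair m (- cvec w) = - of_real (m \<bullet> w)"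
  by (simp add: cpair_def cvec_def inner_vec_def sum_negf)

text \<open>Membership of \<open>- z\<close> in the interior makes \<open>z\<close> the negative of
  a real vector \<open>w\<close> with positive slope along all edges at \<open>v\<close>, so that
  \<open>cone_local\<close> applies with \<open>\<xi> = w\<close>.\<close>

theorem local_case:
  assumes v: "v extreme_point_of P" and \<sigma>: "\<sigma> = dual_cone (vertex_cone P v)"
  shows "\<sigma> \<in> normal_fan P" "dim \<sigma> = CARD('n)"
    "\<exists>\<epsilon>>0. \<forall>z :: complex ^ 'n. norm z
        < \<epsilon> \<and> - z \<in> cvec ` interior \<sigma> \<longrightarrow>
              (\<forall>h. set_integrable lborel (tangent_shift \<rho> u c \<sigma> h) (\<lambda>m. exp (cpair m z))) \<and>
              (\<lambda>m. exp (cpair (rvec m) z)) summable_on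
                lattice_pts (tangent_removed \<rho> u c P v \<sigma> K) \<and>
              todd_at_0 G\<Sigma> K
                (\<lambda>h. LINT m:tangent_shift \<rho> u c \<sigma> h|lborel. exp (cpair m z))
                (\<Sum>\<^sub>\<infinity>m\<in>lattice_pts (tangent_removed \<rho> u c P v \<sigma> K).
                   exp (cpair (rvec m) z))"
    (is "\<exists>\<epsilon>>0. \<forall>z. ?small \<epsilon> z \<longrightarrow> ?claim z")
proof -
  have vV: "v \<in> V" using v by (simp add: V_iff)
  have \<sigma>_eq: "\<sigma> = normal_cone P {v}" using dual_vertex_cone[OF vV] \<sigma> by simp
  show "\<sigma> \<in> normal_fan P" unfolding \<sigma>_eq by (rule vertex_cone_in_fan[OF vV])
  show "dim \<sigma> = CARD('n)"
  proof (rule ccontr)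
    assume "dim \<sigma> \<noteq> CARD('n)"
    then have "dim \<sigma> < DIM(real ^ 'n)" using dim_subset_UNIV[of \<sigma>] by simp
    then obtain x where x: "x \<noteq> 0" "\<And>y. y \<in> span \<sigma> \<Longrightarrow> orthogonal x y"
      using orthogonal_to_subspace_exists by blast
    have "x \<bullet> rvec (u i) = 0" if "i \<in> tight v" for i
    proof -
      have "\<rho> i \<subseteq> \<sigma>" using vertex_ray[OF vV that]
          by (auto simp: \<sigma>_eq cone_rays_def dest: face_of_imp_subset)
      then have "rvec (u i) \<in> span \<sigma>" using u_mem_\<rho>[of i] by (auto intro: span_base)
      then show ?thesis using x(2) by (simp add: orthogonal_def)
    qed
    then show False using extreme_orth[OF vV] x(1) by blast
  qed
  obtain r where r: "r > 0" "\<And>g i b. g \<in> G\<Sigma>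
      \<Longrightarrow> ereal r < fps_conv_radius (todd_factor b (g $ i))"
    using todd_common_radius[OF finite_\<Gamma>] by blast
  \<comment> \<open>\<open>M\<close> dominates the lengths of the edge directions and is positive
    thanks to the \<open>1\<close>. With \<open>\<epsilon> = r / (2 * M)\<close> every coordinate of
    \<open>w\<close> is at most \<open>r / 2\<close>.\<close>
  define M where "M = 1 + (\<Sum>i\<in>UNIV. norm (d v i))"
  have M: "M > 0" by (simp add: M_def add_pos_nonneg sum_nonneg)
  define \<epsilon> where "\<epsilon> = r / (2 * M)"
  have \<epsilon>: "\<epsilon> > 0" using r M by (simp add: \<epsilon>_def)
  have shift: "tangent_shift \<rho> u c \<sigma> h = cone_region v h" for h
    by (auto simp: tangent_shift_def cone_region_def \<sigma>_eq vertex_rays_iff[OF vV])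
  have pts: "lattice_pts (tangent_removed \<rho> u c P v \<sigma> K) = cone_lattice_K v"
    unfolding \<sigma>_eq by (rule lattice_pts_tangent_removed[OF vV])
  have "?claim z"
    if z: "norm z < \<epsilon>" "- z \<in> cvec ` interior \<sigma>" for z :: "complex ^ 'n"
  proof -
    obtain w where w: "w \<in> interior \<sigma>" "- z = cvec w" using z(2) by blast
    have zw: "z = - cvec w" using w(2) by (metis minus_minus)
    have nw: "norm w < \<epsilon>" using z(1) by (simp add: zw norm_cvec)
    have pos: "w \<bullet> d v i > 0" if i: "i \<in> tight v" for i
    proof -
      have nz: "d v i \<noteq> 0" using dual_tight[OF vV i i] by auto
      have "\<sigma> \<subseteq> {x. d v i \<bullet> x \<ge> 0}"
          using i by (auto simp: \<sigma>_eq vertex_normal_cone[OF vV] inner_commute)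
      then have "interior \<sigma> \<subseteq> {x. d v i \<bullet> x > 0}"
        using interior_mono[of \<sigma> "{x. d v i \<bullet> x \<ge> 0}"] interior_halfspace_ge[OF nz, of 0] by simp
      then show ?thesis using w(1) by (auto simp: inner_commute)
    qed
    have small: "\<bar>coord v w i\<bar> * 2 \<le> r" for i
    proof -
      have "\<bar>coord v w i\<bar> \<le> norm w * norm (d v i)"
        by (auto simp: coord_def Cauchy_Schwarz_ineq2)
      also have "norm (d v i) \<le> M"
        using member_le_sum[of i UNIV "\<lambda>i. norm (d v i)"] by (simp add: M_def)
      then have "norm w * norm (d v i) \<le> \<epsilon> * M" using nw M \<epsilon> by (intro mult_mono) auto
      also have "\<epsilon> * M = r / 2" using M by (simp add: \<epsilon>_def)
      finally show ?thesis by simp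
    qed
    note loc = cone_local[OF vV pos r(2) small]
    show ?thesis
      unfolding shift pts zw cpair_cvec
      using loc by (auto simp: has_sum_iff)
  qed
  then show "\<exists>\<epsilon>>0. \<forall>z. ?small \<epsilon> z \<longrightarrow> ?claim z"
    using \<epsilon> by blast
qed

end

theorem theorem5p25:
  fixes P :: "(real ^ 'n) set"
    and F :: "'r::{finite,linorder} \<Rightarrow> (real ^ 'n) set"
    and \<rho> :: "'r \<Rightarrow> (real ^ 'n) set"
    and u :: "'r \<Rightarrow> int ^ 'n"
    and c :: "'r \<Rightarrow> int"
    and \<Sigma> :: "(real ^ 'n) set set"
    and K :: "'r set"
  assumes "lattice_polytope P"
    and "aff_dim P = int CARD('n)"
    and "simple_polytope P"
    and "bij_betw F UNIV {Q. Q facet_of P}"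
    and "\<Sigma> = normal_fan P"
    and "\<And>i. \<rho> i = normal_cone P (F i)"
    and "\<And>i. ray_generator (\<rho> i) (u i)"
    and "P = {m. \<forall>i. 0 \<le> m \<bullet> rvec (u i) + of_int (c i)}"
  shows "(\<forall>f :: real ^ 'n \<Rightarrow> complex. polynomial_function f \<longrightarrow>
           todd_at_0 (grp_fan \<rho> u \<Sigma>) K
             (\<lambda>h. LINT m:polytope_shift u c h|lborel. f m)
             (\<Sum>m\<in>lattice_pts (P - (\<Union>i\<in>K. F i)). f (rvec m))) \<and>
         (\<forall>v \<sigma>. v extreme_point_of P \<and> \<sigma> = dual_cone (vertex_cone P v) \<longrightarrow>
           \<sigma> \<in> \<Sigma> \<and> dim \<sigma> = CARD('n) \<and>
           (\<exists>\<epsilon>>0. \<forall>z :: complex ^ 'n. norm z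
               < \<epsilon> \<and> - z \<in> cvec ` interior \<sigma> \<longrightarrow>
              (\<forall>h. set_integrable lborel (tangent_shift \<rho> u c \<sigma> h) (\<lambda>m. exp (cpair m z))) \<and>
              (\<lambda>m. exp (cpair (rvec m) z)) summable_on
                lattice_pts (tangent_removed \<rho> u c P v \<sigma> K) \<and>
              todd_at_0 (grp_fan \<rho> u \<Sigma>) K
                (\<lambda>h. LINT m:tangent_shift \<rho> u c \<sigma> h|lborel. exp (cpair m z))
                (\<Sum>\<^sub>\<infinity>m\<in>lattice_pts (tangent_removed \<rho> u c P v \<sigma> K).
                   exp (cpair (rvec m) z))))"
proof -
  interpret simple_lattice_polytope P F \<rho> u c K
    by (rule simple_lattice_polytope.intro) (fact assms)+
  show ?thesis
    unfolding assms(5)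
  proof (rule conjI; intro allI impI; (elim conjE, intro conjI)?)
    fix f :: "real ^ 'n \<Rightarrow> complex"
    assume "polynomial_function f"
    then show "todd_at_0 G\<Sigma> K (\<lambda>h. LINT m:polytope_shift u c h|lborel. f m)
        (\<Sum>m\<in>lattice_pts (P - (\<Union>i\<in>K. F i)). f (rvec m))"
      by (rule polynomial_case)
  qed (fact local_case)+
qed

end
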